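(* Let $\mathcal{E}$ be a skeletal connected finite free EI category. If every object in $\mathcal{E}$ is either left regular or right regular, then $k\mathcal{E}$, with the length grading, is a quasi-Koszul algebra.
   Context: $k$ is an algebraically closed field. A finite EI category is a category with finitely many morphisms in which every endomorphism is an isomorphism. It is skeletal if isomorphic objects are equal, and connected if any two objects $x,y$ are joined by a chain $x=x_0,\dots,x_n=y$ with $\mathcal{E}(x_i,x_{i+1})\neq\emptyset$ or $\mathcal{E}(x_{i+1},x_i)\neq\emptyset$ for each $i$. The category algebra $k\mathcal{E}$ has the morphisms of $\mathcal{E}$ as basis, with product $\beta\cdot\alpha=\beta\circ\alpha$ when composable and $0$ otherwise; modules are left modules. A morphism $\alpha$ is unfactorizable if it is not an automorphism and whenever $\alpha=\alpha_1\circ\alpha_2$, one of $\alpha_1,\alpha_2$ is an automorphism. $\mathcal{E}$ is a finite free EI category if it satisfies the Unique Factorization Property: whenever a non-isomorphism has two decompositions into unfactorizable morphisms $x=x_0\xrightarrow{\alpha_1}x_1\to\cdots\xrightarrow{\alpha_m}x_m=y$ and $x=y_0\xrightarrow{\beta_1}y_1\to\cdots\xrightarrow{\beta_n}y_n=y$, then $m=n$, $x_i=y_i$ for all $i$, and there are $h_i\in\operatorname{Aut}_{\mathcal{E}}(x_i)$, $1\leqslant i\leqslant n-1$, such that, with $h_0=1$ and $h_n=1$, $h_i\alpha_i=\beta_ih_{i-1}$ for $1\leqslant i\leqslant n$. Length grading: automorphisms have degree $0$, and a composite of $n$ unfactorizable morphisms has degree $n$. $k\mathcal{E}_0=\bigoplus_xk\operatorname{Aut}_{\mathcal{E}}(x)$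 is viewed as a $k\mathcal{E}$-module as the quotient of $k\mathcal{E}$ by the span of all non-isomorphisms. $k\mathcal{E}$ is a quasi-Koszul algebra if, for the Yoneda product, $\operatorname{Ext}^1_{k\mathcal{E}}(k\mathcal{E}_0,k\mathcal{E}_0)\cdot\operatorname{Ext}^i_{k\mathcal{E}}(k\mathcal{E}_0,k\mathcal{E}_0)=\operatorname{Ext}^{i+1}_{k\mathcal{E}}(k\mathcal{E}_0,k\mathcal{E}_0)$ for all $i\geqslant0$. An object $x$ is left regular if for every morphism $\alpha$ with target $x$, the stabilizer $\{g\in\operatorname{Aut}_{\mathcal{E}}(x):g\alpha=\alpha\}$ has order invertible in $k$. It is right regular if for every morphism $\beta$ with source $x$, the stabilizer $\{g\in\operatorname{Aut}_{\mathcal{E}}(x):\beta g=\beta\}$ has order invertible in $k$. *)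

theory Defs
  imports
    "HOL-Algebra.Module"
    "HOL-Algebra.AbelCoset"
    "HOL-Algebra.Generated_Groups"
    "HOL-Computational_Algebra.Polynomial"
begin

section \<open>Finite EI categories\<close>

record ('o, 'm) category =
  Obj :: "'o set"
  Mor :: "'m set"
  Dom :: "'m \<Rightarrow> 'o"
  Cod :: "'m \<Rightarrow> 'o"
  Ident :: "'o \<Rightarrow> 'm"
  Comp :: "'m \<Rightarrow> 'm \<Rightarrow> 'm"  (infixr \<open>\<cdot>\<index>\<close> 75)

text \<open>\<open>g \<cdot> f\<close> is ``first \<open>f\<close>, then \<open>g\<close>''; it is meaningful only if
  \<open>Dom g = Cod f\<close>.\<close>

locale category =
  fixes E :: "('o, 'm) category" (structure)
  assumes Dom_closed: "f \<in> Mor E \<Longrightarrow> Dom E f \<in> Obj E"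
    and Cod_closed: "f \<in> Mor E \<Longrightarrow> Cod E f \<in> Obj E"
    and Id_closed: "x \<in> Obj E \<Longrightarrow> Ident E x \<in> Mor E"
    and Dom_Id: "x \<in> Obj E \<Longrightarrow> Dom E (Ident E x) = x"
    and Cod_Id: "x \<in> Obj E \<Longrightarrow> Cod E (Ident E x) = x"
    and Comp_closed: "\<lbrakk>g \<in> Mor E; f \<in> Mor E; Dom E g = Cod E f\<rbrakk> \<Longrightarrow> g \<cdot> f \<in> Mor E"
    and Dom_Comp: "\<lbrakk>g \<in> Mor E; f \<in> Mor E; Dom E g = Cod E f\<rbrakk> \<Longrightarrow> Dom E (g \<cdot> f) = Dom E f"
    and Cod_Comp: "\<lbrakk>g \<in> Mor E; f \<in> Mor E; Dom E g = Cod E f\<rbrakk> \<Longrightarrow> Cod E (g \<cdot> f) = Cod E g"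
    and Id_left: "f \<in> Mor E \<Longrightarrow> Ident E (Cod E f) \<cdot> f = f"
    and Id_right: "f \<in> Mor E \<Longrightarrow> f \<cdot> Ident E (Dom E f) = f"
    and Comp_assoc: "\<lbrakk>h \<in> Mor E; g \<in> Mor E; f \<in> Mor E; Dom E h = Cod E g; Dom E g = Cod E f\<rbrakk>
      \<Longrightarrow> (h \<cdot> g) \<cdot> f = h \<cdot> (g \<cdot> f)"

definition Hom :: "('o, 'm) category \<Rightarrow> 'o \<Rightarrow> 'o \<Rightarrow> 'm set" where
  "Hom E x y = {f \<in> Mor E. Dom E f = x \<and> Cod E f = y}"

definition iso_mor :: "('o, 'm) category \<Rightarrow> 'm \<Rightarrow> bool" where
  "iso_mor E f \<longleftrightarrow> f \<in> Mor E \<and>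
     (\<exists>g \<in> Hom E (Cod E f) (Dom E f).
        g \<cdot>\<^bsub>E\<^esub> f = Ident E (Dom E f) \<and> f \<cdot>\<^bsub>E\<^esub> g = Ident E (Cod E f))"

definition Aut :: "('o, 'm) category \<Rightarrow> 'o \<Rightarrow> 'm set" where
  "Aut E x = {f \<in> Hom E x x. iso_mor E f}"

definition is_aut :: "('o, 'm) category \<Rightarrow> 'm \<Rightarrow> bool" where
  "is_aut E f \<longleftrightarrow> (\<exists>x \<in> Obj E. f \<in> Aut E x)"

locale finite_EI_category = category +
  assumes finite_Mor: "finite (Mor E)"
    and EI: "f \<in> Hom E x x \<Longrightarrow> iso_mor E f"

definition skeletal :: "('o, 'm) category \<Rightarrow> bool" where
  "skeletal E \<longleftrightarrow> (\<forall>x \<in> Obj E. \<forall>y \<in> Obj E. (\<exists>f \<in> Hom E x y. iso_mor E f) \<longrightarrow> x = y)"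

definition adjacent :: "('o, 'm) category \<Rightarrow> ('o \<times> 'o) set" where
  "adjacent E = {(x, y). x \<in> Obj E \<and> y \<in> Obj E \<and> (Hom E x y \<noteq> {} \<or> Hom E y x \<noteq> {})}"

definition connected_category :: "('o, 'm) category \<Rightarrow> bool" where
  "connected_category E \<longleftrightarrow> (\<forall>x \<in> Obj E. \<forall>y \<in> Obj E. (x, y) \<in> (adjacent E)\<^sup>*)"

definition unfactorizable :: "('o, 'm) category \<Rightarrow> 'm \<Rightarrow> bool" where
  "unfactorizable E a \<longleftrightarrow> a \<in> Mor E \<and> \<not> is_aut E a \<and>
     (\<forall>a1 \<in> Mor E. \<forall>a2 \<in> Mor E. Dom E a1 = Cod E a2 \<and> a = a1 \<cdot>\<^bsub>E\<^esub> a2 \<longrightarrow>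
        is_aut E a1 \<or> is_aut E a2)"

text \<open>A path \<open>x = x\<^sub>0 \<rightarrow> x\<^sub>1 \<rightarrow> \<dots> \<rightarrow> x\<^sub>n = y\<close> is given by \<open>x\<close> and the list of its arrows in
  order of application; the arrow called \<open>\<alpha>\<^sub>i\<close> (\<open>1 \<le> i \<le> n\<close>) in the usual notation is
  \<open>as ! (i - 1)\<close>.\<close>

fun is_path :: "('o, 'm) category \<Rightarrow> 'o \<Rightarrow> 'm list \<Rightarrow> 'o \<Rightarrow> bool" where
  "is_path E x [] y \<longleftrightarrow> x \<in> Obj E \<and> x = y"
| "is_path E x (a # as) y \<longleftrightarrow> a \<in> Mor E \<and> Dom E a = x \<and> is_path E (Cod E a) as y"

fun composite :: "('o, 'm) category \<Rightarrow> 'o \<Rightarrow> 'm list \<Rightarrow> 'm" where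
  "composite E x [] = Ident E x"
| "composite E x (a # as) = composite E (Cod E a) as \<cdot>\<^bsub>E\<^esub> a"

definition vertex :: "('o, 'm) category \<Rightarrow> 'o \<Rightarrow> 'm list \<Rightarrow> nat \<Rightarrow> 'o" where
  "vertex E x as i = (case i of 0 \<Rightarrow> x | Suc j \<Rightarrow> Cod E (as ! j))"

definition is_decomposition :: "('o, 'm) category \<Rightarrow> 'm \<Rightarrow> 'm list \<Rightarrow> bool" where
  "is_decomposition E f as \<longleftrightarrow>
     is_path E (Dom E f) as (Cod E f) \<and> (\<forall>a \<in> set as. unfactorizable E a) \<and>
     composite E (Dom E f) as = f"

definition unique_factorization :: "('o, 'm) category \<Rightarrow> bool" where
  "unique_factorization E \<longleftrightarrow>
     (\<forall>f \<in> Mor E. \<not> iso_mor E f \<longrightarrow>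
       (\<forall>as bs. is_decomposition E f as \<and> is_decomposition E f bs \<longrightarrow>
          length as = length bs \<and>
          (\<forall>i \<le> length as. vertex E (Dom E f) as i = vertex E (Dom E f) bs i) \<and>
          (\<exists>h. h 0 = Ident E (Dom E f) \<and> h (length as) = Ident E (Cod E f) \<and>
             (\<forall>i. 1 \<le> i \<and> i < length as \<longrightarrow> h i \<in> Aut E (vertex E (Dom E f) as i)) \<and>
             (\<forall>i. 1 \<le> i \<and> i \<le> length as \<longrightarrow>
                h i \<cdot>\<^bsub>E\<^esub> (as ! (i - 1)) = (bs ! (i - 1)) \<cdot>\<^bsub>E\<^esub> h (i - 1)))))"

locale finite_free_EI_category = finite_EI_category +
  assumes UFP: "unique_factorization E"

definition left_regular :: "'k::field itself \<Rightarrow> ('o, 'm) category \<Rightarrow> 'o \<Rightarrow> bool" where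
  "left_regular _ E x \<longleftrightarrow>
     (\<forall>a \<in> Mor E. Cod E a = x \<longrightarrow> (of_nat (card {g \<in> Aut E x. g \<cdot>\<^bsub>E\<^esub> a = a}) :: 'k) \<noteq> 0)"

definition right_regular :: "'k::field itself \<Rightarrow> ('o, 'm) category \<Rightarrow> 'o \<Rightarrow> bool" where
  "right_regular _ E x \<longleftrightarrow>
     (\<forall>b \<in> Mor E. Dom E b = x \<longrightarrow> (of_nat (card {g \<in> Aut E x. b \<cdot>\<^bsub>E\<^esub> g = b}) :: 'k) \<noteq> 0)"

section \<open>Left modules over a ring\<close>

text \<open>The library locale \<^locale>\<open>module\<close> is restricted to commutative rings; only its record type
  is reused.\<close>

locale left_module = R?: ring R + M?: abelian_group M
  for R :: "('a, 'r) ring_scheme" (structure) and M :: "('a, 'b, 'c) module_scheme" (structure) +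
  assumes smult_closed: "\<lbrakk>a \<in> carrier R; x \<in> carrier M\<rbrakk> \<Longrightarrow> a \<odot>\<^bsub>M\<^esub> x \<in> carrier M"
    and smult_l_distr: "\<lbrakk>a \<in> carrier R; b \<in> carrier R; x \<in> carrier M\<rbrakk> \<Longrightarrow>
      (a \<oplus>\<^bsub>R\<^esub> b) \<odot>\<^bsub>M\<^esub> x = a \<odot>\<^bsub>M\<^esub> x \<oplus>\<^bsub>M\<^esub> b \<odot>\<^bsub>M\<^esub> x"
    and smult_r_distr: "\<lbrakk>a \<in> carrier R; x \<in> carrier M; y \<in> carrier M\<rbrakk> \<Longrightarrow>
      a \<odot>\<^bsub>M\<^esub> (x \<oplus>\<^bsub>M\<^esub> y) = a \<odot>\<^bsub>M\<^esub> x \<oplus>\<^bsub>M\<^esub> a \<odot>\<^bsub>M\<^esub> y"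
    and smult_assoc1: "\<lbrakk>a \<in> carrier R; b \<in> carrier R; x \<in> carrier M\<rbrakk> \<Longrightarrow>
      (a \<otimes>\<^bsub>R\<^esub> b) \<odot>\<^bsub>M\<^esub> x = a \<odot>\<^bsub>M\<^esub> (b \<odot>\<^bsub>M\<^esub> x)"
    and smult_one: "x \<in> carrier M \<Longrightarrow> \<one>\<^bsub>R\<^esub> \<odot>\<^bsub>M\<^esub> x = x"

text \<open>Homomorphisms are extensional, so that equality of homomorphisms is equality in HOL.\<close>

definition lmod_hom :: "'a ring \<Rightarrow> ('a, 'b) module \<Rightarrow> ('a, 'c) module \<Rightarrow> ('b \<Rightarrow> 'c) set" where
  "lmod_hom R M N = {f \<in> carrier M \<rightarrow>\<^sub>E carrier N.
     (\<forall>x \<in> carrier M. \<forall>y \<in> carrier M. f (x \<oplus>\<^bsub>M\<^esub> y) = f x \<oplus>\<^bsub>N\<^esub> f y) \<and>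
     (\<forall>a \<in> carrier R. \<forall>x \<in> carrier M. f (a \<odot>\<^bsub>M\<^esub> x) = a \<odot>\<^bsub>N\<^esub> f x)}"

definition hom_group :: "'a ring \<Rightarrow> ('a, 'b) module \<Rightarrow> ('a, 'c) module \<Rightarrow> ('b \<Rightarrow> 'c) monoid" where
  "hom_group R M N = \<lparr>carrier = lmod_hom R M N,
     monoid.mult = (\<lambda>f g. \<lambda>x \<in> carrier M. f x \<oplus>\<^bsub>N\<^esub> g x),
     one = (\<lambda>x \<in> carrier M. \<zero>\<^bsub>N\<^esub>)\<rparr>"

text \<open>In the module records below the ring fields \<^const>\<open>monoid.mult\<close> and \<^const>\<open>one\<close> carry no
  information.\<close>

definition regular_module :: "'a ring \<Rightarrow> ('a, 'a) module" where
  "regular_module R = \<lparr>carrier = carrier R, monoid.mult = monoid.mult R, one = one R,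
     zero = zero R, add = add R, module.smult = monoid.mult R\<rparr>"

definition quotient_module :: "('a, 'b) module \<Rightarrow> 'b set \<Rightarrow> ('a, 'b set) module" where
  "quotient_module M N = \<lparr>carrier = a_rcosets\<^bsub>M\<^esub> N, monoid.mult = undefined, one = undefined,
     zero = N, add = set_add M, module.smult = (\<lambda>a X. \<Union>x \<in> X. N +>\<^bsub>M\<^esub> (a \<odot>\<^bsub>M\<^esub> x))\<rparr>"

definition free_module :: "'a ring \<Rightarrow> 'i set \<Rightarrow> ('a, 'i \<Rightarrow> 'a) module" where
  "free_module R I = \<lparr>carrier = {u. (\<forall>i. u i \<in> carrier R) \<and> (\<forall>i. i \<notin> I \<longrightarrow> u i = \<zero>\<^bsub>R\<^esub>) \<and>
       finite {i. u i \<noteq> \<zero>\<^bsub>R\<^esub>}},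
     monoid.mult = undefined, one = undefined,
     zero = (\<lambda>i. \<zero>\<^bsub>R\<^esub>), add = (\<lambda>u v i. u i \<oplus>\<^bsub>R\<^esub> v i), module.smult = (\<lambda>a u i. a \<otimes>\<^bsub>R\<^esub> u i)\<rparr>"

text \<open>A module is projective iff it is a direct summand of a free module. A projective module \<open>P\<close>
  is a summand of the free module on the set of its own elements, so restricting the index
  set \<open>I\<close> to the type of the elements of \<open>P\<close> loses nothing.\<close>

definition projective_module :: "'a ring \<Rightarrow> ('a, 'p) module \<Rightarrow> bool" where
  "projective_module R P \<longleftrightarrow> left_module R P \<and>
     (\<exists>(I :: 'p set). \<exists>s \<in> lmod_hom R P (free_module R I). \<exists>r \<in> lmod_hom R (free_module R I) P.
        \<forall>x \<in> carrier P. r (s x) = x)"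

section \<open>Ext and the Yoneda product\<close>

record ('a, 'p, 'b) resolution =
  Term :: "nat \<Rightarrow> ('a, 'p) module"
  Diff :: "nat \<Rightarrow> 'p \<Rightarrow> 'p"
  Aug :: "'p \<Rightarrow> 'b"

text \<open>\<open>Diff P n\<close> is the differential from term \<open>n + 1\<close> to term \<open>n\<close>.\<close>

definition projective_resolution ::
    "'a ring \<Rightarrow> ('a, 'b) module \<Rightarrow> ('a, 'p, 'b) resolution \<Rightarrow> bool" where
  "projective_resolution R M P \<longleftrightarrow> left_module R M \<and>
     (\<forall>n. projective_module R (Term P n)) \<and>
     (\<forall>n. Diff P n \<in> lmod_hom R (Term P (Suc n)) (Term P n)) \<and>
     Aug P \<in> lmod_hom R (Term P 0) M \<and>
     Aug P ` carrier (Term P 0) = carrier M \<and>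
     Diff P 0 ` carrier (Term P 1) = {x \<in> carrier (Term P 0). Aug P x = \<zero>\<^bsub>M\<^esub>} \<and>
     (\<forall>n. Diff P (Suc n) ` carrier (Term P (Suc (Suc n))) =
        {x \<in> carrier (Term P (Suc n)). Diff P n x = \<zero>\<^bsub>Term P n\<^esub>})"

text \<open>\<open>Ext R P N i\<close> is the cohomology of \<open>Hom\<^sub>R(P, N)\<close> in degree \<open>i\<close>; if \<open>P\<close> is a projective
  resolution of \<open>M\<close>, this is the group \<open>Ext\<^sup>i\<^sub>R(M, N)\<close>.\<close>

definition cocycles ::
    "'a ring \<Rightarrow> ('a, 'p, 'b) resolution \<Rightarrow> ('a, 'c) module \<Rightarrow> nat \<Rightarrow> ('p \<Rightarrow> 'c) set" where
  "cocycles R P N i = {f \<in> lmod_hom R (Term P i) N.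
     \<forall>x \<in> carrier (Term P (Suc i)). f (Diff P i x) = \<zero>\<^bsub>N\<^esub>}"

definition coboundaries ::
    "'a ring \<Rightarrow> ('a, 'p, 'b) resolution \<Rightarrow> ('a, 'c) module \<Rightarrow> nat \<Rightarrow> ('p \<Rightarrow> 'c) set" where
  "coboundaries R P N i = (case i of
     0 \<Rightarrow> {\<lambda>x \<in> carrier (Term P 0). \<zero>\<^bsub>N\<^esub>}
   | Suc j \<Rightarrow> (\<lambda>g. compose (carrier (Term P (Suc j))) g (Diff P j)) ` lmod_hom R (Term P j) N)"

definition Ext ::
    "'a ring \<Rightarrow> ('a, 'p, 'b) resolution \<Rightarrow> ('a, 'c) module \<Rightarrow> nat \<Rightarrow> ('p \<Rightarrow> 'c) set monoid" where
  "Ext R P N i = (hom_group R (Term P i) N)\<lparr>carrier := cocycles R P N i\<rparr> Mod coboundaries R P N i"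

definition ext_class ::
    "'a ring \<Rightarrow> ('a, 'p, 'b) resolution \<Rightarrow> ('a, 'c) module \<Rightarrow> nat \<Rightarrow> ('p \<Rightarrow> 'c) \<Rightarrow> ('p \<Rightarrow> 'c) set" where
  "ext_class R P N i f = coboundaries R P N i #>\<^bsub>hom_group R (Term P i) N\<^esub> f"

text \<open>\<open>\<phi>\<close> is a chain map from \<open>P\<close>, shifted by \<open>i\<close>, to \<open>Q\<close> over the cocycle \<open>f : P\<^sub>i \<rightarrow> M\<close>, where
  \<open>Q\<close> is a resolution of \<open>M\<close>.\<close>

definition chain_lift :: "'a ring \<Rightarrow> ('a, 'p, 'b) resolution \<Rightarrow> ('a, 'q, 'c) resolution \<Rightarrow> nat \<Rightarrow>
    ('p \<Rightarrow> 'c) \<Rightarrow> (nat \<Rightarrow> 'p \<Rightarrow> 'q) \<Rightarrow> bool" where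
  "chain_lift R P Q i f \<phi> \<longleftrightarrow>
     (\<forall>n. \<phi> n \<in> lmod_hom R (Term P (i + n)) (Term Q n)) \<and>
     (\<forall>x \<in> carrier (Term P i). Aug Q (\<phi> 0 x) = f x) \<and>
     (\<forall>n. \<forall>x \<in> carrier (Term P (Suc (i + n))).
        Diff Q n (\<phi> (Suc n) x) = \<phi> n (Diff P (i + n) x))"

text \<open>\<open>is_yoneda_product R P Q M N j i \<xi> \<eta> \<zeta>\<close> says that \<open>\<zeta> = \<xi> \<cdot> \<eta>\<close> in \<open>Ext\<^sup>i\<^sup>+\<^sup>j(L, N)\<close> for
  \<open>\<xi> \<in> Ext\<^sup>j(M, N)\<close> and \<open>\<eta> \<in> Ext\<^sup>i(L, M)\<close>, where \<open>P\<close>, \<open>Q\<close> are projective resolutions of \<open>L\<close>, \<open>M\<close>.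
  The class \<open>\<zeta>\<close> exists and depends only on \<open>\<xi>\<close> and \<open>\<eta>\<close> by the comparison theorem. The
  conventional sign is immaterial for the subgroup generated by products.\<close>

definition is_yoneda_product :: "'a ring \<Rightarrow> ('a, 'p, 'b) resolution \<Rightarrow> ('a, 'q, 'c) resolution \<Rightarrow>
    ('a, 'c) module \<Rightarrow> ('a, 'd) module \<Rightarrow> nat \<Rightarrow> nat \<Rightarrow>
    ('q \<Rightarrow> 'd) set \<Rightarrow> ('p \<Rightarrow> 'c) set \<Rightarrow> ('p \<Rightarrow> 'd) set \<Rightarrow> bool" where
  "is_yoneda_product R P Q M N j i \<xi> \<eta> \<zeta> \<longleftrightarrow>
     \<xi> \<in> carrier (Ext R Q N j) \<and> \<eta> \<in> carrier (Ext R P M i) \<and>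
     (\<exists>g \<in> \<xi>. \<exists>f \<in> \<eta>. \<exists>\<phi>. chain_lift R P Q i f \<phi> \<and>
        \<zeta> = ext_class R P N (i + j) (compose (carrier (Term P (i + j))) g (\<phi> j)))"

text \<open>\<open>Ext\<^sup>j(M, N) \<cdot> Ext\<^sup>i(L, M)\<close>. Over an algebra over a field, multiples of products are products,
  so the generated subgroup is the linear span.\<close>

definition ext_product :: "'a ring \<Rightarrow> ('a, 'p, 'b) resolution \<Rightarrow> ('a, 'q, 'c) resolution \<Rightarrow>
    ('a, 'c) module \<Rightarrow> ('a, 'd) module \<Rightarrow> nat \<Rightarrow> nat \<Rightarrow> ('p \<Rightarrow> 'd) set set" where
  "ext_product R P Q M N j i =
     generate (Ext R P N (i + j)) {\<zeta>. \<exists>\<xi> \<eta>. is_yoneda_product R P Q M N j i \<xi> \<eta> \<zeta>}"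

text \<open>The condition \<open>Ext\<^sup>1(A\<^sub>0, A\<^sub>0) \<cdot> Ext\<^sup>i(A\<^sub>0, A\<^sub>0) = Ext\<^sup>i\<^sup>+\<^sup>1(A\<^sub>0, A\<^sub>0)\<close> for all \<open>i \<ge> 0\<close>, computed
  with every projective resolution of \<open>A\<^sub>0\<close> whose terms live in the type \<open>'p\<close>. Statements should
  keep \<open>'p\<close> arbitrary: resolutions exist as soon as \<open>'p\<close> is large enough, e.g. resolutions by
  finitely generated free modules in \<open>nat \<Rightarrow> 'a\<close> if the ring is left Noetherian and \<open>A\<^sub>0\<close> is
  finitely generated.\<close>

definition quasi_koszul :: "'p itself \<Rightarrow> 'a ring \<Rightarrow> ('a, 'b) module \<Rightarrow> bool" where
  "quasi_koszul _ A A0 \<longleftrightarrow>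
     (\<forall>P :: ('a, 'p, 'b) resolution. projective_resolution A A0 P \<longrightarrow>
        (\<forall>i. ext_product A P P A0 A0 1 i = carrier (Ext A P A0 (i + 1))))"

section \<open>The category algebra\<close>

text \<open>A function \<open>a\<close> represents the linear combination \<open>\<Sum>m. a m \<cdot> m\<close>; this is the category algebra
  only if there are finitely many morphisms.\<close>

definition category_algebra :: "('o, 'm) category \<Rightarrow> ('m \<Rightarrow> 'k::field) ring" where
  "category_algebra E = \<lparr>carrier = {a. \<forall>m. m \<notin> Mor E \<longrightarrow> a m = 0},
     monoid.mult = (\<lambda>b a m. \<Sum>(g, f) \<in> {(g, f). g \<in> Mor E \<and> f \<in> Mor E \<and> Dom E g = Cod E f \<and>
                                 g \<cdot>\<^bsub>E\<^esub> f = m}. b g * a f),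
     one = (\<lambda>m. if m \<in> Ident E ` Obj E then 1 else 0),
     zero = (\<lambda>m. 0), add = (\<lambda>a b m. a m + b m)\<rparr>"

definition non_iso_span :: "('o, 'm) category \<Rightarrow> ('m \<Rightarrow> 'k::field) set" where
  "non_iso_span E = {a \<in> carrier (category_algebra E). \<forall>m. iso_mor E m \<longrightarrow> a m = 0}"

text \<open>The degree zero part of the length grading, as a module over the category algebra.\<close>

definition degree_zero_module ::
    "('o, 'm) category \<Rightarrow> ('m \<Rightarrow> 'k::field, ('m \<Rightarrow> 'k) set) module" where
  "degree_zero_module E = quotient_module (regular_module (category_algebra E)) (non_iso_span E)"

end

theory Submission
  imports Defs "HOL-Library.Function_Algebras"
begin

text \<open>Write \<open>A = kE\<close>, \<open>J\<close> for the span of the non-isomorphisms and \<open>A\<^sub>0 = A/J\<close>. The products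
  with \<open>Ext\<^sup>0\<close> are harmless, since \<open>Ext\<^sup>0\<close> contains the identity; the point is that
  \<open>Ext\<^sup>n(A\<^sub>0, A\<^sub>0) = 0\<close> for \<open>n \<ge> 2\<close>. As \<open>A\<^sub>0\<close> is a product of group algebras, hence symmetric,
  \<open>A\<close>-linear maps \<open>M \<rightarrow> A\<^sub>0\<close> are the same as \<open>k\<close>-linear functionals on \<open>M/JM\<close>, so it suffices to show
  \<open>Tor\<^sub>n(A/J, A\<^sub>0) = 0\<close>, i.e. that in a projective resolution \<open>P\<close> of \<open>A\<^sub>0\<close> a boundary
  \<open>du \<in> JP\<close> of degree \<open>n - 1 \<ge> 1\<close> lies in \<open>d(JP)\<close>.

  Unique factorization gives \<open>JP = \<Oplus> aP\<close>, where \<open>a\<close> runs through representatives of the unfactorizable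
  morphisms modulo right multiplication by automorphisms, and it identifies \<open>aP\<close> with the coinvariants of
  \<open>H = {h. a h = a}\<close> on \<open>e\<^sub>xP\<close>, \<open>x\<close> being the source of \<open>a\<close>. If \<open>x\<close> is right regular, averaging over \<open>H\<close> shows
  that taking coinvariants is exact. If \<open>x\<close> is left regular, then \<open>e\<^sub>xP\<close> is a resolution of the free
  module \<open>kAut(x)\<close> by projective \<open>kAut(x)\<close>-modules, hence equivariantly contractible.\<close>

section \<open>Homomorphism groups and Ext\<close>

text \<open>The argument starts in degree 2 because it needs a differential below: once a boundary v
  in JP is a sum of terms a v_a, the cycle condition on v, read in each summand aP, gives a d(v_a) =
  0. For Tor_1 there is no such condition, and indeed Tor_1(A/J, A_0) = J/J^2 is spanned by the
  unfactorizable morphisms. The obstacle is that a d(v_a) = 0 does not make v_a a cycle. It has to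
  be replaced by a cycle with the same product with a; the norm over H does this in the right
  regular case, the equivariant contraction in the left regular one. The projectivity behind the
  contraction comes from permutation modules: Aut(x) permutes the morphisms into x, and the point
  stabilizers have invertible order. The symmetrizing form of A_0 that turns module maps into
  functionals is the sum of the coefficients at the identities. Projectivity is given only by
  splittings of free modules. The resolution is therefore transported to one function space, where
  each term is the image of an idempotent and maps between terms become endomorphisms of a single
  vector space.\<close>

lemma lmod_homD:
  assumes "f \<in> lmod_hom R M N"
  shows lmod_hom_closed: "x \<in> carrier M \<Longrightarrow> f x \<in> carrier N"
    and lmod_hom_add: "x \<in> carrier M \<Longrightarrow> y \<in> carrier M \<Longrightarrow> f (x \<oplus>\<^bsub>M\<^esub> y) = f x \<oplus>\<^bsub>N\<^esub> f y"
    and lmod_hom_smult: "a \<in> carrier R \<Longrightarrow> x \<in> carrier M \<Longrightarrow> f (a \<odot>\<^bsub>M\<^esub> x) = a \<odot>\<^bsub>N\<^esub> f x"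
    and lmod_hom_extensional: "f \<in> extensional (carrier M)"
  using assms by (auto simp: lmod_hom_def PiE_def)

lemma lmod_homI:
  assumes "\<And>x. x \<in> carrier M \<Longrightarrow> f x \<in> carrier N"
    and "\<And>x y. x \<in> carrier M \<Longrightarrow> y \<in> carrier M \<Longrightarrow> f (x \<oplus>\<^bsub>M\<^esub> y) = f x \<oplus>\<^bsub>N\<^esub> f y"
    and "\<And>a x. a \<in> carrier R \<Longrightarrow> x \<in> carrier M \<Longrightarrow> f (a \<odot>\<^bsub>M\<^esub> x) = a \<odot>\<^bsub>N\<^esub> f x"
    and "f \<in> extensional (carrier M)"
  shows "f \<in> lmod_hom R M N"
  using assms by (auto simp: lmod_hom_def PiE_def)

lemma left_module_add_group: "left_module R M \<Longrightarrow> abelian_group M"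
  by (simp add: left_module_def)

lemma lmod_hom_zero:
  assumes "left_module R M" "left_module R N" "f \<in> lmod_hom R M N"
  shows "f \<zero>\<^bsub>M\<^esub> = \<zero>\<^bsub>N\<^esub>"
proof -
  interpret M: abelian_group M using assms left_module_add_group by blast
  interpret N: abelian_group N using assms left_module_add_group by blast
  have "f \<zero>\<^bsub>M\<^esub> \<oplus>\<^bsub>N\<^esub> f \<zero>\<^bsub>M\<^esub> = f \<zero>\<^bsub>M\<^esub>" using lmod_hom_add[OF assms(3), of "\<zero>\<^bsub>M\<^esub>" "\<zero>\<^bsub>M\<^esub>"] by simp
  then show ?thesis using lmod_hom_closed[OF assms(3), of "\<zero>\<^bsub>M\<^esub>"] by simp
qed

lemma lmod_hom_compose:
  assumes "left_module R L" "f \<in> lmod_hom R L M" "g \<in> lmod_hom R M N"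
  shows "compose (carrier L) g f \<in> lmod_hom R L N"
proof -
  interpret L: left_module R L by fact
  show ?thesis
    by (rule lmod_homI)
      (auto simp: compose_def lmod_homD[OF assms(2)] lmod_homD[OF assms(3)] L.smult_closed)
qed

lemma smult_zero:
  assumes "left_module R M" "a \<in> carrier R"
  shows "a \<odot>\<^bsub>M\<^esub> \<zero>\<^bsub>M\<^esub> = \<zero>\<^bsub>M\<^esub>"
proof -
  interpret left_module R M by fact
  have "a \<odot>\<^bsub>M\<^esub> \<zero>\<^bsub>M\<^esub> \<oplus>\<^bsub>M\<^esub> a \<odot>\<^bsub>M\<^esub> \<zero>\<^bsub>M\<^esub> = a \<odot>\<^bsub>M\<^esub> \<zero>\<^bsub>M\<^esub>"
    using smult_r_distr[of a "\<zero>\<^bsub>M\<^esub>" "\<zero>\<^bsub>M\<^esub>"] assms by simp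
  then show ?thesis using smult_closed[of a "\<zero>\<^bsub>M\<^esub>"] assms by simp
qed

lemma smult_minus:
  assumes "left_module R M" "a \<in> carrier R" "x \<in> carrier M"
  shows "a \<odot>\<^bsub>M\<^esub> (\<ominus>\<^bsub>M\<^esub> x) = \<ominus>\<^bsub>M\<^esub> (a \<odot>\<^bsub>M\<^esub> x)"
proof -
  interpret left_module R M by fact
  have "a \<odot>\<^bsub>M\<^esub> (\<ominus>\<^bsub>M\<^esub> x) \<oplus>\<^bsub>M\<^esub> a \<odot>\<^bsub>M\<^esub> x = \<zero>\<^bsub>M\<^esub>"
    using smult_r_distr[of a "\<ominus>\<^bsub>M\<^esub> x" x] assms smult_zero[OF assms(1,2)] by (simp add: M.l_neg)
  then show ?thesis using smult_closed assms by (simp add: M.minus_equality)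
qed

lemma hom_group_comm_group:
  assumes "left_module R M" "left_module R N"
  shows "comm_group (hom_group R M N)"
proof -
  interpret M: left_module R M by fact
  interpret N: left_module R N by fact
  let ?H = "hom_group R M N"
  show ?thesis
  proof (rule comm_groupI)
    fix f g assume fg: "f \<in> carrier ?H" "g \<in> carrier ?H"
    then have f: "f \<in> lmod_hom R M N" and g: "g \<in> lmod_hom R M N" by (auto simp: hom_group_def)
    note fD = lmod_homD[OF f] and gD = lmod_homD[OF g]
    have "(\<lambda>x \<in> carrier M. f x \<oplus>\<^bsub>N\<^esub> g x) \<in> lmod_hom R M N"
      by (rule lmod_homI) (auto simp: fD gD N.M.a_ac N.smult_r_distr M.smult_closed)
    then show "f \<otimes>\<^bsub>?H\<^esub> g \<in> carrier ?H" by (simp add: hom_group_def)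
    show "f \<otimes>\<^bsub>?H\<^esub> g = g \<otimes>\<^bsub>?H\<^esub> f"
      by (auto simp: hom_group_def fun_eq_iff restrict_def fD gD N.M.a_comm)
    fix h assume "h \<in> carrier ?H"
    then have h: "h \<in> lmod_hom R M N" by (auto simp: hom_group_def)
    show "f \<otimes>\<^bsub>?H\<^esub> g \<otimes>\<^bsub>?H\<^esub> h = f \<otimes>\<^bsub>?H\<^esub> (g \<otimes>\<^bsub>?H\<^esub> h)"
      by (auto simp: hom_group_def fun_eq_iff restrict_def fD gD lmod_homD[OF h] N.M.a_assoc)
  next
    have "(\<lambda>x \<in> carrier M. \<zero>\<^bsub>N\<^esub>) \<in> lmod_hom R M N"
      by (rule lmod_homI) (auto simp: M.smult_closed smult_zero[OF assms(2)])
    then show "\<one>\<^bsub>?H\<^esub> \<in> carrier ?H" by (simp add: hom_group_def)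
  next
    fix f assume "f \<in> carrier ?H"
    then have f: "f \<in> lmod_hom R M N" by (auto simp: hom_group_def)
    note fD = lmod_homD[OF f]
    show "\<one>\<^bsub>?H\<^esub> \<otimes>\<^bsub>?H\<^esub> f = f"
      using lmod_hom_extensional[OF f] by (auto simp: hom_group_def fun_eq_iff restrict_def fD extensional_def)
    have "(\<lambda>x \<in> carrier M. \<ominus>\<^bsub>N\<^esub> f x) \<in> lmod_hom R M N"
      by (rule lmod_homI) (auto simp: fD M.smult_closed smult_minus[OF assms(2)] N.M.minus_add)
    then have "(\<lambda>x \<in> carrier M. \<ominus>\<^bsub>N\<^esub> f x) \<in> carrier ?H" by (simp add: hom_group_def)
    moreover have "(\<lambda>x \<in> carrier M. \<ominus>\<^bsub>N\<^esub> f x) \<otimes>\<^bsub>?H\<^esub> f = \<one>\<^bsub>?H\<^esub>"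
      by (auto simp: hom_group_def fun_eq_iff restrict_def fD N.M.l_neg)
    ultimately show "\<exists>g \<in> carrier ?H. g \<otimes>\<^bsub>?H\<^esub> f = \<one>\<^bsub>?H\<^esub>" by blast
  qed
qed

lemma hom_group_inv:
  assumes "left_module R M" "left_module R N" "f \<in> lmod_hom R M N" "x \<in> carrier M"
  shows "(inv\<^bsub>hom_group R M N\<^esub> f) x = \<ominus>\<^bsub>N\<^esub> f x"
proof -
  interpret H: comm_group "hom_group R M N" by (rule hom_group_comm_group[OF assms(1,2)])
  interpret N: left_module R N by fact
  have f: "f \<in> carrier (hom_group R M N)" using assms by (simp add: hom_group_def)
  then have i: "inv\<^bsub>hom_group R M N\<^esub> f \<in> lmod_hom R M N" using H.inv_closed by (simp add: hom_group_def)
  have "(inv\<^bsub>hom_group R M N\<^esub> f) x \<oplus>\<^bsub>N\<^esub> f x = \<zero>\<^bsub>N\<^esub>"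
    using fun_cong[OF H.l_inv[OF f], of x] assms(4) by (simp add: hom_group_def)
  then show ?thesis
    using lmod_hom_closed[OF i assms(4)] lmod_hom_closed[OF assms(3,4)] by (simp add: N.M.minus_equality)
qed

context
  fixes R :: "'a ring" and M :: "('a, 'b) module" and P :: "('a, 'p, 'b) resolution"
  assumes P: "projective_resolution R M P"
begin

lemma Term_left_module: "left_module R (Term P n)"
  using P by (simp add: projective_resolution_def projective_module_def)

lemma Diff_hom: "Diff P n \<in> lmod_hom R (Term P (Suc n)) (Term P n)"
  using P by (simp add: projective_resolution_def)

lemma Diff_Diff:
  assumes "x \<in> carrier (Term P (Suc (Suc n)))"
  shows "Diff P n (Diff P (Suc n) x) = \<zero>\<^bsub>Term P n\<^esub>"
proof -
  have "Diff P (Suc n) x \<in> {x \<in> carrier (Term P (Suc n)). Diff P n x = \<zero>\<^bsub>Term P n\<^esub>}"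
    using P assms unfolding projective_resolution_def by blast
  then show ?thesis by simp
qed

context
  fixes N :: "('a, 'c) module"
  assumes N: "left_module R N"
begin

lemma cocycles_group: "group ((hom_group R (Term P i) N)\<lparr>carrier := cocycles R P N i\<rparr>)"
  and cocycles_subgroup: "subgroup (cocycles R P N i) (hom_group R (Term P i) N)"
proof -
  interpret H: comm_group "hom_group R (Term P i) N" by (rule hom_group_comm_group[OF Term_left_module N])
  interpret N: left_module R N by (rule N)
  note D = lmod_hom_closed[OF Diff_hom]
  show "subgroup (cocycles R P N i) (hom_group R (Term P i) N)"
  proof
    show "cocycles R P N i \<subseteq> carrier (hom_group R (Term P i) N)" by (auto simp: cocycles_def hom_group_def)
    show "f \<otimes>\<^bsub>hom_group R (Term P i) N\<^esub> g \<in> cocycles R P N i" if "f \<in> cocycles R P N i" "g \<in> cocycles R P N i" for f g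
      using that H.m_closed[of f g] D by (auto simp: cocycles_def hom_group_def)
    show "\<one>\<^bsub>hom_group R (Term P i) N\<^esub> \<in> cocycles R P N i"
      using H.one_closed D by (auto simp: cocycles_def hom_group_def)
    show "inv\<^bsub>hom_group R (Term P i) N\<^esub> f \<in> cocycles R P N i" if "f \<in> cocycles R P N i" for f
    proof -
      have f: "f \<in> lmod_hom R (Term P i) N" using that by (simp add: cocycles_def)
      have "inv\<^bsub>hom_group R (Term P i) N\<^esub> f \<in> lmod_hom R (Term P i) N"
        using f H.inv_closed[of f] by (simp add: hom_group_def)
      then show ?thesis
        using that D hom_group_inv[OF Term_left_module N f] by (auto simp: cocycles_def)
    qed
  qed
  then show "group ((hom_group R (Term P i) N)\<lparr>carrier := cocycles R P N i\<rparr>)"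
    by (rule H.subgroup_imp_group)
qed

text \<open>Normality is free, since the cocycles commute; the content is the inclusion in the
  cocycles, which is \<open>Diff_Diff\<close>. Degree 0 is treated apart, because there
  \<open>coboundaries\<close> is by definition the zero map alone.\<close>

lemma coboundaries_normal: "coboundaries R P N i \<lhd> (hom_group R (Term P i) N)\<lparr>carrier := cocycles R P N i\<rparr>"
proof -
  let ?H = "hom_group R (Term P i) N"
  let ?G = "?H\<lparr>carrier := cocycles R P N i\<rparr>"
  interpret H: comm_group ?H by (rule hom_group_comm_group[OF Term_left_module N])
  interpret N: left_module R N by (rule N)
  interpret G: group ?G by (rule cocycles_group)
  have sub: "coboundaries R P N i \<subseteq> cocycles R P N i"
  proof (cases i)
    case 0
    have "\<one>\<^bsub>?H\<^esub> \<in> cocycles R P N i" using subgroup.one_closed[OF cocycles_subgroup] .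
    then show ?thesis using 0 by (auto simp: coboundaries_def hom_group_def)
  next
    case (Suc j)
    show ?thesis
    proof
      fix f assume "f \<in> coboundaries R P N i"
      then obtain g where g: "g \<in> lmod_hom R (Term P j) N" "f = compose (carrier (Term P (Suc j))) g (Diff P j)"
        using Suc by (auto simp: coboundaries_def)
      show "f \<in> cocycles R P N i"
        using g Suc lmod_hom_compose[OF Term_left_module Diff_hom g(1)] lmod_hom_zero[OF Term_left_module N g(1)]
        by (auto simp: cocycles_def compose_def Diff_Diff lmod_hom_closed[OF Diff_hom])
    qed
  qed
  have "subgroup (coboundaries R P N i) ?H"
  proof (cases i)
    case 0
    then show ?thesis using H.triv_subgroup by (simp add: coboundaries_def hom_group_def)
  next
    case (Suc j)
    let ?c = "\<lambda>g. compose (carrier (Term P (Suc j))) g (Diff P j)"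
    let ?K = "hom_group R (Term P j) N"
    interpret K: comm_group ?K by (rule hom_group_comm_group[OF Term_left_module N])
    have "group_hom ?K ?H ?c"
    proof (unfold_locales, rule homI)
      fix g assume "g \<in> carrier ?K"
      then show "?c g \<in> carrier ?H" using lmod_hom_compose[OF Term_left_module Diff_hom] Suc by (simp add: hom_group_def)
    next
      fix g h assume "g \<in> carrier ?K" "h \<in> carrier ?K"
      then show "?c (g \<otimes>\<^bsub>?K\<^esub> h) = ?c g \<otimes>\<^bsub>?H\<^esub> ?c h"
        using Suc by (auto simp: hom_group_def compose_def fun_eq_iff restrict_def lmod_hom_closed[OF Diff_hom])
    qed
    then have "subgroup (?c ` carrier ?K) ?H" by (rule group_hom.img_is_subgroup)
    then show ?thesis using Suc by (simp add: coboundaries_def hom_group_def)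
  qed
  then have "subgroup (coboundaries R P N i) ?G"
    using H.subgroup_incl[OF _ cocycles_subgroup sub] by blast
  moreover have "comm_group ?G"
    by (rule G.group_comm_groupI) (use subgroup.mem_carrier[OF cocycles_subgroup] H.m_comm in auto)
  ultimately show ?thesis by (simp add: comm_group.subgroup_imp_normal)
qed

lemma Ext_group: "group (Ext R P N i)"
  unfolding Ext_def by (rule normal.factorgroup_is_group[OF coboundaries_normal])

lemma Ext_one: "\<one>\<^bsub>Ext R P N i\<^esub> = coboundaries R P N i"
  by (simp add: Ext_def FactGroup_def)

lemma Ext_carrier: "carrier (Ext R P N i) = ext_class R P N i ` cocycles R P N i"
  by (auto simp: Ext_def FactGroup_def RCOSETS_def ext_class_def r_coset_def)

lemma ext_class_coboundary:
  assumes "f \<in> coboundaries R P N i"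
  shows "ext_class R P N i f = \<one>\<^bsub>Ext R P N i\<^esub>"
proof -
  let ?G = "(hom_group R (Term P i) N)\<lparr>carrier := cocycles R P N i\<rparr>"
  interpret B: normal "coboundaries R P N i" ?G by (rule coboundaries_normal)
  have "coboundaries R P N i #>\<^bsub>?G\<^esub> f = coboundaries R P N i"
    using assms B.rcos_const by blast
  then show ?thesis by (simp add: Ext_one ext_class_def r_coset_def)
qed

lemma ext_class_subset:
  assumes "f \<in> cocycles R P N i" shows "ext_class R P N i f \<subseteq> cocycles R P N i" "f \<in> ext_class R P N i f"
proof -
  let ?G = "(hom_group R (Term P i) N)\<lparr>carrier := cocycles R P N i\<rparr>"
  interpret B: normal "coboundaries R P N i" ?G by (rule coboundaries_normal)
  have eq: "ext_class R P N i f = coboundaries R P N i #>\<^bsub>?G\<^esub> f" by (simp add: ext_class_def r_coset_def)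
  show "ext_class R P N i f \<subseteq> cocycles R P N i" using B.r_coset_subset_G[OF B.subset] assms unfolding eq by simp
  show "f \<in> ext_class R P N i f" unfolding eq using B.rcos_self[OF _ B.subgroup_axioms] assms by simp
qed

end

end

text \<open>A chain lift commutes with the differentials, so composing a cocycle with it gives a
  cocycle. This yields the easy inclusion, of the generated subgroup in Ext.\<close>

lemma yoneda_product_closed:
  assumes P: "projective_resolution R L P" and Q: "projective_resolution R M Q" and N: "left_module R N"
    and prod: "is_yoneda_product R P Q M N j i \<xi> \<eta> \<zeta>"
  shows "\<zeta> \<in> carrier (Ext R P N (i + j))"
proof -
  from prod obtain g f \<phi> where g: "\<xi> \<in> carrier (Ext R Q N j)" "g \<in> \<xi>" and lift: "chain_lift R P Q i f \<phi>"
    and \<zeta>: "\<zeta> = ext_class R P N (i + j) (compose (carrier (Term P (i + j))) g (\<phi> j))"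
    by (auto simp: is_yoneda_product_def)
  have gc: "g \<in> cocycles R Q N j"
    using g ext_class_subset(1)[OF Q N] by (auto simp: Ext_carrier[OF Q N])
  have gh: "g \<in> lmod_hom R (Term Q j) N" and g0: "\<And>x. x \<in> carrier (Term Q (Suc j)) \<Longrightarrow> g (Diff Q j x) = \<zero>\<^bsub>N\<^esub>"
    using gc by (auto simp: cocycles_def)
  have \<phi>: "\<phi> n \<in> lmod_hom R (Term P (i + n)) (Term Q n)" for n using lift by (simp add: chain_lift_def)
  have "compose (carrier (Term P (i + j))) g (\<phi> j) \<in> cocycles R P N (i + j)"
    unfolding cocycles_def
  proof (intro CollectI conjI ballI)
    show "compose (carrier (Term P (i + j))) g (\<phi> j) \<in> lmod_hom R (Term P (i + j)) N"
      by (rule lmod_hom_compose[OF Term_left_module[OF P] \<phi> gh])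
    fix x assume x: "x \<in> carrier (Term P (Suc (i + j)))"
    have "\<phi> j (Diff P (i + j) x) = Diff Q j (\<phi> (Suc j) x)" using lift x by (simp add: chain_lift_def)
    then show "compose (carrier (Term P (i + j))) g (\<phi> j) (Diff P (i + j) x) = \<zero>\<^bsub>N\<^esub>"
      using lmod_hom_closed[OF Diff_hom[OF P] x] g0 lmod_hom_closed[OF \<phi>, of x "Suc j"] x by (simp add: compose_def)
  qed
  then show ?thesis by (simp add: \<zeta> Ext_carrier[OF P N])
qed

text \<open>The augmentation is a cocycle whose class in Ext^0(M, M) is the identity of M. The
  identity chain map lifts it, so multiplying by this class changes nothing.\<close>

lemma ext_product_zero:
  assumes P: "projective_resolution R M P" and N: "left_module R N" and \<zeta>: "\<zeta> \<in> carrier (Ext R P N j)"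
  shows "\<zeta> \<in> ext_product R P P M N j 0"
proof -
  from P have M: "left_module R M" and A: "Aug P \<in> lmod_hom R (Term P 0) M"
    and AD: "\<And>x. x \<in> carrier (Term P 1) \<Longrightarrow> Aug P (Diff P 0 x) = \<zero>\<^bsub>M\<^esub>"
    by (auto simp: projective_resolution_def)
  obtain g where g: "g \<in> cocycles R P N j" "\<zeta> = ext_class R P N j g" using \<zeta> by (auto simp: Ext_carrier[OF P N])
  define \<phi> where "\<phi> n = (\<lambda>x \<in> carrier (Term P n). x)" for n
  have Ac: "Aug P \<in> cocycles R P M 0" using A AD by (simp add: cocycles_def)
  have "\<phi> n \<in> lmod_hom R (Term P n) (Term P n)" for n
  proof -
    interpret T: left_module R "Term P n" by (rule Term_left_module[OF P])
    show ?thesis by (rule lmod_homI) (auto simp: \<phi>_def T.smult_closed)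
  qed
  then have lift: "chain_lift R P P 0 (Aug P) \<phi>"
    using lmod_hom_closed[OF Diff_hom[OF P]] by (auto simp: chain_lift_def \<phi>_def)
  have "compose (carrier (Term P j)) g (\<phi> j) = g"
    using lmod_hom_extensional[of g R "Term P j" N] g(1)
    by (auto simp: compose_def \<phi>_def fun_eq_iff extensional_def cocycles_def)
  then have "is_yoneda_product R P P M N j 0 \<zeta> (ext_class R P M 0 (Aug P)) \<zeta>"
    unfolding is_yoneda_product_def using \<zeta> g ext_class_subset(2)[OF P N g(1)] lift Ac
    by (intro conjI bexI[of _ g] bexI[OF _ ext_class_subset(2)[OF P M Ac]] exI[of _ \<phi>])
      (auto simp: Ext_carrier[OF P M])
  then show ?thesis unfolding ext_product_def by (intro generate.incl) auto
qed

text \<open>Target degree 1 is the case \<open>i = 0\<close>, where multiplying by the identity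
  already gives everything. From degree 2 on the target is trivial, and a generated subgroup
  contains the trivial class whatever the products are.\<close>

lemma quasi_koszul_if_higher_Ext_vanish:
  assumes "\<And>P :: ('a, 'p, 'b) resolution. \<And>n. projective_resolution R M P \<Longrightarrow>
    cocycles R P M (Suc (Suc n)) \<subseteq> coboundaries R P M (Suc (Suc n))"
  shows "quasi_koszul TYPE('p) R M"
  unfolding quasi_koszul_def
proof (intro allI impI)
  fix P :: "('a, 'p, 'b) resolution" and i
  assume P: "projective_resolution R M P"
  then have M: "left_module R M" by (simp add: projective_resolution_def)
  interpret X: group "Ext R P M (i + 1)" by (rule Ext_group[OF P M])
  show "ext_product R P P M M 1 i = carrier (Ext R P M (i + 1))"
  proof
    show "ext_product R P P M M 1 i \<subseteq> carrier (Ext R P M (i + 1))"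
      unfolding ext_product_def by (rule X.generate_incl) (use yoneda_product_closed[OF P P M, of 1 i] in auto)
    show "carrier (Ext R P M (i + 1)) \<subseteq> ext_product R P P M M 1 i"
    proof (cases i)
      case 0
      then show ?thesis using ext_product_zero[OF P M] by auto
    next
      case (Suc n)
      have "\<zeta> = \<one>\<^bsub>Ext R P M (i + 1)\<^esub>" if "\<zeta> \<in> carrier (Ext R P M (i + 1))" for \<zeta>
        using that assms[OF P, of n] ext_class_coboundary[OF P M] Suc by (auto simp: Ext_carrier[OF P M])
      then show ?thesis unfolding ext_product_def by (metis generate.one subsetI)
    qed
  qed
qed

section \<open>Unique factorization in a skeletal free EI category\<close>

locale skeletal_free_EI_category = finite_free_EI_category +
  assumes skeletal: "skeletal E"
begin

section \<open>Isomorphisms and automorphism groups\<close>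

lemma iso_mor_Dom_eq_Cod: "iso_mor E f \<Longrightarrow> Dom E f = Cod E f"
  using skeletal Dom_closed Cod_closed
  unfolding skeletal_def iso_mor_def Hom_def by blast

text \<open>Skeletality makes isomorphisms endomorphisms and EI gives the converse. From here on,
  being an isomorphism is tested by comparing two objects.\<close>

lemma iso_mor_iff: "iso_mor E f \<longleftrightarrow> f \<in> Mor E \<and> Dom E f = Cod E f"
  using iso_mor_Dom_eq_Cod EI[of f "Dom E f"] by (auto simp: Hom_def iso_mor_def)

lemma Aut_iff: "f \<in> Aut E x \<longleftrightarrow> f \<in> Mor E \<and> Dom E f = x \<and> Cod E f = x"
  using EI by (auto simp: Aut_def Hom_def)

lemma is_aut_iff: "is_aut E f \<longleftrightarrow> f \<in> Mor E \<and> Dom E f = Cod E f"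
  using Cod_closed by (auto simp: is_aut_def Aut_iff)

lemma Ident_in_Aut: "x \<in> Obj E \<Longrightarrow> Ident E x \<in> Aut E x"
  by (simp add: Aut_iff Id_closed Dom_Id Cod_Id)

lemma finite_Aut: "finite (Aut E x)"
  by (rule finite_subset[OF _ finite_Mor]) (auto simp: Aut_iff)

lemma Aut_Comp_closed: "\<lbrakk>g \<in> Aut E x; f \<in> Aut E x\<rbrakk> \<Longrightarrow> g \<cdot> f \<in> Aut E x"
  by (simp add: Aut_iff Comp_closed Dom_Comp Cod_Comp)

definition inv_mor :: "'b \<Rightarrow> 'b" where
  "inv_mor g = (SOME g'. g' \<in> Aut E (Dom E g) \<and> g' \<cdot> g = Ident E (Dom E g) \<and> g \<cdot> g' = Ident E (Dom E g))"

lemma inv_mor: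
  assumes "g \<in> Aut E x"
  shows inv_mor_Aut: "inv_mor g \<in> Aut E x"
    and inv_mor_left: "inv_mor g \<cdot> g = Ident E x"
    and inv_mor_right: "g \<cdot> inv_mor g = Ident E x"
proof -
  have "\<exists>g'. g' \<in> Aut E (Dom E g) \<and> g' \<cdot> g = Ident E (Dom E g) \<and> g \<cdot> g' = Ident E (Dom E g)"
  proof -
    have "iso_mor E g" "Dom E g = x" "Cod E g = x" using assms by (auto simp: Aut_iff iso_mor_iff)
    then show ?thesis by (auto simp: iso_mor_def Hom_def Aut_iff)
  qed
  from someI_ex[OF this, folded inv_mor_def] assms
  show "inv_mor g \<in> Aut E x" "inv_mor g \<cdot> g = Ident E x" "g \<cdot> inv_mor g = Ident E x"
    by (auto simp: Aut_iff)
qed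

lemma inv_mor_Comp_cancel:
  assumes "g \<in> Aut E x" "f \<in> Mor E" "Cod E f = x"
  shows "inv_mor g \<cdot> (g \<cdot> f) = f" "g \<cdot> (inv_mor g \<cdot> f) = f"
  using assms inv_mor[OF assms(1)] Comp_assoc[of "inv_mor g" g f] Comp_assoc[of g "inv_mor g" f] Id_left[of f]
  by (auto simp: Aut_iff)

lemma Comp_inv_mor_cancel:
  assumes "g \<in> Aut E x" "f \<in> Mor E" "Dom E f = x"
  shows "(f \<cdot> g) \<cdot> inv_mor g = f" "(f \<cdot> inv_mor g) \<cdot> g = f"
  using assms inv_mor[OF assms(1)] Comp_assoc[of f "inv_mor g" g] Comp_assoc[of f g "inv_mor g"] Id_right[of f]
  by (auto simp: Aut_iff)

lemma bij_betw_Aut_Comp: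
  assumes "g \<in> Aut E x"
  shows "bij_betw (\<lambda>f. g \<cdot> f) {f \<in> Mor E. Cod E f = x} {f \<in> Mor E. Cod E f = x}"
  by (rule bij_betw_byWitness[where f' = "\<lambda>f. inv_mor g \<cdot> f"])
    (use assms inv_mor_Aut[OF assms] in \<open>auto simp: inv_mor_Comp_cancel Aut_iff Comp_closed Cod_Comp\<close>)

lemma inv_mor_unique:
  assumes "g \<in> Aut E x" "g' \<in> Aut E x" "g' \<cdot> g = Ident E x"
  shows "inv_mor g = g'"
  using assms Comp_inv_mor_cancel(1)[of g x g'] inv_mor_Aut[OF assms(1)] Id_left[of "inv_mor g"]
  by (auto simp: Aut_iff)

lemma inv_mor_inv_mor: "g \<in> Aut E x \<Longrightarrow> inv_mor (inv_mor g) = g"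
  by (rule inv_mor_unique[where x = x]) (auto simp: inv_mor)

text \<open>Arrows in both directions make \<open>g \<cdot> f\<close> and \<open>f \<cdot> g\<close>
  endomorphisms, hence invertible; so \<open>f\<close> has a left and a right inverse and is an
  isomorphism. Existence of an arrow is thus a partial order on the objects.\<close>

lemma Comp_Aut_imp_Aut:
  assumes "g \<in> Mor E" "f \<in> Mor E" "Dom E g = Cod E f" "Cod E g = Dom E f"
  shows "Dom E f = Cod E f"
proof -
  obtain u where u: "u \<in> Mor E" "Dom E u = Dom E f" "Cod E u = Dom E f" "u \<cdot> (g \<cdot> f) = Ident E (Dom E f)"
    using assms inv_mor[of "g \<cdot> f" "Dom E f"] by (auto simp: Aut_iff Comp_closed Dom_Comp Cod_Comp)
  obtain v where v: "v \<in> Mor E" "Dom E v = Cod E f" "Cod E v = Cod E f" "(f \<cdot> g) \<cdot> v = Ident E (Cod E f)"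
    using assms inv_mor[of "f \<cdot> g" "Cod E f"] by (auto simp: Aut_iff Comp_closed Dom_Comp Cod_Comp)
  define a where "a = u \<cdot> g"
  define b where "b = g \<cdot> v"
  have a: "a \<in> Mor E" "Dom E a = Cod E f" "Cod E a = Dom E f" "a \<cdot> f = Ident E (Dom E f)"
    using u assms by (auto simp: a_def Comp_closed Dom_Comp Cod_Comp Comp_assoc)
  have b: "b \<in> Mor E" "Dom E b = Cod E f" "Cod E b = Dom E f" "f \<cdot> b = Ident E (Cod E f)"
    using v assms by (auto simp: b_def Comp_closed Dom_Comp Cod_Comp Comp_assoc)
  have "a = a \<cdot> (f \<cdot> b)" using a b Id_right[of a] by auto
  also have "\<dots> = b" using a b assms Id_left[of b] Comp_assoc[of a f b] by auto
  finally have "iso_mor E f" using a b assms by (auto simp: iso_mor_def Hom_def)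
  then show ?thesis by (rule iso_mor_Dom_eq_Cod)
qed

section \<open>The order on objects and the existence of decompositions\<close>

lemma finite_Obj: "finite (Obj E)"
proof -
  have "Obj E = Dom E ` Ident E ` Obj E" by (force simp: Dom_Id)
  moreover have "finite (Ident E ` Obj E)"
    by (rule finite_subset[OF _ finite_Mor]) (auto simp: Id_closed)
  ultimately show ?thesis by (metis finite_imageI)
qed

text \<open>A numerical rank for the order on objects: it turns choices of extremal factorizations
  and inductions along arrows into statements about numbers.\<close>

definition height :: "'a \<Rightarrow> nat" where
  "height y = card {z \<in> Obj E. Hom E z y \<noteq> {}}"

lemma height_less:
  assumes f: "f \<in> Mor E" "Dom E f \<noteq> Cod E f"
  shows "height (Dom E f) < height (Cod E f)"
  unfolding height_def
proof (rule psubset_card_mono)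
  show "finite {z \<in> Obj E. Hom E z (Cod E f) \<noteq> {}}" using finite_Obj by simp
  have "\<exists>h. h \<in> Hom E z (Cod E f)" if "h \<in> Hom E z (Dom E f)" for h z
    using that f by (intro exI[of _ "f \<cdot> h"]) (auto simp: Hom_def Comp_closed Dom_Comp Cod_Comp)
  moreover have "Ident E (Cod E f) \<in> Hom E (Cod E f) (Cod E f)"
    using f Cod_closed Id_closed Dom_Id Cod_Id by (simp add: Hom_def)
  moreover have "Hom E (Cod E f) (Dom E f) = {}"
    using Comp_Aut_imp_Aut[of _ f] f by (auto simp: Hom_def)
  ultimately show "{z \<in> Obj E. Hom E z (Dom E f) \<noteq> {}} \<subset> {z \<in> Obj E. Hom E z (Cod E f) \<noteq> {}}"
    using Cod_closed[OF f(1)] by blast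
qed

text \<open>This is what makes the span of the non-isomorphisms a two-sided ideal.\<close>

lemma Comp_non_iso:
  assumes "g \<in> Mor E" "f \<in> Mor E" "Dom E g = Cod E f" "Dom E g \<noteq> Cod E g \<or> Dom E f \<noteq> Cod E f"
  shows "Dom E (g \<cdot> f) \<noteq> Cod E (g \<cdot> f)"
  using assms Comp_Aut_imp_Aut[of g f] by (auto simp: Dom_Comp Cod_Comp)

lemma unfactorizable_iff:
  "unfactorizable E a \<longleftrightarrow> a \<in> Mor E \<and> Dom E a \<noteq> Cod E a \<and>
     (\<forall>a1 a2. a1 \<in> Mor E \<and> a2 \<in> Mor E \<and> Dom E a1 = Cod E a2 \<and> a = a1 \<cdot> a2 \<longrightarrow>
        Dom E a1 = Cod E a1 \<or> Dom E a2 = Cod E a2)"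
  unfolding unfactorizable_def is_aut_iff by blast

text \<open>Among the non-isomorphisms that are left factors of \<open>m\<close> (such as
  \<open>m\<close> itself) take one whose source has maximal height. A proper factorization
  \<open>a1 \<cdot> a2\<close> of it would make \<open>a1\<close> a left factor with a higher
  source.\<close>

lemma non_iso_factor:
  assumes m: "m \<in> Mor E" "Dom E m \<noteq> Cod E m"
  shows "\<exists>a f. unfactorizable E a \<and> f \<in> Mor E \<and> Dom E a = Cod E f \<and> m = a \<cdot> f"
proof -
  define S where "S = {a \<in> Mor E. Dom E a \<noteq> Cod E a \<and> (\<exists>f \<in> Mor E. Dom E a = Cod E f \<and> m = a \<cdot> f)}"
  have "m \<in> S" unfolding S_def using m Id_right[of m] Id_closed Cod_Id Dom_closed by force
  moreover have "finite S" unfolding S_def using finite_Mor by simp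
  ultimately have "Max ((\<lambda>a. height (Dom E a)) ` S) \<in> (\<lambda>a. height (Dom E a)) ` S"
    by (intro Max_in) auto
  then obtain a where a: "a \<in> S" "Max ((\<lambda>a. height (Dom E a)) ` S) = height (Dom E a)" by auto
  then have max: "height (Dom E b) \<le> height (Dom E a)" if "b \<in> S" for b
    using that \<open>finite S\<close> by (metis Max_ge finite_imageI imageI)
  from a(1) obtain f where f: "a \<in> Mor E" "Dom E a \<noteq> Cod E a" "f \<in> Mor E" "Dom E a = Cod E f" "m = a \<cdot> f"
    by (auto simp: S_def)
  have "unfactorizable E a"
    unfolding unfactorizable_iff
  proof (intro conjI allI impI f(1,2))
    fix a1 a2
    assume h: "a1 \<in> Mor E \<and> a2 \<in> Mor E \<and> Dom E a1 = Cod E a2 \<and> a = a1 \<cdot> a2"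
    show "Dom E a1 = Cod E a1 \<or> Dom E a2 = Cod E a2"
    proof (rule ccontr)
      assume n: "\<not> (Dom E a1 = Cod E a1 \<or> Dom E a2 = Cod E a2)"
      have d: "Dom E a = Dom E a2" using h by (auto simp: Dom_Comp)
      have "m = a1 \<cdot> (a2 \<cdot> f)" using h f d Comp_assoc[of a1 a2 f] by auto
      then have "a1 \<in> S" using h n f d
        by (auto simp: S_def Comp_closed Cod_Comp intro!: bexI[of _ "a2 \<cdot> f"])
      from max[OF this] height_less[of a2] h n d show False by auto
    qed
  qed
  with f show ?thesis by blast
qed

lemma is_path_append:
  "is_path E x (as @ bs) z \<longleftrightarrow> (\<exists>y. is_path E x as y \<and> is_path E y bs z)"
proof (induction as arbitrary: x)
  case Nil
  have "is_path E x bs z \<Longrightarrow> x \<in> Obj E" using Dom_closed by (cases bs) auto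
  then show ?case by auto
qed auto

lemma composite_path:
  "is_path E x as y \<Longrightarrow> composite E x as \<in> Mor E \<and> Dom E (composite E x as) = x \<and> Cod E (composite E x as) = y"
  by (induction as arbitrary: x) (auto simp: Id_closed Dom_Id Cod_Id Comp_closed Dom_Comp Cod_Comp)

lemma composite_snoc:
  "is_path E x as y \<Longrightarrow> a \<in> Mor E \<Longrightarrow> Dom E a = y \<Longrightarrow> composite E x (as @ [a]) = a \<cdot> composite E x as"
proof (induction as arbitrary: x)
  case Nil
  then show ?case using Id_left[of a] Id_right[of a] Cod_closed by (auto simp: Dom_Id Cod_Id)
next
  case (Cons b as)
  then show ?case using composite_path[of "Cod E b" as y] Comp_assoc[of a "composite E (Cod E b) as" b] by auto
qed

lemma is_decomposition_snoc:
  assumes "is_decomposition E f as" "unfactorizable E a" "Dom E a = Cod E f" "f \<in> Mor E"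
  shows "is_decomposition E (a \<cdot> f) (as @ [a])"
  using assms composite_snoc[of "Dom E f" as "Cod E f" a]
  by (auto simp: is_decomposition_def is_path_append unfactorizable_def Dom_Comp Cod_Comp Cod_closed)

lemma is_decomposition_single:
  assumes "unfactorizable E a" shows "is_decomposition E a [a]"
  using assms Id_left[of a] by (auto simp: is_decomposition_def unfactorizable_def Cod_closed)

lemma unfactorizable_Comp_Aut:
  assumes a: "unfactorizable E a" and f: "f \<in> Aut E (Dom E a)"
  shows "unfactorizable E (a \<cdot> f)"
  unfolding unfactorizable_iff
proof (intro conjI allI impI)
  have a': "a \<in> Mor E" "Dom E a \<noteq> Cod E a" using a by (auto simp: unfactorizable_iff)
  with f show "a \<cdot> f \<in> Mor E" "Dom E (a \<cdot> f) \<noteq> Cod E (a \<cdot> f)"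
    by (auto simp: Aut_iff Comp_closed Dom_Comp Cod_Comp)
  fix a1 a2 assume h: "a1 \<in> Mor E \<and> a2 \<in> Mor E \<and> Dom E a1 = Cod E a2 \<and> a \<cdot> f = a1 \<cdot> a2"
  have d: "Dom E a2 = Dom E a" using h f a' by (metis Aut_iff Dom_Comp)
  have "a = a1 \<cdot> (a2 \<cdot> inv_mor f)"
    using h d f a' Comp_inv_mor_cancel(1)[OF f, of a] inv_mor_Aut[OF f] Comp_assoc[of a1 a2 "inv_mor f"]
    by (auto simp: Aut_iff)
  moreover have "a2 \<cdot> inv_mor f \<in> Mor E" "Cod E (a2 \<cdot> inv_mor f) = Cod E a2"
    using h inv_mor_Aut[OF f] d by (auto simp: Aut_iff Comp_closed Cod_Comp)
  ultimately have "Dom E a1 = Cod E a1 \<or> Dom E (a2 \<cdot> inv_mor f) = Cod E (a2 \<cdot> inv_mor f)"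
    using a h unfolding unfactorizable_iff by metis
  then show "Dom E a1 = Cod E a1 \<or> Dom E a2 = Cod E a2"
    using inv_mor_Aut[OF f] d h by (auto simp: Aut_iff Dom_Comp Cod_Comp)
qed

text \<open>The last arrow is peeled off. If an automorphism remains, it is absorbed into that
  arrow, which stays unfactorizable; otherwise the remainder has a lower target.\<close>

lemma decomposition_exists:
  assumes "m \<in> Mor E" "Dom E m \<noteq> Cod E m"
  shows "\<exists>as. is_decomposition E m as \<and> as \<noteq> []"
  using assms
proof (induction "height (Cod E m)" arbitrary: m rule: less_induct)
  case less
  obtain a f where a: "unfactorizable E a" "f \<in> Mor E" "Dom E a = Cod E f" "m = a \<cdot> f"
    using non_iso_factor[OF less.prems] by blast
  show ?case
  proof (cases "Dom E f = Cod E f")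
    case True
    then have "unfactorizable E m" using unfactorizable_Comp_Aut[of a f] a by (auto simp: Aut_iff)
    then show ?thesis using is_decomposition_single by blast
  next
    case False
    have "height (Cod E f) < height (Cod E m)"
      using height_less[of a] a by (auto simp: unfactorizable_iff Cod_Comp)
    from less.hyps[OF this a(2) False] show ?thesis
      using is_decomposition_snoc[of f _ a] a by blast
  qed
qed

section \<open>Unique factorization in terms of the last arrow\<close>

lemma is_path_vertex: "is_path E x as y \<Longrightarrow> vertex E x as (length as) = y"
proof (induction as arbitrary: x)
  case (Cons a as)
  then show ?case by (cases as) (auto simp: vertex_def)
qed (simp add: vertex_def)

text \<open>Pasting the squares of a commutative ladder. The rungs \<open>h\<close> are indexed by
  vertices, so there is one more rung than there are arrows in each path.\<close>

lemma composite_intertwine: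
  assumes "is_path E x as y" "is_path E x' bs y'" "length as = length bs"
    "h 0 \<in> Mor E" "Dom E (h 0) = x" "Cod E (h 0) = x'"
    "\<And>i. i < length as \<Longrightarrow> h (Suc i) \<in> Mor E \<and> Dom E (h (Suc i)) = Cod E (as ! i) \<and> Cod E (h (Suc i)) = Cod E (bs ! i)"
    "\<And>i. i < length as \<Longrightarrow> h (Suc i) \<cdot> as ! i = bs ! i \<cdot> h i"
  shows "h (length as) \<cdot> composite E x as = composite E x' bs \<cdot> h 0"
  using assms
proof (induction as arbitrary: x x' bs h)
  case Nil
  then show ?case using Id_left[of "h 0"] Id_right[of "h 0"] by auto
next
  case (Cons a as)
  from Cons.prems(3) obtain b bs' where bs: "bs = b # bs'" by (cases bs) auto
  have st: "h 1 \<in> Mor E" "Dom E (h 1) = Cod E a" "Cod E (h 1) = Cod E b" "h 1 \<cdot> a = b \<cdot> h 0"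
    using Cons.prems(7,8)[of 0] bs by auto
  \<comment> \<open>The tails form a ladder whose rungs are \<open>h\<close> shifted by one.\<close>
  have "h (Suc (length as)) \<cdot> composite E (Cod E a) as = composite E (Cod E b) bs' \<cdot> h 1"
  proof -
    have "(\<lambda>i. h (Suc i)) (length as) \<cdot> composite E (Cod E a) as = composite E (Cod E b) bs' \<cdot> (\<lambda>i. h (Suc i)) 0"
    proof (rule Cons.IH)
      fix i assume "i < length as"
      then show "h (Suc (Suc i)) \<in> Mor E \<and> Dom E (h (Suc (Suc i))) = Cod E (as ! i) \<and> Cod E (h (Suc (Suc i))) = Cod E (bs' ! i)"
        "h (Suc (Suc i)) \<cdot> as ! i = bs' ! i \<cdot> h (Suc i)"
        using Cons.prems(7,8)[of "Suc i"] bs by auto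
    qed (use Cons.prems bs st in auto)
    then show ?thesis by simp
  qed
  moreover have "h (Suc (length as)) \<in> Mor E \<and> Dom E (h (Suc (length as))) = y"
    using Cons.prems(7)[of "length as"] is_path_vertex[OF Cons.prems(1)] by (simp add: vertex_def)
  ultimately show ?case
    using Cons.prems bs st composite_path[of "Cod E a" as y] composite_path[of "Cod E b" bs' y']
      Comp_assoc[of "h (Suc (length as))" "composite E (Cod E a) as" a]
      Comp_assoc[of "composite E (Cod E b) bs'" "h 1" a]
      Comp_assoc[of "composite E (Cod E b) bs'" b "h 0"]
    by auto
qed

text \<open>The form in which unique factorization is used. Decompositions of \<open>f\<close> and
  \<open>f'\<close> are extended by \<open>a\<close> and \<open>b\<close>; the rung of the resulting
  ladder at the source of these last arrows is \<open>g\<close>. The last square, which ends in an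
  identity, reads \<open>a = b \<cdot> g\<close>, and the squares before it paste to
  \<open>g \<cdot> f = f'\<close>.\<close>

lemma unfactorizable_Comp_eq:
  assumes a: "unfactorizable E a" "f \<in> Mor E" "Dom E a = Cod E f"
    and b: "unfactorizable E b" "f' \<in> Mor E" "Dom E b = Cod E f'"
    and eq: "a \<cdot> f = b \<cdot> f'"
  shows "Dom E a = Dom E b \<and> (\<exists>g \<in> Aut E (Dom E a). g \<cdot> f = f' \<and> a = b \<cdot> g)"
proof -
  let ?m = "a \<cdot> f"
  have M: "a \<in> Mor E" "b \<in> Mor E" "Dom E a \<noteq> Cod E a" "Dom E b \<noteq> Cod E b"
    using a b by (auto simp: unfactorizable_iff)
  have m: "?m \<in> Mor E" "\<not> iso_mor E ?m" "Dom E ?m = Dom E f" "Cod E ?m = Cod E a"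
    using M a Comp_non_iso[of a f] by (auto simp: Comp_closed iso_mor_iff Dom_Comp Cod_Comp)
  have mf': "Dom E f' = Dom E f" "Cod E b = Cod E a" using eq m M b by (metis Dom_Comp, metis Cod_Comp)
  have ufp: "is_decomposition E ?m as \<Longrightarrow> is_decomposition E ?m bs \<Longrightarrow>
          length as = length bs \<and>
          (\<forall>i \<le> length as. vertex E (Dom E ?m) as i = vertex E (Dom E ?m) bs i) \<and>
          (\<exists>h. h 0 = Ident E (Dom E ?m) \<and> h (length as) = Ident E (Cod E ?m) \<and>
             (\<forall>i. 1 \<le> i \<and> i < length as \<longrightarrow> h i \<in> Aut E (vertex E (Dom E ?m) as i)) \<and>
             (\<forall>i. 1 \<le> i \<and> i \<le> length as \<longrightarrow>
                h i \<cdot> (as ! (i - 1)) = (bs ! (i - 1)) \<cdot> h (i - 1)))" for as bs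
    using UFP m unfolding unique_factorization_def by blast
  have single: "is_decomposition E ?m [?m]" if "Dom E f = Cod E f \<or> Dom E f' = Cod E f'"
    using is_decomposition_single unfactorizable_Comp_Aut[of a f] unfactorizable_Comp_Aut[of b f'] that a b eq
    by (auto simp: Aut_iff)
  \<comment> \<open>Otherwise the composite would have a decomposition of length one and another of
    length at least two.\<close>
  have iso_iff: "Dom E f = Cod E f \<longleftrightarrow> Dom E f' = Cod E f'"
  proof (rule ccontr)
    assume ne: "\<not> ?thesis"
    then obtain p q where p: "unfactorizable E q" "p \<in> Mor E" "Dom E q = Cod E p" "?m = q \<cdot> p" "Dom E p \<noteq> Cod E p"
      using a b eq by blast
    from decomposition_exists[OF p(2,5)] obtain as where as: "is_decomposition E p as" "as \<noteq> []" by blast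
    have "is_decomposition E ?m (as @ [q])"
      using is_decomposition_snoc[OF as(1) p(1,3,2)] p(4) by simp
    from ufp[OF this single] ne as show False by auto
  qed
  show ?thesis
  proof (cases "Dom E f = Cod E f")
    case True
    then have F: "f \<in> Aut E (Dom E a)" "f' \<in> Aut E (Dom E a)" "Dom E b = Dom E a" using iso_iff mf' a b by (auto simp: Aut_iff)
    \<comment> \<open>For automorphisms there is no ladder, and \<open>g\<close> is forced by
      \<open>g \<cdot> f = f'\<close>.\<close>
    let ?g = "f' \<cdot> inv_mor f"
    have i: "inv_mor f \<in> Aut E (Dom E a)" using inv_mor_Aut F by blast
    have "?g \<in> Aut E (Dom E a)" using F i by (intro Aut_Comp_closed)
    moreover have "?g \<cdot> f = f'" using Comp_inv_mor_cancel(2)[OF F(1), of f'] F by (auto simp: Aut_iff)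
    moreover have "a = b \<cdot> ?g"
      using Comp_inv_mor_cancel(1)[OF F(1), of a] M F i eq Comp_assoc[of b f' "inv_mor f"] by (auto simp: Aut_iff)
    ultimately show ?thesis using F by auto
  next
    case False
    obtain as where as: "is_decomposition E f as" "as \<noteq> []" using decomposition_exists[OF a(2) False] by blast
    obtain bs where bs: "is_decomposition E f' bs" "bs \<noteq> []" using decomposition_exists[OF b(2)] False iso_iff by blast
    have dec: "is_decomposition E ?m (as @ [a])" "is_decomposition E ?m (bs @ [b])"
      using is_decomposition_snoc[OF as(1) a(1,3,2)] is_decomposition_snoc[OF bs(1) b(1,3,2)] eq by auto
    from ufp[OF dec, unfolded m(3,4)] have l: "length as = length bs"
      and vert: "\<And>i. i \<le> Suc (length as) \<Longrightarrow> vertex E (Dom E f) (as @ [a]) i = vertex E (Dom E f) (bs @ [b]) i"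
      by auto
    from ufp[OF dec, unfolded m(3,4)] obtain h where h: "h 0 = Ident E (Dom E f)" "h (Suc (length as)) = Ident E (Cod E a)"
      "\<forall>i. 1 \<le> i \<and> i < length (as @ [a]) \<longrightarrow> h i \<in> Aut E (vertex E (Dom E f) (as @ [a]) i)"
      "\<forall>i. 1 \<le> i \<and> i \<le> length (as @ [a]) \<longrightarrow> h i \<cdot> ((as @ [a]) ! (i - 1)) = ((bs @ [b]) ! (i - 1)) \<cdot> h (i - 1)"
      by (elim conjE exE) simp
    note h0 = h(1) and hl = h(2)
    have hA: "h i \<in> Aut E (vertex E (Dom E f) (as @ [a]) i)" if "1 \<le> i" "i \<le> length as" for i
      using h(3) that by simp
    have hc: "h (Suc i) \<cdot> ((as @ [a]) ! i) = ((bs @ [b]) ! i) \<cdot> h i" if "i \<le> length as" for i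
      using h(4)[rule_format, of "Suc i"] that by simp
    have paths: "is_path E (Dom E f) as (Cod E f)" "is_path E (Dom E f) bs (Cod E f')"
      "composite E (Dom E f) as = f" "composite E (Dom E f) bs = f'"
      using as bs mf' by (auto simp: is_decomposition_def)
    have va: "vertex E (Dom E f) (as @ [a]) i = vertex E (Dom E f) as i" if "i \<le> length as" for i
      using that by (auto simp: vertex_def nth_append split: nat.splits)
    have vb: "vertex E (Dom E f) (bs @ [b]) i = vertex E (Dom E f) bs i" if "i \<le> length as" for i
      using that l by (auto simp: vertex_def nth_append split: nat.splits)
    have dd: "Cod E f = Cod E f'"
      using vert[of "length as"] va[of "length as"] vb[of "length as"] is_path_vertex[OF paths(1)]
        is_path_vertex[OF paths(2)] l by simp
    let ?g = "h (length as)"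
    \<comment> \<open>Automorphisms are provided only at inner vertices, so the source of
      \<open>a\<close> must not be vertex 0.\<close>
    have "1 \<le> length as" using as by (cases as) auto
    then have g: "?g \<in> Aut E (Dom E a)"
      using hA[of "length as"] va[of "length as"] is_path_vertex[OF paths(1)] a by auto
    have "h (length as) \<cdot> composite E (Dom E f) as = composite E (Dom E f) bs \<cdot> h 0"
    proof (rule composite_intertwine[OF paths(1,2) l])
      fix i assume i: "i < length as"
      then have "h (Suc i) \<in> Aut E (Cod E (as ! i))" "Cod E (as ! i) = Cod E (bs ! i)"
        using hA[of "Suc i"] va[of "Suc i"] vert[of "Suc i"] vb[of "Suc i"] by (auto simp: vertex_def)
      then show "h (Suc i) \<in> Mor E \<and> Dom E (h (Suc i)) = Cod E (as ! i) \<and> Cod E (h (Suc i)) = Cod E (bs ! i)"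
        by (auto simp: Aut_iff)
      show "h (Suc i) \<cdot> as ! i = bs ! i \<cdot> h i" using hc[of i] i l by (auto simp: nth_append)
    qed (use h0 a Dom_closed Id_closed Dom_Id Cod_Id in auto)
    then have gf: "?g \<cdot> f = f'" using paths h0 Id_right[of f'] b mf' by auto
    have "a = b \<cdot> ?g" using hc[of "length as"] hl l Id_left[of a] M by (auto simp: nth_append)
    with g gf dd a b show ?thesis by auto
  qed
qed

end

section \<open>Free modules as function spaces\<close>

lemma sum_fun_apply: "(\<Sum>x\<in>A. f x) i = (\<Sum>x\<in>A. f x i)"
  by (induction A rule: infinite_finite_induct) auto

definition scl :: "'k::field \<Rightarrow> ('p \<Rightarrow> 'b \<Rightarrow> 'k) \<Rightarrow> 'p \<Rightarrow> 'b \<Rightarrow> 'k" where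
  "scl c u = (\<lambda>i m. c * u i m)"

definition delta :: "'p \<Rightarrow> 'b \<Rightarrow> 'p \<Rightarrow> 'b \<Rightarrow> 'k::field" where
  "delta i f = (\<lambda>j m. if j = i \<and> m = f then 1 else 0)"

lemma scl_simps [simp]: "scl 0 u = 0" "scl c 0 = 0" "scl 1 u = u" "scl c (scl d u) = scl (c * d) u"
  by (auto simp: scl_def fun_eq_iff)

lemma scl_add: "scl c (u + v) = scl c u + scl c v" "scl (c + d) u = scl c u + scl d u"
  and scl_diff: "scl c (u - v) = scl c u - scl c v"
  by (auto simp: scl_def fun_eq_iff algebra_simps)

lemma scl_sum: "scl c (\<Sum>a\<in>A. f a) = (\<Sum>a\<in>A. scl c (f a))" "scl (\<Sum>a\<in>A. k a) u = (\<Sum>a\<in>A. scl (k a) u)"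
  by (auto simp: scl_def fun_eq_iff sum_fun_apply sum_distrib_left sum_distrib_right)

context skeletal_free_EI_category
begin

text \<open>The functions in \<open>free_space\<close> form the free module over the category algebra with
  basis the whole type of the first argument; \<open>act\<close> is left multiplication by a morphism.\<close>

definition free_space :: "('p \<Rightarrow> 'b \<Rightarrow> 'k::field) set" where
  "free_space = {u. (\<forall>i m. m \<notin> Mor E \<longrightarrow> u i m = 0) \<and> finite {i. u i \<noteq> 0}}"

definition act :: "'b \<Rightarrow> ('p \<Rightarrow> 'b \<Rightarrow> 'k::field) \<Rightarrow> 'p \<Rightarrow> 'b \<Rightarrow> 'k" where
  "act g u = (\<lambda>i m. \<Sum>f \<in> {f \<in> Mor E. Cod E f = Dom E g \<and> g \<cdot> f = m}. u i f)"

text \<open>Linearity over k, demanded on \<open>free_space\<close> only: functions outside it do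
  not represent module elements.\<close>

definition lin :: "(('p \<Rightarrow> 'b \<Rightarrow> 'k::field) \<Rightarrow> 'q \<Rightarrow> 'b \<Rightarrow> 'k) \<Rightarrow> bool" where
  "lin L \<longleftrightarrow> (\<forall>u \<in> free_space. L u \<in> free_space) \<and>
     (\<forall>u \<in> free_space. \<forall>v \<in> free_space. L (u + v) = L u + L v) \<and>
     (\<forall>c. \<forall>u \<in> free_space. L (scl c u) = scl c (L u))"

lemma free_space_zero: "0 \<in> free_space"
  by (simp add: free_space_def)

lemma free_space_add: "u \<in> free_space \<Longrightarrow> v \<in> free_space \<Longrightarrow> u + v \<in> free_space"
  unfolding free_space_def
  by (auto intro: finite_subset[of _ "{i. u i \<noteq> 0} \<union> {i. v i \<noteq> 0}"])

lemma free_space_scl: "u \<in> free_space \<Longrightarrow> scl c u \<in> free_space"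
  unfolding free_space_def scl_def
  by (auto intro: finite_subset[of _ "{i. u i \<noteq> 0}"] simp: fun_eq_iff)

lemma free_space_diff: "u \<in> free_space \<Longrightarrow> v \<in> free_space \<Longrightarrow> u - v \<in> free_space"
  unfolding free_space_def
  by (auto intro: finite_subset[of _ "{i. u i \<noteq> 0} \<union> {i. v i \<noteq> 0}"])

lemma free_space_sum: "(\<And>a. a \<in> A \<Longrightarrow> f a \<in> free_space) \<Longrightarrow> (\<Sum>a\<in>A. f a) \<in> free_space"
  by (induction A rule: infinite_finite_induct) (auto simp: free_space_zero free_space_add)

lemma free_space_delta: "f \<in> Mor E \<Longrightarrow> delta i f \<in> free_space"
  unfolding free_space_def delta_def
  by (auto intro: finite_subset[of _ "{i}"] simp: fun_eq_iff)

lemma free_space_act: "g \<in> Mor E \<Longrightarrow> u \<in> free_space \<Longrightarrow> act g u \<in> free_space"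
proof -
  assume g: "g \<in> Mor E" and u: "u \<in> free_space"
  have "act g u i m = 0" if "m \<notin> Mor E" for i m
    unfolding act_def using that g by (intro sum.neutral) (auto simp: Comp_closed)
  moreover have "{i. act g u i \<noteq> 0} \<subseteq> {i. u i \<noteq> 0}"
    by (auto simp: act_def fun_eq_iff intro: sum.neutral)
  ultimately show ?thesis using u by (auto simp: free_space_def dest: finite_subset)
qed

lemma act_add: "act g (u + v) = act g u + act g v"
  and act_diff: "act g (u - v) = act g u - act g v"
  and act_scl: "act g (scl c u) = scl c (act g u)"
  and act_zero: "act g 0 = 0"
  by (auto simp: act_def fun_eq_iff sum.distrib sum_subtractf scl_def sum_distrib_left)

lemma act_sum: "act g (\<Sum>a\<in>A. f a) = (\<Sum>a\<in>A. act g (f a))"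
  by (induction A rule: infinite_finite_induct) 
    (simp_all add: act_zero act_add del: plus_fun_apply zero_fun_apply)

lemma lin_act: "g \<in> Mor E \<Longrightarrow> lin (act g)"
  by (simp add: lin_def free_space_act act_add act_scl)

lemma act_Comp:
  assumes g: "g \<in> Mor E" "f \<in> Mor E" "Dom E g = Cod E f"
  shows "act g (act f u) = act (g \<cdot> f) u"
proof (intro ext)
  fix i m
  have "act g (act f u) i m = (\<Sum>q \<in> {q \<in> Mor E. Cod E q = Dom E g \<and> g \<cdot> q = m}.
      \<Sum>p \<in> {p \<in> Mor E. Cod E p = Dom E f \<and> f \<cdot> p = q}. u i p)"
    by (simp add: act_def)
  also have "\<dots> = (\<Sum>(q, p) \<in> (SIGMA q : {q \<in> Mor E. Cod E q = Dom E g \<and> g \<cdot> q = m}.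
      {p \<in> Mor E. Cod E p = Dom E f \<and> f \<cdot> p = q}). u i p)"
    using finite_Mor by (subst sum.Sigma) auto
  also have "\<dots> = (\<Sum>p \<in> {p \<in> Mor E. Cod E p = Dom E (g \<cdot> f) \<and> (g \<cdot> f) \<cdot> p = m}. u i p)"
    by (rule sum.reindex_bij_witness[where j = snd and i = "\<lambda>p. (f \<cdot> p, p)"])
      (use g in \<open>auto simp: Comp_closed Dom_Comp Cod_Comp Comp_assoc\<close>)
  finally show "act g (act f u) i m = act (g \<cdot> f) u i m" by (simp add: act_def)
qed

lemma act_act_zero:
  assumes "f \<in> Mor E" "Dom E g \<noteq> Cod E f" shows "act g (act f u) = 0"
proof (intro ext)
  fix i m
  have "act f u i p = 0" if "p \<in> Mor E" "Cod E p = Dom E g" for p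
    unfolding act_def using that assms by (intro sum.neutral) (auto simp: Cod_Comp)
  then show "act g (act f u) i m = 0 i m"
    unfolding act_def[of g] by (auto intro: sum.neutral)
qed

lemma act_delta:
  assumes "f \<in> Mor E"
  shows "act g (delta i f) = (if Dom E g = Cod E f then delta i (g \<cdot> f) else 0)"
proof (intro ext)
  fix j m
  have "act g (delta i f) j m = (\<Sum>p \<in> {p \<in> Mor E. Cod E p = Dom E g \<and> g \<cdot> p = m}. if p = f then (if j = i then 1 else 0) else 0)"
    unfolding act_def delta_def by (rule sum.cong) auto
  also have "\<dots> = (if f \<in> {p \<in> Mor E. Cod E p = Dom E g \<and> g \<cdot> p = m} then (if j = i then 1 else 0) else 0)"
    using finite_Mor by (subst sum.delta) auto
  finally show "act g (delta i f) j m = (if Dom E g = Cod E f then delta i (g \<cdot> f) else 0) j m"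
    using assms by (auto simp: delta_def)
qed

text \<open>An automorphism permutes the basis elements with target \<open>x\<close>, so the fibre
  sum in \<open>act\<close> has at most one term.\<close>

lemma act_Aut:
  assumes g: "g \<in> Aut E x"
  shows "act g u i m = (if m \<in> Mor E \<and> Cod E m = x then u i (inv_mor g \<cdot> m) else 0)"
proof -
  have "{f \<in> Mor E. Cod E f = Dom E g \<and> g \<cdot> f = m} = (if m \<in> Mor E \<and> Cod E m = x then {inv_mor g \<cdot> m} else {})"
    using g inv_mor_Aut[OF g] inv_mor_Comp_cancel[OF g] by (auto simp: Aut_iff Comp_closed Cod_Comp)
  then show ?thesis by (simp add: act_def)
qed

lemma inv_mor_Ident: "x \<in> Obj E \<Longrightarrow> inv_mor (Ident E x) = Ident E x"
  using Id_left[of "Ident E x"] by (intro inv_mor_unique[where x = x]) (auto simp: Ident_in_Aut Id_closed Cod_Id)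

lemma act_Ident:
  "x \<in> Obj E \<Longrightarrow> act (Ident E x) u i m = (if m \<in> Mor E \<and> Cod E m = x then u i m else 0)"
  using act_Aut[OF Ident_in_Aut, of x u i m] Id_left[of m] by (auto simp: inv_mor_Ident)

lemma act_Comp_Ident: "g \<in> Mor E \<Longrightarrow> act g (act (Ident E (Dom E g)) u) = act g u"
  by (simp add: act_Comp Id_closed Dom_closed Cod_Id Id_right)

section \<open>Linear maps and their construction from values on basis elements\<close>

lemma lin_zero: "lin L \<Longrightarrow> L 0 = 0"
  using free_space_zero unfolding lin_def by (metis add_cancel_left_left)

lemma lin_add: "lin L \<Longrightarrow> u \<in> free_space \<Longrightarrow> v \<in> free_space \<Longrightarrow> L (u + v) = L u + L v"
  and lin_scl: "lin L \<Longrightarrow> u \<in> free_space \<Longrightarrow> L (scl c u) = scl c (L u)"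
  and lin_closed: "lin L \<Longrightarrow> u \<in> free_space \<Longrightarrow> L u \<in> free_space"
  by (auto simp: lin_def)

lemma lin_diff: "lin L \<Longrightarrow> u \<in> free_space \<Longrightarrow> v \<in> free_space \<Longrightarrow> L (u - v) = L u - L v"
  using lin_add[of L "u - v" v] by (auto simp: free_space_diff)

lemma lin_sum:
  "lin L \<Longrightarrow> (\<And>a. a \<in> A \<Longrightarrow> f a \<in> free_space) \<Longrightarrow> L (\<Sum>a\<in>A. f a) = (\<Sum>a\<in>A. L (f a))"
  by (induction A rule: infinite_finite_induct)
    (simp_all add: lin_zero lin_add free_space_sum del: plus_fun_apply zero_fun_apply)

lemma lin_comp: "lin L \<Longrightarrow> lin L' \<Longrightarrow> lin (\<lambda>u. L (L' u))"
  by (simp add: lin_def)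

lemma lin_minus: "lin L \<Longrightarrow> lin L' \<Longrightarrow> lin (\<lambda>u. L u - L' u)"
  by (simp add: lin_def free_space_diff scl_diff)

lemma lin_ident: "lin (\<lambda>u. u)"
  by (simp add: lin_def)

text \<open>The linear map that sends the basis element \<open>delta i f\<close> to
  \<open>w i f\<close> if \<open>f\<close> has target \<open>x\<close>, and to 0 for the other
  morphisms. Only its part on the targets \<open>x\<close> matters, because these are what an arrow
  out of \<open>x\<close> can be composed with.\<close>

definition wsum :: "('p \<Rightarrow> 'b \<Rightarrow> 'q \<Rightarrow> 'b \<Rightarrow> 'k::field) \<Rightarrow> 'a \<Rightarrow> ('p \<Rightarrow> 'b \<Rightarrow> 'k) \<Rightarrow> 'q \<Rightarrow> 'b \<Rightarrow> 'k" where
  "wsum w x u = (\<Sum>i \<in> {i. u i \<noteq> 0}. \<Sum>f \<in> {f \<in> Mor E. Cod E f = x}. scl (u i f) (w i f))"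

lemma wsum_superset:
  "finite S \<Longrightarrow> {i. u i \<noteq> 0} \<subseteq> S \<Longrightarrow> wsum w x u = (\<Sum>i \<in> S. \<Sum>f \<in> {f \<in> Mor E. Cod E f = x}. scl (u i f) (w i f))"
  unfolding wsum_def by (rule sum.mono_neutral_left) auto

lemma lin_wsum:
  fixes w :: "'p \<Rightarrow> 'b \<Rightarrow> 'q \<Rightarrow> 'b \<Rightarrow> 'k::field"
  assumes "\<And>i f. f \<in> Mor E \<Longrightarrow> Cod E f = x \<Longrightarrow> w i f \<in> free_space"
  shows "lin (wsum w x)"
  unfolding lin_def
proof (intro conjI ballI allI)
  fix u v :: "'p \<Rightarrow> 'b \<Rightarrow> 'k" and c :: 'k
  assume u: "u \<in> free_space"
  show "wsum w x u \<in> free_space"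
    unfolding wsum_def by (intro free_space_sum free_space_scl assms) auto
  have fu: "finite {i. u i \<noteq> 0}" using u by (auto simp: free_space_def)
  have "{i. scl c u i \<noteq> 0} \<subseteq> {i. u i \<noteq> 0}" by (auto simp: scl_def fun_eq_iff)
  then have "wsum w x (scl c u) = (\<Sum>i \<in> {i. u i \<noteq> 0}. \<Sum>f \<in> {f \<in> Mor E. Cod E f = x}. scl (scl c u i f) (w i f))"
    by (rule wsum_superset[OF fu])
  then show "wsum w x (scl c u) = scl c (wsum w x u)"
    unfolding wsum_def scl_sum by (auto simp: scl_def[of c u])
  assume v: "v \<in> free_space"
  let ?S = "{i. u i \<noteq> 0} \<union> {i. v i \<noteq> 0}"
  have S: "finite ?S" using u v by (auto simp: free_space_def)
  have "wsum w x u = (\<Sum>i \<in> ?S. \<Sum>f \<in> {f \<in> Mor E. Cod E f = x}. scl (u i f) (w i f))"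
    "wsum w x v = (\<Sum>i \<in> ?S. \<Sum>f \<in> {f \<in> Mor E. Cod E f = x}. scl (v i f) (w i f))"
    "wsum w x (u + v) = (\<Sum>i \<in> ?S. \<Sum>f \<in> {f \<in> Mor E. Cod E f = x}. scl ((u + v) i f) (w i f))"
    by (rule wsum_superset[OF S]; auto)+
  then show "wsum w x (u + v) = wsum w x u + wsum w x v"
    by (simp add: scl_add sum.distrib)
qed

text \<open>Presents the idempotent of \<open>x\<close> as a \<open>wsum\<close>, so that linear
  maps on its image can be compared on basis elements.\<close>

lemma act_Ident_wsum:
  assumes u: "u \<in> free_space" and x: "x \<in> Obj E"
  shows "act (Ident E x) u = wsum delta x u"
proof (intro ext)
  fix j m
  have fin: "finite {i. u i \<noteq> 0}" using u by (auto simp: free_space_def)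
  have "wsum delta x u j m = (\<Sum>i \<in> {i. u i \<noteq> 0}. \<Sum>f \<in> {f \<in> Mor E. Cod E f = x}. if i = j then (if f = m then u i f else 0) else 0)"
    unfolding wsum_def sum_fun_apply scl_def delta_def by (intro sum.cong refl) auto
  also have "\<dots> = (\<Sum>i \<in> {i. u i \<noteq> 0}. if i = j then (\<Sum>f \<in> {f \<in> Mor E. Cod E f = x}. if f = m then u i f else 0) else 0)"
    by (intro sum.cong refl) auto
  also have "\<dots> = (if m \<in> Mor E \<and> Cod E m = x then u j m else 0)"
    using fin finite_Mor by (auto simp: sum.delta)
  finally show "act (Ident E x) u j m = wsum delta x u j m" using x by (simp add: act_Ident)
qed

lemma lin_wsum_eq:
  assumes L: "lin L" and w: "\<And>i f. f \<in> Mor E \<Longrightarrow> Cod E f = x \<Longrightarrow> w i f \<in> free_space"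
  shows "L (wsum w x u) = wsum (\<lambda>i f. L (w i f)) x u"
proof -
  have "L (wsum w x u) = (\<Sum>i \<in> {i. u i \<noteq> 0}. L (\<Sum>f \<in> {f \<in> Mor E. Cod E f = x}. scl (u i f) (w i f)))"
    unfolding wsum_def by (rule lin_sum[OF L]) (auto intro!: free_space_sum free_space_scl w)
  also have "\<dots> = (\<Sum>i \<in> {i. u i \<noteq> 0}. \<Sum>f \<in> {f \<in> Mor E. Cod E f = x}. L (scl (u i f) (w i f)))"
    by (intro sum.cong refl lin_sum[OF L]) (auto intro!: free_space_scl w)
  also have "\<dots> = wsum (\<lambda>i f. L (w i f)) x u"
    unfolding wsum_def by (intro sum.cong refl lin_scl[OF L]) (auto intro!: w)
  finally show ?thesis .
qed

lemma wsum_cong: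
  "(\<And>i f. f \<in> Mor E \<Longrightarrow> Cod E f = x \<Longrightarrow> w i f = w' i f) \<Longrightarrow> wsum w x u = wsum w' x u"
  unfolding wsum_def by (intro sum.cong refl) auto

text \<open>Commutation with Aut(x) tested on basis elements; \<open>act_wsum\<close> turns it into
  commutation of the whole map.\<close>

definition equivariant_weight :: "'a \<Rightarrow> ('p \<Rightarrow> 'b \<Rightarrow> 'q \<Rightarrow> 'b \<Rightarrow> 'k::field) \<Rightarrow> bool" where
  "equivariant_weight x w \<longleftrightarrow> (\<forall>i. \<forall>f \<in> Mor E. Cod E f = x \<longrightarrow> w i f \<in> free_space \<and>
     (\<forall>g \<in> Aut E x. w i (g \<cdot> f) = act g (w i f)))"

lemma equivariant_weightD:
  assumes "equivariant_weight x w" "f \<in> Mor E" "Cod E f = x"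
  shows "w i f \<in> free_space" "g \<in> Aut E x \<Longrightarrow> w i (g \<cdot> f) = act g (w i f)"
  using assms by (auto simp: equivariant_weight_def)

text \<open>Left multiplication by \<open>g\<close> permutes the morphisms into \<open>x\<close>, so
  the inner sum can be reindexed along it.\<close>

lemma act_wsum:
  assumes w: "equivariant_weight x w" and g: "g \<in> Aut E x" and u: "u \<in> free_space"
  shows "act g (wsum w x u) = wsum w x (act g u)"
proof -
  have fin: "finite {i. u i \<noteq> 0}" using u by (simp add: free_space_def)
  let ?S = "{f \<in> Mor E. Cod E f = x}"
  have g': "g \<in> Mor E" using g by (simp add: Aut_iff)
  have "act g (wsum w x u) = wsum (\<lambda>i f. act g (w i f)) x u"
    by (rule lin_wsum_eq[OF lin_act[OF g']]) (rule equivariant_weightD(1)[OF w])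
  also have "\<dots> = wsum (\<lambda>i f. w i (g \<cdot> f)) x u"
    by (rule wsum_cong) (simp add: equivariant_weightD(2)[OF w _ _ g])
  also have "\<dots> = (\<Sum>i \<in> {i. u i \<noteq> 0}. \<Sum>f \<in> ?S. scl (act g u i (g \<cdot> f)) (w i (g \<cdot> f)))"
    unfolding wsum_def using g
    by (intro sum.cong refl) (auto simp: act_Aut[OF g] inv_mor_Comp_cancel(1)[OF g] Aut_iff Comp_closed Cod_Comp)
  also have "\<dots> = (\<Sum>i \<in> {i. u i \<noteq> 0}. \<Sum>f \<in> ?S. scl (act g u i f) (w i f))"
    using bij_betw_Aut_Comp[OF g] by (intro sum.cong refl sum.reindex_bij_betw)
  also have "\<dots> = wsum w x (act g u)"
    by (rule wsum_superset[OF fin, symmetric]) (auto simp: act_def fun_eq_iff intro: sum.neutral)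
  finally show ?thesis .
qed

text \<open>The fibres of composition with \<open>a\<close> are the orbits of H = {g. a g = a}. This
  is the identification of aP with coinvariants of H, seen on the basis.\<close>

lemma unfactorizable_fibre:
  assumes a: "unfactorizable E a" "Dom E a = x"
    and f: "f \<in> Mor E" "Cod E f = x" "f' \<in> Mor E" "Cod E f' = x" "a \<cdot> f = a \<cdot> f'"
  obtains g where "g \<in> Aut E x" "a \<cdot> g = a" "g \<cdot> f = f'"
  using unfactorizable_Comp_eq[OF a(1) f(1) _ a(1) f(3) _ f(5)] a f that by auto

text \<open>Elements killed by \<open>a\<close> are those that vanish in the coinvariants of H, and
  an equivariant map descends to coinvariants.\<close>

lemma act_wsum_eq_zero:
  assumes w: "equivariant_weight x w" and a: "unfactorizable E a" "Dom E a = x"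
    and u: "act a u = 0"
  shows "act a (wsum w x u) = 0"
proof -
  let ?S = "{f \<in> Mor E. Cod E f = x}"
  have aM: "a \<in> Mor E" using a by (simp add: unfactorizable_def)
  \<comment> \<open>The common value of \<open>act a (w i f)\<close> on the fibre over
    \<open>m\<close>. It is independent of \<open>f\<close>, since two members of a fibre differ by
    some \<open>g\<close> with \<open>a \<cdot> g = a\<close>.\<close>
  define W where "W i m = act a (w i (SOME f. f \<in> ?S \<and> a \<cdot> f = m))" for i m
  have W: "act a (w i f) = W i (a \<cdot> f)" if f: "f \<in> ?S" for i f
  proof -
    let ?f = "SOME f'. f' \<in> ?S \<and> a \<cdot> f' = a \<cdot> f"
    have "?f \<in> ?S \<and> a \<cdot> ?f = a \<cdot> f" by (rule someI_ex) (use f in blast)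
    then obtain g where g: "g \<in> Aut E x" "a \<cdot> g = a" "g \<cdot> f = ?f"
      using unfactorizable_fibre[OF a, of f ?f] f by auto
    have "W i (a \<cdot> f) = act a (act g (w i f))"
      unfolding W_def g(3)[symmetric] using equivariant_weightD(2)[OF w _ _ g(1)] f by simp
    also have "\<dots> = act a (w i f)" using act_Comp[OF aM, of g] g a by (auto simp: Aut_iff)
    finally show ?thesis by simp
  qed
  have "(\<Sum>f \<in> ?S. scl (u i f) (act a (w i f))) = 0" for i
  proof -
    have "(\<Sum>f \<in> ?S. scl (u i f) (act a (w i f))) = (\<Sum>f \<in> ?S. scl (u i f) (W i (a \<cdot> f)))"
      by (intro sum.cong refl) (simp add: W)
    also have "\<dots> = (\<Sum>m \<in> (\<lambda>f. a \<cdot> f) ` ?S. \<Sum>f \<in> {f \<in> ?S. a \<cdot> f = m}. scl (u i f) (W i (a \<cdot> f)))"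
      by (rule sum.image_gen) (use finite_Mor in simp)
    also have "\<dots> = (\<Sum>m \<in> (\<lambda>f. a \<cdot> f) ` ?S. scl (act a u i m) (W i m))"
      unfolding act_def scl_sum using a by (intro sum.cong refl) auto
    finally show ?thesis using u by simp
  qed
  then have "wsum (\<lambda>i f. act a (w i f)) x u = 0" by (simp add: wsum_def)
  then show ?thesis
    using lin_wsum_eq[OF lin_act[OF aM], of x w u] equivariant_weightD(1)[OF w] by simp
qed

text \<open>The elements of the subgroup \<open>H\<close> that carry \<open>f\<close> to
  \<open>h \<cdot> f\<close> form a coset of the stabilizer of \<open>f\<close>.\<close>

lemma card_fibre_Aut:
  assumes H: "H \<subseteq> Aut E x" "\<And>g h. g \<in> H \<Longrightarrow> h \<in> H \<Longrightarrow> g \<cdot> h \<in> H" "\<And>g. g \<in> H \<Longrightarrow> inv_mor g \<in> H"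
    and f: "f \<in> Mor E" "Cod E f = x" and h: "h \<in> H"
  shows "card {g \<in> H. g \<cdot> f = h \<cdot> f} = card {g \<in> H. g \<cdot> f = f}"
proof -
  have hA: "h \<in> Aut E x" using h H by auto
  have c: "\<And>g. g \<in> H \<Longrightarrow> g \<in> Mor E \<and> Dom E g = x \<and> Cod E g = x" using H by (auto simp: Aut_iff)
  have *: "\<forall>g \<in> {g \<in> H. g \<cdot> f = h \<cdot> f}. h \<cdot> (inv_mor h \<cdot> g) = g" "\<forall>g \<in> {g \<in> H. g \<cdot> f = f}. inv_mor h \<cdot> (h \<cdot> g) = g"
    using inv_mor_Comp_cancel[OF hA] c by auto
  have **: "(\<lambda>g. inv_mor h \<cdot> g) ` {g \<in> H. g \<cdot> f = h \<cdot> f} \<subseteq> {g \<in> H. g \<cdot> f = f}"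
  proof (rule image_subsetI)
    fix g assume "g \<in> {g \<in> H. g \<cdot> f = h \<cdot> f}"
    then have g: "g \<in> H" "g \<cdot> f = h \<cdot> f" by auto
    have "(inv_mor h \<cdot> g) \<cdot> f = inv_mor h \<cdot> (h \<cdot> f)"
      using g f c[OF H(3)[OF h]] c[OF g(1)] Comp_assoc[of "inv_mor h" g f] by auto
    then show "inv_mor h \<cdot> g \<in> {g \<in> H. g \<cdot> f = f}" using H(2)[OF H(3)[OF h] g(1)] inv_mor_Comp_cancel[OF hA f] by simp
  qed
  moreover have "(\<lambda>g. h \<cdot> g) ` {g \<in> H. g \<cdot> f = f} \<subseteq> {g \<in> H. g \<cdot> f = h \<cdot> f}"
    using H(2)[OF h] c c[OF h] f by (auto simp: Comp_assoc)
  ultimately show ?thesis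
    by (intro bij_betw_same_card[OF bij_betw_byWitness[OF *]])
qed

text \<open>The norm of H at the basis element \<open>f\<close> counts each point of the orbit of
  \<open>f\<close> equally often, namely as often as the stabilizer of \<open>f\<close> has
  elements. The orbit is a fibre over \<open>a \<cdot> f\<close>, and the sum over a fibre is a
  coefficient of \<open>act a u\<close>. No division occurs.\<close>

lemma stabilizer_norm_eq_zero:
  assumes a: "unfactorizable E a" "Dom E a = x" and u: "act a u = 0"
  shows "(\<Sum>h \<in> {h \<in> Aut E x. a \<cdot> h = a}. act (inv_mor h) u) = 0"
proof (intro ext)
  fix i f
  let ?H = "{h \<in> Aut E x. a \<cdot> h = a}"
  have aM: "a \<in> Mor E" using a by (simp add: unfactorizable_def)
  have Hc: "\<And>g h. g \<in> ?H \<Longrightarrow> h \<in> ?H \<Longrightarrow> g \<cdot> h \<in> ?H"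
    using Comp_assoc[OF aM] a Aut_Comp_closed[of _ x] by (auto simp: Aut_iff) metis
  have Hi: "inv_mor g \<in> ?H" if "g \<in> ?H" for g
    using that Comp_inv_mor_cancel(1)[of g x a] inv_mor_Aut[of g x] aM a by auto
  show "(\<Sum>h \<in> ?H. act (inv_mor h) u) i f = 0 i f"
  proof (cases "f \<in> Mor E \<and> Cod E f = x")
    case False
    then show ?thesis
      unfolding sum_fun_apply by (simp, intro sum.neutral) (auto simp: act_Aut[OF inv_mor_Aut])
  next
    case True
    then have f: "f \<in> Mor E" "Cod E f = x" by auto
    have "(\<Sum>h \<in> ?H. act (inv_mor h) u) i f = (\<Sum>h \<in> ?H. u i (h \<cdot> f))"
      unfolding sum_fun_apply using f by (intro sum.cong refl) (auto simp: act_Aut[OF inv_mor_Aut] inv_mor_inv_mor)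
    also have "\<dots> = (\<Sum>p \<in> (\<lambda>h. h \<cdot> f) ` ?H. \<Sum>h \<in> {h \<in> ?H. h \<cdot> f = p}. u i (h \<cdot> f))"
      by (rule sum.image_gen) (use finite_Aut in simp)
    also have "\<dots> = (\<Sum>p \<in> (\<lambda>h. h \<cdot> f) ` ?H. of_nat (card {h \<in> ?H. h \<cdot> f = p}) * u i p)"
      by (intro sum.cong refl) auto
    also have "\<dots> = (\<Sum>p \<in> (\<lambda>h. h \<cdot> f) ` ?H. of_nat (card {h \<in> ?H. h \<cdot> f = f}) * u i p)"
    proof (intro sum.cong refl)
      fix p assume "p \<in> (\<lambda>h. h \<cdot> f) ` ?H"
      then obtain h where h: "h \<in> ?H" "p = h \<cdot> f" by blast
      have "card {g \<in> ?H. g \<cdot> f = h \<cdot> f} = card {g \<in> ?H. g \<cdot> f = f}"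
        by (rule card_fibre_Aut[OF _ Hc Hi f h(1)]) auto
      then show "of_nat (card {h \<in> ?H. h \<cdot> f = p}) * u i p = of_nat (card {h \<in> ?H. h \<cdot> f = f}) * u i p"
        using h by simp
    qed
    \<comment> \<open>Orbit equals fibre: the nontrivial inclusion is unique factorization.\<close>
    also have "(\<lambda>h. h \<cdot> f) ` ?H = {p \<in> Mor E. Cod E p = Dom E a \<and> a \<cdot> p = a \<cdot> f}" (is "?L = ?R")
    proof (intro equalityI subsetI)
      fix p assume "p \<in> ?L"
      then obtain h where "h \<in> Aut E x" "a \<cdot> h = a" "p = h \<cdot> f" by blast
      then show "p \<in> ?R" using f a aM Comp_assoc[of a h f] by (auto simp: Aut_iff Comp_closed Cod_Comp)
    next
      fix p assume "p \<in> ?R"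
      then obtain g where "g \<in> Aut E x" "a \<cdot> g = a" "g \<cdot> f = p"
        using unfactorizable_fibre[OF a f, of p] a by auto
      then show "p \<in> ?L" by blast
    qed
    also have "(\<Sum>p \<in> ?R. of_nat (card {h \<in> ?H. h \<cdot> f = f}) * u i p) = of_nat (card {h \<in> ?H. h \<cdot> f = f}) * act a u i (a \<cdot> f)"
      unfolding act_def sum_distrib_left ..
    finally show ?thesis using u by simp
  qed
qed

text \<open>This is projectivity over kAut(x) of a permutation module whose point stabilizers have
  invertible order. Lifts of \<open>K\<close> through \<open>D\<close> are chosen freely at one
  representative of each orbit and averaged over the elements that move it to \<open>f\<close>;
  averages remain lifts because \<open>D\<close> and \<open>K\<close> commute with Aut(x).\<close>

lemma left_regular_lift:
  fixes D :: "('q \<Rightarrow> 'b \<Rightarrow> 'k::field) \<Rightarrow> 'r \<Rightarrow> 'b \<Rightarrow> 'k" and K :: "('p \<Rightarrow> 'b \<Rightarrow> 'k) \<Rightarrow> 'r \<Rightarrow> 'b \<Rightarrow> 'k"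
  assumes reg: "left_regular TYPE('k) E x" and x: "x \<in> Obj E"
    and D: "lin D" "\<And>g u. g \<in> Aut E x \<Longrightarrow> u \<in> free_space \<Longrightarrow> D (act g u) = act g (D u)"
    and K: "lin K" "\<And>g u. g \<in> Aut E x \<Longrightarrow> u \<in> free_space \<Longrightarrow> K (act g u) = act g (K u)"
    and lift: "\<And>u. u \<in> free_space \<Longrightarrow> \<exists>w \<in> free_space. K u = D w"
  shows "\<exists>w. equivariant_weight x w \<and> (\<forall>u \<in> free_space. D (wsum w x u) = K (act (Ident E x) u))"
proof -
  let ?S = "{f \<in> Mor E. Cod E f = x}"
  define rep where "rep f = (SOME r. r \<in> ?S \<and> (\<exists>g \<in> Aut E x. g \<cdot> r = f))" for f
  define S where "S f = {g \<in> Aut E x. g \<cdot> rep f = f}" for f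
  define w0 where "w0 i f = (SOME w. w \<in> free_space \<and> K (delta i f) = D w)" for i f
  define w where "w i f = scl (1 / of_nat (card (S f))) (\<Sum>g \<in> S f. act g (w0 i (rep f)))" for i f
  have w0: "w0 i f \<in> free_space" "D (w0 i f) = K (delta i f)" if "f \<in> Mor E" for i f
    using someI_ex[of "\<lambda>w. w \<in> free_space \<and> K (delta i f) = D w"] lift[OF free_space_delta[OF that, of i]]
    unfolding w0_def by metis+
  have rep: "rep f \<in> ?S" "\<exists>g \<in> Aut E x. g \<cdot> rep f = f" if "f \<in> ?S" for f
  proof -
    have "\<exists>r. r \<in> ?S \<and> (\<exists>g \<in> Aut E x. g \<cdot> r = f)"
      using that Ident_in_Aut[OF x] Id_left[of f] by (intro exI[of _ f]) auto
    from someI_ex[OF this] show "rep f \<in> ?S" "\<exists>g \<in> Aut E x. g \<cdot> rep f = f" by (auto simp: rep_def)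
  qed
  \<comment> \<open>The predicates behind the two choices coincide, so the chosen representatives
    are equal and not merely in one orbit.\<close>
  have rep_eq: "rep (h \<cdot> f) = rep f" if h: "h \<in> Aut E x" and f: "f \<in> ?S" for h f
  proof -
    have "(\<exists>g \<in> Aut E x. g \<cdot> r = h \<cdot> f) \<longleftrightarrow> (\<exists>g \<in> Aut E x. g \<cdot> r = f)" if r: "r \<in> ?S" for r
    proof
      assume "\<exists>g \<in> Aut E x. g \<cdot> r = h \<cdot> f"
      then obtain g where g: "g \<in> Aut E x" "g \<cdot> r = h \<cdot> f" by blast
      have "(inv_mor h \<cdot> g) \<cdot> r = f"
        using g h r f inv_mor_Comp_cancel(1)[OF h, of f] inv_mor_Aut[OF h] Comp_assoc[of "inv_mor h" g r] by (auto simp: Aut_iff)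
      then show "\<exists>g \<in> Aut E x. g \<cdot> r = f" using Aut_Comp_closed[OF inv_mor_Aut[OF h] g(1)] by blast
    next
      assume "\<exists>g \<in> Aut E x. g \<cdot> r = f"
      then obtain g where g: "g \<in> Aut E x" "g \<cdot> r = f" by blast
      have "(h \<cdot> g) \<cdot> r = h \<cdot> f" using g h r Comp_assoc[of h g r] by (auto simp: Aut_iff)
      then show "\<exists>g \<in> Aut E x. g \<cdot> r = h \<cdot> f" using Aut_Comp_closed[OF h g(1)] by blast
    qed
    then have "(\<lambda>r. r \<in> ?S \<and> (\<exists>g \<in> Aut E x. g \<cdot> r = h \<cdot> f)) = (\<lambda>r. r \<in> ?S \<and> (\<exists>g \<in> Aut E x. g \<cdot> r = f))"
      by (intro ext conj_cong refl)
    then show ?thesis unfolding rep_def by simp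
  qed
  \<comment> \<open>\<open>S f\<close> is a coset of the stabilizer of \<open>rep f\<close>; left
    regularity, applied to the morphism \<open>rep f\<close>, makes its size invertible.\<close>
  have card: "(of_nat (card (S f)) :: 'k) \<noteq> 0" if f: "f \<in> ?S" for f
  proof -
    obtain h where h: "h \<in> Aut E x" "h \<cdot> rep f = f" using rep(2)[OF f] by blast
    have "card {g \<in> Aut E x. g \<cdot> rep f = h \<cdot> rep f} = card {g \<in> Aut E x. g \<cdot> rep f = rep f}"
      by (rule card_fibre_Aut) (use rep(1)[OF f] h Aut_Comp_closed inv_mor_Aut in auto)
    moreover have "(of_nat (card {g \<in> Aut E x. g \<cdot> rep f = rep f}) :: 'k) \<noteq> 0"
      using reg rep(1)[OF f] by (auto simp: left_regular_def)
    ultimately show ?thesis using h by (simp add: S_def)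
  qed
  have S_Aut: "g \<in> Aut E x" "g \<in> Mor E" if "g \<in> S f" for g f using that by (auto simp: S_def Aut_iff)
  have wF: "w i f \<in> free_space" if "f \<in> ?S" for i f
    unfolding w_def using rep(1)[OF that] S_Aut(2) by (intro free_space_scl free_space_sum free_space_act w0) auto
  have wE: "w i (h \<cdot> f) = act h (w i f)" if f: "f \<in> ?S" and h: "h \<in> Aut E x" for i f h
  proof -
    have r: "rep f \<in> Mor E" "Cod E (rep f) = x" using rep(1)[OF f] by auto
    \<comment> \<open>Equivariance of the average: translation by \<open>h\<close> carries the coset
      of \<open>f\<close> to the coset of \<open>h \<cdot> f\<close>.\<close>
    have bij: "bij_betw (\<lambda>g. h \<cdot> g) (S f) (S (h \<cdot> f))"
    proof (rule bij_betw_byWitness[where f' = "\<lambda>g. inv_mor h \<cdot> g"])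
      show "\<forall>g \<in> S f. inv_mor h \<cdot> (h \<cdot> g) = g" "\<forall>g \<in> S (h \<cdot> f). h \<cdot> (inv_mor h \<cdot> g) = g"
        using inv_mor_Comp_cancel[OF h] by (auto simp: S_def Aut_iff)
      show "(\<lambda>g. h \<cdot> g) ` S f \<subseteq> S (h \<cdot> f)"
      proof (rule image_subsetI)
        fix g assume "g \<in> S f"
        then have g: "g \<in> Aut E x" "g \<cdot> rep f = f" by (auto simp: S_def)
        have "(h \<cdot> g) \<cdot> rep f = h \<cdot> f" using Comp_assoc[of h g "rep f"] g r h by (simp add: Aut_iff)
        then show "h \<cdot> g \<in> S (h \<cdot> f)" using Aut_Comp_closed[OF h g(1)] rep_eq[OF h f] by (simp add: S_def)
      qed
      show "(\<lambda>g. inv_mor h \<cdot> g) ` S (h \<cdot> f) \<subseteq> S f"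
      proof (rule image_subsetI)
        fix g assume "g \<in> S (h \<cdot> f)"
        then have g: "g \<in> Aut E x" "g \<cdot> rep f = h \<cdot> f" using rep_eq[OF h f] by (auto simp: S_def)
        have "(inv_mor h \<cdot> g) \<cdot> rep f = inv_mor h \<cdot> (h \<cdot> f)"
          using Comp_assoc[of "inv_mor h" g "rep f"] g r inv_mor_Aut[OF h] by (simp add: Aut_iff)
        then show "inv_mor h \<cdot> g \<in> S f"
          using Aut_Comp_closed[OF inv_mor_Aut[OF h] g(1)] inv_mor_Comp_cancel(1)[OF h, of f] f by (simp add: S_def)
      qed
    qed
    have "act h (w i f) = scl (1 / of_nat (card (S f))) (\<Sum>g \<in> S f. act h (act g (w0 i (rep f))))"
      by (simp add: w_def act_scl act_sum)
    also have "(\<Sum>g \<in> S f. act h (act g (w0 i (rep f)))) = (\<Sum>g \<in> S f. act (h \<cdot> g) (w0 i (rep f)))"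
      using h by (intro sum.cong refl act_Comp) (auto simp: S_def Aut_iff)
    also have "\<dots> = (\<Sum>g \<in> S (h \<cdot> f). act g (w0 i (rep f)))"
      by (rule sum.reindex_bij_betw[OF bij])
    finally show ?thesis using bij_betw_same_card[OF bij] rep_eq[OF h f] by (simp add: w_def)
  qed
  have eq: "equivariant_weight x w" using wF wE by (auto simp: equivariant_weight_def)
  have Dw: "D (w i f) = K (delta i f)" if f: "f \<in> ?S" for i f
  proof -
    have r: "rep f \<in> Mor E" "Cod E (rep f) = x" using rep(1)[OF f] by auto
    have aF: "act g (w0 i (rep f)) \<in> free_space" if "g \<in> S f" for g
      using that by (intro free_space_act S_Aut(2) w0 r)
    have "D (w i f) = scl (1 / of_nat (card (S f))) (D (\<Sum>g \<in> S f. act g (w0 i (rep f))))"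
      unfolding w_def by (intro lin_scl[OF D(1)] free_space_sum aF)
    also have "D (\<Sum>g \<in> S f. act g (w0 i (rep f))) = (\<Sum>g \<in> S f. D (act g (w0 i (rep f))))"
      by (intro lin_sum[OF D(1)] aF)
    also have "(\<Sum>g \<in> S f. D (act g (w0 i (rep f)))) = (\<Sum>g \<in> S f. K (delta i f))"
    proof (intro sum.cong refl)
      fix g assume g: "g \<in> S f"
      then have gA: "g \<in> Aut E x" "g \<cdot> rep f = f" by (auto simp: S_def)
      have "D (act g (w0 i (rep f))) = act g (K (delta i (rep f)))" using D(2)[OF gA(1)] w0 r by simp
      also have "\<dots> = K (delta i f)"
      proof -
        have "act g (delta i (rep f) :: 'p \<Rightarrow> 'b \<Rightarrow> 'k) = delta i f"
          using act_delta[OF r(1), of g i] gA r by (simp add: Aut_iff)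
        then show ?thesis using K(2)[OF gA(1) free_space_delta[OF r(1), of i]] by simp
      qed
      finally show "D (act g (w0 i (rep f))) = K (delta i f)" .
    qed
    also have "\<dots> = scl (of_nat (card (S f))) (K (delta i f))"
      unfolding scl_def by (auto simp: fun_eq_iff sum_fun_apply)
    finally show ?thesis using card[OF f] by simp
  qed
  have "D (wsum w x u) = K (act (Ident E x) u)" if u: "u \<in> free_space" for u
  proof -
    have "D (wsum w x u) = wsum (\<lambda>i f. D (w i f)) x u"
      by (rule lin_wsum_eq[OF D(1)]) (use wF in auto)
    also have "\<dots> = wsum (\<lambda>i f. K (delta i f)) x u" by (rule wsum_cong) (use Dw in auto)
    also have "\<dots> = K (wsum delta x u)" by (rule lin_wsum_eq[OF K(1), symmetric]) (rule free_space_delta)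
    finally show ?thesis using act_Ident_wsum[OF u x] by simp
  qed
  with eq show ?thesis by blast
qed

end

section \<open>Boundaries in the radical\<close>

text \<open>The values of \<open>p\<close> on a basis of \<open>W\<close> are extended to a linear
  functional on the whole space, which must agree with \<open>p\<close> on the span of that
  basis.\<close>

lemma (in vector_space) functional_extension:
  fixes p :: "'b \<Rightarrow> 'a"
  assumes W: "subspace W"
    and add: "\<And>u v. u \<in> W \<Longrightarrow> v \<in> W \<Longrightarrow> p (u + v) = p u + p v"
    and scale: "\<And>c u. u \<in> W \<Longrightarrow> p (scale c u) = c * p u"
  obtains q where "\<And>u v. q (u + v) = q u + q v" "\<And>c u. q (scale c u) = c * q u" "\<And>u. u \<in> W \<Longrightarrow> q u = p u"
proof -
  interpret pair: vector_space_pair scale "(*)"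
    by unfold_locales (simp_all add: ring_distribs mult.assoc)
  obtain B where B: "B \<subseteq> W" "independent B" "W \<subseteq> span B" by (rule basis_exists[of W])
  obtain q where q: "Vector_Spaces.linear scale (*) q" "\<forall>x \<in> B. q x = p x"
    using pair.linear_independent_extend[OF B(2), of p] by blast
  interpret q: Vector_Spaces.linear scale "(*)" q by fact
  \<comment> \<open>Membership in \<open>W\<close> is carried along because \<open>p\<close> is
    linear only there.\<close>
  have "u \<in> W \<and> q u = p u" if "u \<in> span B" for u
    using that
  proof (induction rule: span_induct_alt)
    case base
    have "p (scale 0 0) = 0 * p 0" by (rule scale) (rule subspace_0[OF W])
    then show ?case using subspace_0[OF W] by (simp add: q.zero)
  next
    case (step c x y)
    have x: "x \<in> W" "scale c x \<in> W" using step(1) B(1) subspace_scale[OF W] by auto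
    have "p (scale c x + y) = c * p x + p y"
      using add[OF x(2)] scale[OF x(1)] step(2) by simp
    then show ?case using step q(2) subspace_add[OF W x(2)] by (simp add: q.add q.scale)
  qed
  then have "q u = p u" if "u \<in> W" for u using B(3) that by blast
  then show ?thesis by (rule that[OF q.add q.scale])
qed

context skeletal_free_EI_category
begin

text \<open>J times the free module.\<close>

definition radical_space :: "('p \<Rightarrow> 'b \<Rightarrow> 'k::field) set" where
  "radical_space = {u \<in> free_space. \<forall>i m. iso_mor E m \<longrightarrow> u i m = 0}"

lemma radical_space_act:
  assumes "g \<in> Mor E" "\<not> iso_mor E g" "u \<in> free_space"
  shows "act g u \<in> radical_space"
proof -
  have "act g u i m = 0" if "iso_mor E m" for i m
    unfolding act_def using that assms Comp_non_iso[of g]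
    by (intro sum.neutral) (auto simp: iso_mor_iff)
  then show ?thesis using free_space_act assms by (auto simp: radical_space_def)
qed

lemma radical_space_sum: "(\<And>a. a \<in> A \<Longrightarrow> f a \<in> radical_space) \<Longrightarrow> (\<Sum>a\<in>A. f a) \<in> radical_space"
  by (auto simp: radical_space_def free_space_sum sum_fun_apply)

text \<open>The direct sum decomposition of JP, stated on the basis: the second clause is
  generation, the third independence. The set collects one element from each class of unfactorizable
  morphisms modulo right multiplication by automorphisms.\<close>

lemma unfactorizable_representatives:
  obtains U where "\<And>a. a \<in> U \<Longrightarrow> unfactorizable E a"
    "\<And>m. m \<in> Mor E \<Longrightarrow> \<not> iso_mor E m \<Longrightarrow> \<exists>a \<in> U. \<exists>f \<in> Mor E. Cod E f = Dom E a \<and> a \<cdot> f = m"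
    "\<And>a b f f'. a \<in> U \<Longrightarrow> b \<in> U \<Longrightarrow> f \<in> Mor E \<Longrightarrow> f' \<in> Mor E \<Longrightarrow> Cod E f = Dom E a \<Longrightarrow>
       Cod E f' = Dom E b \<Longrightarrow> a \<cdot> f = b \<cdot> f' \<Longrightarrow> a = b"
proof -
  define R where "R a b \<longleftrightarrow> (\<exists>g \<in> Aut E (Dom E b). Dom E a = Dom E b \<and> a = b \<cdot> g)" for a b
  have R_refl: "R a a" if "unfactorizable E a" for a
    using that Id_right[of a] Ident_in_Aut[of "Dom E a"] Dom_closed[of a] unfolding R_def unfactorizable_def by metis
  have R_sym: "R b a" if "unfactorizable E b" "R a b" for a b
    using that Comp_inv_mor_cancel(1)[of _ "Dom E b" b] inv_mor_Aut[of _ "Dom E b"]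
    unfolding R_def unfactorizable_def by metis
  have R_trans: "R a c" if "unfactorizable E c" "R a b" "R b c" for a b c
  proof -
    from that obtain g h where g: "g \<in> Aut E (Dom E b)" "Dom E a = Dom E b" "a = b \<cdot> g"
      and h: "h \<in> Aut E (Dom E c)" "Dom E b = Dom E c" "b = c \<cdot> h" by (auto simp: R_def)
    have "a = c \<cdot> (h \<cdot> g)" using g h that(1) Comp_assoc[of c h g] by (auto simp: Aut_iff unfactorizable_def)
    then show ?thesis using g h Aut_Comp_closed[of h "Dom E c" g] by (auto simp: R_def)
  qed
  define r where "r b = (SOME a. unfactorizable E a \<and> R a b)" for b
  have r: "unfactorizable E (r b)" "R (r b) b" if "unfactorizable E b" for b
    using someI_ex[of "\<lambda>a. unfactorizable E a \<and> R a b"] R_refl[OF that] that by (auto simp: r_def)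
  have r_eq: "r a = r b" if "unfactorizable E a" "unfactorizable E b" "R a b" for a b
  proof -
    have "(\<lambda>c. unfactorizable E c \<and> R c a) = (\<lambda>c. unfactorizable E c \<and> R c b)"
      using that R_trans R_sym by (intro ext) blast
    then show ?thesis by (simp add: r_def)
  qed
  show thesis
  proof (rule that[of "r ` {a. unfactorizable E a}"])
    fix m assume "m \<in> Mor E" "\<not> iso_mor E m"
    then obtain a f where a: "unfactorizable E a" "f \<in> Mor E" "Dom E a = Cod E f" "m = a \<cdot> f"
      using non_iso_factor[of m] by (auto simp: iso_mor_iff)
    from R_sym[OF a(1) r(2)[OF a(1)]] obtain g where
      g: "g \<in> Aut E (Dom E (r a))" "Dom E a = Dom E (r a)" "a = r a \<cdot> g" by (auto simp: R_def)
    have ra: "r a \<in> Mor E" using r(1)[OF a(1)] by (simp add: unfactorizable_def)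
    have "(r a \<cdot> g) \<cdot> f = r a \<cdot> (g \<cdot> f)"
      by (rule Comp_assoc) (use g ra a(2,3) in \<open>auto simp: Aut_iff\<close>)
    then have "r a \<cdot> (g \<cdot> f) = m" using a(4) g(3) by simp
    moreover have "g \<cdot> f \<in> Mor E" "Cod E (g \<cdot> f) = Dom E (r a)"
      using g(1,2) a(2,3) by (auto simp: Aut_iff Comp_closed Cod_Comp)
    ultimately show "\<exists>a \<in> r ` {a. unfactorizable E a}. \<exists>f \<in> Mor E. Cod E f = Dom E a \<and> a \<cdot> f = m"
      using a(1) by blast
  next
    fix a b f f' assume h: "a \<in> r ` {a. unfactorizable E a}" "b \<in> r ` {a. unfactorizable E a}"
      "f \<in> Mor E" "f' \<in> Mor E" "Cod E f = Dom E a" "Cod E f' = Dom E b" "a \<cdot> f = b \<cdot> f'"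
    then have ab: "unfactorizable E a" "unfactorizable E b" "r a = a" "r b = b"
      using r r_eq by auto
    have "R a b" using unfactorizable_Comp_eq[OF ab(1) h(3) _ ab(2) h(4) _ h(7)] h by (auto simp: R_def)
    then show "a = b" using r_eq[OF ab(1,2)] ab by simp
  qed (use r in auto)
qed

end

text \<open>A resolution by direct summands of free modules: \<open>e n\<close> is the idempotent whose image is the \<open>n\<close>-th
  term, \<open>D n\<close> is the differential precomposed with \<open>e (Suc n)\<close>, and \<open>rho\<close> is the augmentation followed
  by a section that is linear over the automorphism groups only.\<close>

locale free_complex = skeletal_free_EI_category E
  for E :: "('o, 'm) category" (structure) +
  fixes e D :: "nat \<Rightarrow> ('p \<Rightarrow> 'm \<Rightarrow> 'k::field) \<Rightarrow> 'p \<Rightarrow> 'm \<Rightarrow> 'k"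
    and rho :: "('p \<Rightarrow> 'm \<Rightarrow> 'k) \<Rightarrow> 'p \<Rightarrow> 'm \<Rightarrow> 'k"
  assumes lin_e: "lin (e n)"
    and e_act: "g \<in> Mor E \<Longrightarrow> u \<in> free_space \<Longrightarrow> e n (act g u) = act g (e n u)"
    and lin_D: "lin (D n)"
    and D_act: "g \<in> Mor E \<Longrightarrow> u \<in> free_space \<Longrightarrow> D n (act g u) = act g (D n u)"
    and e_D: "u \<in> free_space \<Longrightarrow> e n (D n u) = D n u"
    and D_D: "u \<in> free_space \<Longrightarrow> D n (D (Suc n) u) = 0"
    and exact: "u \<in> free_space \<Longrightarrow> D n u = 0 \<Longrightarrow> \<exists>w \<in> free_space. e (Suc n) u = D (Suc n) w"
    and lin_rho: "lin rho"
    and rho_act: "g \<in> Aut E x \<Longrightarrow> u \<in> free_space \<Longrightarrow> rho (act g u) = act g (rho u)"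
    and rho_D: "u \<in> free_space \<Longrightarrow> rho (D 0 u) = 0"
    and aug_exact: "u \<in> free_space \<Longrightarrow> \<exists>w \<in> free_space. e 0 (u - rho u) = D 0 w"
    and regular: "x \<in> Obj E \<Longrightarrow> left_regular TYPE('k) E x \<or> right_regular TYPE('k) E x"
begin

lemmas closed = lin_closed[OF lin_e] lin_closed[OF lin_D] lin_closed[OF lin_rho]

text \<open>The usual construction of a contracting homotopy s for the augmented complex, with every
  lift made equivariant by \<open>left_regular_lift\<close>. Of the homotopy identity only its
  consequence d s d = d on the part at \<open>x\<close> is kept, which is all that is used.\<close>

lemma equivariant_contraction:
  assumes reg: "left_regular TYPE('k) E x" and x: "x \<in> Obj E"
  shows "\<exists>w. equivariant_weight x w \<and>
    (\<forall>u \<in> free_space. D n (wsum w x (D n u)) = act (Ident E x) (D n u))"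
proof (induction n)
  case 0
  note I = Id_closed[OF x]
  \<comment> \<open>Identity minus section after augmentation: its values lie in the kernel of the
    augmentation, that is in the image of \<open>D 0\<close>.\<close>
  define K where "K u = e 0 (u - rho u)" for u
  have "\<exists>w. equivariant_weight x w \<and> (\<forall>u \<in> free_space. D 0 (wsum w x u) = K (act (Ident E x) u))"
  proof (rule left_regular_lift[OF reg x lin_D])
    show "lin K" unfolding K_def by (intro lin_comp[OF lin_e] lin_minus lin_ident lin_rho)
    show "K (act g u) = act g (K u)" if "g \<in> Aut E x" "u \<in> free_space" for g u
      using that by (simp add: K_def rho_act act_diff[symmetric] e_act free_space_diff closed Aut_iff)
    show "\<exists>w \<in> free_space. K u = D 0 w" if "u \<in> free_space" for u
      using aug_exact[OF that] by (simp add: K_def)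
  qed (simp add: D_act Aut_iff)
  then obtain w where w: "equivariant_weight x w" "\<And>u. u \<in> free_space \<Longrightarrow> D 0 (wsum w x u) = K (act (Ident E x) u)"
    by blast
  have "D 0 (wsum w x (D 0 u)) = act (Ident E x) (D 0 u)" if u: "u \<in> free_space" for u
  proof -
    have "D 0 (wsum w x (D 0 u)) = K (act (Ident E x) (D 0 u))" using w(2) closed u by simp
    also have "act (Ident E x) (D 0 u) = D 0 (act (Ident E x) u)" using D_act[OF I u] by simp
    also have "K (D 0 (act (Ident E x) u)) = D 0 (act (Ident E x) u)"
      using free_space_act[OF I u] by (simp add: K_def rho_D e_D)
    finally show ?thesis using D_act[OF I u] by simp
  qed
  with w(1) show ?case by blast
next
  case (Suc n)
  note I = Id_closed[OF x]
  from Suc obtain w where w: "equivariant_weight x w"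
    "\<And>u. u \<in> free_space \<Longrightarrow> D n (wsum w x (D n u)) = act (Ident E x) (D n u)" by blast
  have lw: "lin (wsum w x)" by (rule lin_wsum) (rule equivariant_weightD(1)[OF w(1)])
  \<comment> \<open>Identity minus homotopy after differential: by the induction hypothesis
    \<open>D n\<close> kills the bracket, so exactness applies.\<close>
  define K where "K u = e (Suc n) (act (Ident E x) u - wsum w x (D n u))" for u
  have "\<exists>w. equivariant_weight x w \<and> (\<forall>u \<in> free_space. D (Suc n) (wsum w x u) = K (act (Ident E x) u))"
  proof (rule left_regular_lift[OF reg x lin_D])
    show "lin K" unfolding K_def by (intro lin_comp[OF lin_e] lin_minus lin_act I lin_comp[OF lw] lin_D)
    show "K (act g u) = act g (K u)" if g: "g \<in> Aut E x" and u: "u \<in> free_space" for g u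
    proof -
      have gM: "g \<in> Mor E" "Dom E g = x" "Cod E g = x" using g by (auto simp: Aut_iff)
      have "act (Ident E x) (act g u) = act g u" "act g (act (Ident E x) u) = act g u"
        using act_Comp[OF I gM(1)] act_Comp_Ident[OF gM(1)] gM x Id_left[OF gM(1)] by (auto simp: Dom_Id)
      moreover have "wsum w x (D n (act g u)) = act g (wsum w x (D n u))"
        using act_wsum[OF w(1) g, of "D n u"] D_act[OF gM(1) u] closed u by simp
      ultimately have "K (act g u) = e (Suc n) (act g (act (Ident E x) u - wsum w x (D n u)))"
        by (simp add: K_def act_diff)
      also have "\<dots> = act g (K u)"
        unfolding K_def using u by (intro e_act gM free_space_diff free_space_act I lin_closed[OF lw] closed)
      finally show ?thesis .
    qed
    show "\<exists>w \<in> free_space. K u = D (Suc n) w" if u: "u \<in> free_space" for u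
      unfolding K_def
    proof (rule exact)
      show "act (Ident E x) u - wsum w x (D n u) \<in> free_space"
        using u by (intro free_space_diff free_space_act I lin_closed[OF lw] closed)
      show "D n (act (Ident E x) u - wsum w x (D n u)) = 0"
        using u w(2) by (simp add: lin_diff[OF lin_D] free_space_act I lin_closed[OF lw] closed D_act)
    qed
  qed (simp add: D_act Aut_iff)
  then obtain w' where w': "equivariant_weight x w'" "\<And>u. u \<in> free_space \<Longrightarrow> D (Suc n) (wsum w' x u) = K (act (Ident E x) u)"
    by blast
  have "D (Suc n) (wsum w' x (D (Suc n) u)) = act (Ident E x) (D (Suc n) u)" if u: "u \<in> free_space" for u
  proof -
    let ?v = "act (Ident E x) u"
    have v: "?v \<in> free_space" using free_space_act[OF I u] .
    have idem: "act (Ident E x) ?v = ?v" using act_Comp_Ident[OF I] x by (simp add: Dom_Id)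
    have "D (Suc n) (wsum w' x (D (Suc n) u)) = K (act (Ident E x) (D (Suc n) u))" using w'(2) closed u by simp
    also have "act (Ident E x) (D (Suc n) u) = D (Suc n) ?v" using D_act[OF I u] by simp
    also have "K (D (Suc n) ?v) = e (Suc n) (act (Ident E x) (D (Suc n) ?v) - wsum w x 0)"
      unfolding K_def using D_D[OF v] by simp
    also have "\<dots> = e (Suc n) (D (Suc n) ?v)"
      using D_act[OF I v] idem lin_zero[OF lw] by simp
    also have "\<dots> = D (Suc n) ?v" by (rule e_D[OF v])
    finally show ?thesis using D_act[OF I u] by simp
  qed
  with w'(1) show ?case by blast
qed

text \<open>Exactness of the complex after multiplication by \<open>a\<close>, and the only place
  where the two kinds of regularity are separated. In both cases \<open>v\<close> is replaced by a
  genuine cycle with the same product with \<open>a\<close>.\<close>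

lemma act_kernel_lift:
  assumes a: "unfactorizable E a" and v: "v \<in> free_space" and zero: "act a (D n v) = 0"
  shows "\<exists>w \<in> free_space. act a (e (Suc n) v) = act a (D (Suc n) w)"
proof -
  define x where "x = Dom E a"
  have aM: "a \<in> Mor E" using a by (simp add: unfactorizable_def)
  then have x: "x \<in> Obj E" unfolding x_def by (rule Dom_closed)
  note I = Id_closed[OF x]
  consider "left_regular TYPE('k) E x" | "right_regular TYPE('k) E x" using regular[OF x] by blast
  then have "\<exists>v' \<in> free_space. D n v' = 0 \<and> act a v' = act a v"
  proof cases
    case 1
    obtain w where w: "equivariant_weight x w"
      "\<And>u. u \<in> free_space \<Longrightarrow> D n (wsum w x (D n u)) = act (Ident E x) (D n u)"
      using equivariant_contraction[OF 1 x, of n] by blast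
    have lw: "lin (wsum w x)" by (rule lin_wsum) (rule equivariant_weightD(1)[OF w(1)])
    have wF: "wsum w x (D n v) \<in> free_space" using v closed lin_closed[OF lw] by simp
    \<comment> \<open>The correction by the homotopy is invisible to \<open>a\<close>:
      \<open>D n v\<close> vanishes in the coinvariants, and the homotopy is equivariant.\<close>
    have "act a (wsum w x (D n v)) = 0" by (rule act_wsum_eq_zero[OF w(1) a x_def[symmetric] zero])
    then have "act a (act (Ident E x) v - wsum w x (D n v)) = act a v"
      using act_Comp_Ident[OF aM] by (simp add: act_diff x_def)
    moreover have "D n (act (Ident E x) v - wsum w x (D n v)) = 0"
      using v w(2) wF by (simp add: lin_diff[OF lin_D] free_space_act I D_act)
    ultimately show ?thesis using wF v free_space_act[OF I] free_space_diff by blast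
  next
    case 2
    let ?H = "{h \<in> Aut E x. a \<cdot> h = a}"
    define c :: 'k where "c = of_nat (card ?H)"
    \<comment> \<open>Right regularity is applied to the morphism \<open>a\<close> itself.\<close>
    have c: "c \<noteq> 0" using 2 aM by (simp add: c_def right_regular_def x_def)
    \<comment> \<open>The norm of \<open>v\<close>. Its differential is the norm of
      \<open>D n v\<close>, which vanishes, while \<open>a\<close> sends it to \<open>c\<close>
      times the product with \<open>v\<close>.\<close>
    define s where "s = (\<Sum>h \<in> ?H. act (inv_mor h) v)"
    have iM: "inv_mor h \<in> Mor E" "Cod E (inv_mor h) = x" if "h \<in> ?H" for h
      using that inv_mor_Aut[of h x] by (auto simp: Aut_iff)
    have s: "s \<in> free_space" unfolding s_def using v iM by (intro free_space_sum free_space_act) auto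
    have "D n s = (\<Sum>h \<in> ?H. act (inv_mor h) (D n v))"
      unfolding s_def using v iM by (subst lin_sum[OF lin_D]) (auto simp: free_space_act D_act intro!: sum.cong)
    then have "D n s = 0" using stabilizer_norm_eq_zero[OF a x_def[symmetric] zero] by simp
    then have Dz: "D n (scl (1 / c) s) = 0" using lin_scl[OF lin_D s] by simp
    have "act a s = (\<Sum>h \<in> ?H. act a v)"
      unfolding s_def act_sum
    proof (intro sum.cong refl)
      fix h assume h: "h \<in> ?H"
      have "act a (act (inv_mor h) v) = act (a \<cdot> inv_mor h) v"
        using act_Comp[OF aM iM(1)[OF h]] iM(2)[OF h] by (simp add: x_def)
      also have "a \<cdot> inv_mor h = (a \<cdot> h) \<cdot> inv_mor h" using h by simp
      also have "(a \<cdot> h) \<cdot> inv_mor h = a" by (rule Comp_inv_mor_cancel(1)) (use h aM x_def in auto)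
      finally show "act a (act (inv_mor h) v) = act a v" .
    qed
    also have "\<dots> = scl c (act a v)" by (auto simp: c_def scl_def fun_eq_iff sum_fun_apply)
    finally have "act a (scl (1 / c) s) = act a v" using c by (simp add: act_scl)
    with Dz s free_space_scl show ?thesis by blast
  qed
  then obtain v' where v': "v' \<in> free_space" "D n v' = 0" "act a v' = act a v" by blast
  obtain w where "w \<in> free_space" "e (Suc n) v' = D (Suc n) w" using exact[OF v'(1,2)] by blast
  then show ?thesis using e_act[OF aM v'(1)] e_act[OF aM v] v'(3) by metis
qed

text \<open>Vanishing of Tor. The boundary lies in degree \<open>Suc n\<close>, so
  \<open>D n\<close> exists and kills it; independence of the summands splits this into one
  condition for each \<open>a\<close>, to which \<open>act_kernel_lift\<close> applies.\<close>

lemma boundary_in_radical: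
  assumes u: "u \<in> free_space" and rad: "D (Suc n) u \<in> radical_space"
  shows "\<exists>w \<in> radical_space. D (Suc n) u = D (Suc n) w"
proof -
  define v where "v = D (Suc n) u"
  have v: "v \<in> free_space" "\<And>i m. iso_mor E m \<Longrightarrow> v i m = 0" "e (Suc n) v = v" "D n v = 0"
    using rad u e_D D_D by (auto simp: v_def radical_space_def)
  obtain U where U: "\<And>a. a \<in> U \<Longrightarrow> unfactorizable E a"
    "\<And>m. m \<in> Mor E \<Longrightarrow> \<not> iso_mor E m \<Longrightarrow> \<exists>a \<in> U. \<exists>f \<in> Mor E. Cod E f = Dom E a \<and> a \<cdot> f = m"
    "\<And>a b f f'. a \<in> U \<Longrightarrow> b \<in> U \<Longrightarrow> f \<in> Mor E \<Longrightarrow> f' \<in> Mor E \<Longrightarrow> Cod E f = Dom E a \<Longrightarrow>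
       Cod E f' = Dom E b \<Longrightarrow> a \<cdot> f = b \<cdot> f' \<Longrightarrow> a = b"
    by (rule unfactorizable_representatives) blast
  have UM: "a \<in> Mor E" "\<not> iso_mor E a" if "a \<in> U" for a using U(1)[OF that] by (auto simp: unfactorizable_iff iso_mor_iff)
  have finU: "finite U" by (rule finite_subset[OF _ finite_Mor]) (use UM in auto)
  \<comment> \<open>Each non-isomorphism is above exactly one representative, so
    \<open>above\<close> partitions the basis of J.\<close>
  define above where "above a m \<longleftrightarrow> (\<exists>f \<in> Mor E. Cod E f = Dom E a \<and> a \<cdot> f = m)" for a m
  have above_unique: "a = b" if "a \<in> U" "b \<in> U" "above a m" "above b m" for a b m
    using that U(3)[of a b] by (auto simp: above_def)
  have act_above: "act a y i m = 0" if "\<not> above a m" for a m i and y :: "'p \<Rightarrow> 'm \<Rightarrow> 'k"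
    using that unfolding act_def above_def by (intro sum.neutral) auto
  have act_split: "act a (y a) = 0" if sum0: "(\<Sum>b \<in> U. act b (y b)) = 0" and a: "a \<in> U"
    for a and y :: "'m \<Rightarrow> 'p \<Rightarrow> 'm \<Rightarrow> 'k"
  proof (intro ext)
    fix i m
    show "act a (y a) i m = 0 i m"
    proof (cases "above a m")
      case True
      have "(\<Sum>b \<in> U. act b (y b) i m) = (\<Sum>b \<in> U. if b = a then act a (y a) i m else 0)"
        by (intro sum.cong refl) (use above_unique[OF a _ True] act_above in \<open>metis (full_types)\<close>)
      also have "\<dots> = act a (y a) i m" using finU a by (simp add: sum.delta)
      finally show ?thesis using fun_cong[OF fun_cong[OF sum0, of i], of m] by (simp add: sum_fun_apply)
    qed (simp add: act_above)
  qed
  define ch where "ch a m = (SOME f. f \<in> Mor E \<and> Cod E f = Dom E a \<and> a \<cdot> f = m)" for a m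
  have ch: "ch a m \<in> Mor E" "Cod E (ch a m) = Dom E a" "a \<cdot> ch a m = m" if "above a m" for a m
    using someI_ex[of "\<lambda>f. f \<in> Mor E \<and> Cod E f = Dom E a \<and> a \<cdot> f = m"] that by (auto simp: ch_def above_def)
  \<comment> \<open>A preimage of the component of \<open>v\<close> at \<open>a\<close>: each
    coefficient is placed at one chosen point of its fibre and 0 at the others, so that fibre sums
    return \<open>v\<close>.\<close>
  define va where "va a = (\<lambda>i f. if f \<in> Mor E \<and> f = ch a (a \<cdot> f) then v i (a \<cdot> f) else 0)" for a
  have vaF: "va a \<in> free_space" for a
  proof -
    have "{i. va a i \<noteq> 0} \<subseteq> {i. v i \<noteq> 0}" by (auto simp: va_def fun_eq_iff)
    then show ?thesis using v(1) by (auto simp: free_space_def va_def dest: finite_subset)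
  qed
  have act_va: "act a (va a) i m = (if above a m then v i m else 0)" for a i m
  proof (cases "above a m")
    case True
    have "act a (va a) i m = (\<Sum>f \<in> {f \<in> Mor E. Cod E f = Dom E a \<and> a \<cdot> f = m}. if f = ch a m then v i m else 0)"
      unfolding act_def va_def by (intro sum.cong refl) auto
    also have "\<dots> = v i m" using ch[OF True] finite_Mor by (subst sum.delta) auto
    finally show ?thesis using True by simp
  qed (simp add: act_above)
  have dec: "(\<Sum>a \<in> U. act a (va a)) = v"
  proof (intro ext)
    fix i m
    show "(\<Sum>a \<in> U. act a (va a)) i m = v i m"
    proof (cases "m \<in> Mor E \<and> \<not> iso_mor E m")
      case True
      then obtain a where a: "a \<in> U" "above a m" using U(2)[of m] by (auto simp: above_def)
      have "(\<Sum>b \<in> U. act b (va b) i m) = (\<Sum>b \<in> U. if b = a then v i m else 0)"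
        unfolding act_va by (intro sum.cong refl) (use above_unique[OF a(1) _ a(2)] a in \<open>metis (full_types)\<close>)
      then show ?thesis using finU a by (simp add: sum_fun_apply sum.delta)
    next
      case False
      then have "v i m = 0" using v by (auto simp: free_space_def)
      then show ?thesis by (auto simp: sum_fun_apply act_va intro!: sum.neutral)
    qed
  qed
  have "(\<Sum>a \<in> U. act a (D n (va a))) = D n (\<Sum>a \<in> U. act a (va a))"
    using UM vaF by (subst lin_sum[OF lin_D]) (auto simp: free_space_act D_act intro!: sum.cong)
  then have "(\<Sum>a \<in> U. act a (D n (va a))) = 0" using dec v(4) by simp
  then have "\<exists>w \<in> free_space. act a (e (Suc n) (va a)) = act a (D (Suc n) w)" if "a \<in> U" for a
    using act_kernel_lift[OF U(1)[OF that] vaF] act_split[OF _ that, of "\<lambda>a. D n (va a)"] by blast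
  then obtain w where w: "\<And>a. a \<in> U \<Longrightarrow> w a \<in> free_space"
    "\<And>a. a \<in> U \<Longrightarrow> act a (e (Suc n) (va a)) = act a (D (Suc n) (w a))" by metis
  \<comment> \<open>Being a boundary, \<open>v\<close> is fixed by the idempotent, while the
    summands \<open>va a\<close> need not lie in its image.\<close>
  have "v = e (Suc n) (\<Sum>a \<in> U. act a (va a))" using v dec by simp
  also have "\<dots> = (\<Sum>a \<in> U. act a (e (Suc n) (va a)))"
    using UM vaF by (subst lin_sum[OF lin_e]) (auto simp: free_space_act e_act intro!: sum.cong)
  also have "\<dots> = (\<Sum>a \<in> U. D (Suc n) (act a (w a)))"
    using UM w by (intro sum.cong refl) (simp add: D_act)
  also have "\<dots> = D (Suc n) (\<Sum>a \<in> U. act a (w a))"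
    using UM w by (subst lin_sum[OF lin_D]) (auto simp: free_space_act)
  finally show ?thesis unfolding v_def
    using radical_space_sum[of U "\<lambda>a. act a (w a)"] radical_space_act UM w by blast
qed

text \<open>The dual of \<open>boundary_in_radical\<close>: \<open>l\<close> is transported to the
  sum of the boundaries and the radical, with value 0 on the radical, and then extended over k.
  Linearity over A is restored only later.\<close>

lemma functional_lift:
  fixes l :: "('p \<Rightarrow> 'm \<Rightarrow> 'k) \<Rightarrow> 'k"
  assumes add: "\<And>u v. u \<in> free_space \<Longrightarrow> v \<in> free_space \<Longrightarrow> l (u + v) = l u + l v"
    and scale: "\<And>c u. u \<in> free_space \<Longrightarrow> l (scl c u) = c * l u"
    and rad: "\<And>u. u \<in> radical_space \<Longrightarrow> l u = 0"
    and cocycle: "\<And>u. u \<in> free_space \<Longrightarrow> l (D (Suc (Suc n)) u) = 0"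
    and e: "\<And>u. u \<in> free_space \<Longrightarrow> l (e (Suc (Suc n)) u) = l u"
  obtains q where "\<And>u v. q (u + v) = q u + q v" "\<And>c u. q (scl c u) = c * q u"
    "\<And>u. u \<in> radical_space \<Longrightarrow> q u = 0" "\<And>u. u \<in> free_space \<Longrightarrow> q (D (Suc n) u) = l u"
proof -
  interpret vector_space "scl :: 'k \<Rightarrow> ('p \<Rightarrow> 'm \<Rightarrow> 'k) \<Rightarrow> _"
    by unfold_locales (auto simp: scl_add)
  have l_diff: "l (u - v) = l u - l v" if "u \<in> free_space" "v \<in> free_space" for u v
    using add[of "u - v" v] that by (simp add: free_space_diff)
  have rF: "u \<in> free_space" if "u \<in> radical_space" for u :: "'p \<Rightarrow> 'm \<Rightarrow> 'k" using that by (simp add: radical_space_def)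
  have r_add: "u + v \<in> radical_space" if "u \<in> radical_space" "v \<in> radical_space" for u v :: "'p \<Rightarrow> 'm \<Rightarrow> 'k"
    using that by (auto simp: radical_space_def free_space_add)
  have r_diff: "u - v \<in> radical_space" if "u \<in> radical_space" "v \<in> radical_space" for u v :: "'p \<Rightarrow> 'm \<Rightarrow> 'k"
    using that by (auto simp: radical_space_def free_space_diff)
  have r_scl: "scl c u \<in> radical_space" if "u \<in> radical_space" for c and u :: "'p \<Rightarrow> 'm \<Rightarrow> 'k"
    using that by (auto simp: radical_space_def free_space_scl) (auto simp: scl_def)
  have r_zero: "0 \<in> radical_space" by (simp add: radical_space_def free_space_zero)
  \<comment> \<open>After a radical element is subtracted, \<open>u\<close> becomes a cycle, hence a
    boundary up to the idempotent \<open>e\<close>, and \<open>l\<close> vanishes on both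
    parts.\<close>
  have key: "l u = 0" if u: "u \<in> free_space" and ur: "D (Suc n) u \<in> radical_space" for u
  proof -
    obtain w where w: "w \<in> radical_space" "D (Suc n) u = D (Suc n) w" using boundary_in_radical[OF u ur] by blast
    have "D (Suc n) (u - w) = 0" using w u rF by (simp add: lin_diff[OF lin_D])
    then obtain y where y: "y \<in> free_space" "e (Suc (Suc n)) (u - w) = D (Suc (Suc n)) y"
      using exact[of "u - w" "Suc n"] u rF[OF w(1)] free_space_diff by blast
    have "l (u - w) = 0" using cocycle[OF y(1)] y(2) e[of "u - w"] u rF[OF w(1)] free_space_diff by metis
    then show ?thesis using l_diff[OF u rF[OF w(1)]] rad[OF w(1)] by simp
  qed
  define W where "W = {D (Suc n) u + j |u j. u \<in> free_space \<and> j \<in> radical_space}"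
  \<comment> \<open>Any preimage modulo the radical may be chosen, by \<open>key\<close>.\<close>
  define p where "p v = l (SOME u. u \<in> free_space \<and> v - D (Suc n) u \<in> radical_space)" for v
  have p: "p (D (Suc n) u + j) = l u" if u: "u \<in> free_space" and j: "j \<in> radical_space" for u j
  proof -
    let ?P = "\<lambda>u'. u' \<in> free_space \<and> D (Suc n) u + j - D (Suc n) u' \<in> radical_space"
    let ?u = "SOME u'. ?P u'"
    have "?P ?u" by (rule someI[of ?P u]) (use u j in simp)
    then have h: "?u \<in> free_space" "D (Suc n) u + j - D (Suc n) ?u \<in> radical_space" by auto
    have "D (Suc n) (u - ?u) = (D (Suc n) u + j - D (Suc n) ?u) - j"
      using lin_diff[OF lin_D u h(1)] by simp
    then have "D (Suc n) (u - ?u) \<in> radical_space" using r_diff[OF h(2) j] by simp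
    then have "l (u - ?u) = 0" using key free_space_diff[OF u h(1)] by blast
    then show ?thesis using l_diff[OF u h(1)] by (simp add: p_def)
  qed
  have W_add: "D (Suc n) u + j + (D (Suc n) u' + j') = D (Suc n) (u + u') + (j + j')"
    if "u \<in> free_space" "u' \<in> free_space" for u u' j j' using lin_add[OF lin_D that] by (simp add: algebra_simps)
  have W_scl: "scl c (D (Suc n) u + j) = D (Suc n) (scl c u) + scl c j" if "u \<in> free_space" for u j c
    using lin_scl[OF lin_D that] by (simp add: scl_add)
  have "subspace W"
    unfolding subspace_def
  proof (intro conjI ballI allI)
    have "D (Suc n) 0 + 0 \<in> W" unfolding W_def using free_space_zero r_zero by blast
    then show "0 \<in> W" using lin_zero[OF lin_D] by simp
    show "v + v' \<in> W" if "v \<in> W" "v' \<in> W" for v v'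
    proof -
      obtain u j u' j' where "v = D (Suc n) u + j" "v' = D (Suc n) u' + j'" "u \<in> free_space" "u' \<in> free_space"
        "j \<in> radical_space" "j' \<in> radical_space" using \<open>v \<in> W\<close> \<open>v' \<in> W\<close> by (auto simp: W_def)
      then show ?thesis unfolding W_def using W_add free_space_add r_add by blast
    qed
    show "scl c v \<in> W" if "v \<in> W" for c v
    proof -
      obtain u j where "v = D (Suc n) u + j" "u \<in> free_space" "j \<in> radical_space" using \<open>v \<in> W\<close> by (auto simp: W_def)
      then show ?thesis unfolding W_def using W_scl free_space_scl r_scl by blast
    qed
  qed
  moreover have "p (v + v') = p v + p v'" if vW: "v \<in> W" "v' \<in> W" for v v'
  proof -
    obtain u j u' j' where h: "v = D (Suc n) u + j" "v' = D (Suc n) u' + j'" "u \<in> free_space" "u' \<in> free_space"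
      "j \<in> radical_space" "j' \<in> radical_space" using vW by (auto simp: W_def)
    have "p (v + v') = l (u + u')"
      unfolding h(1,2) W_add[OF h(3,4)] using h by (intro p free_space_add r_add)
    then show ?thesis using h p add by simp
  qed
  moreover have "p (scl c v) = c * p v" if vW: "v \<in> W" for c v
  proof -
    obtain u j where h: "v = D (Suc n) u + j" "u \<in> free_space" "j \<in> radical_space" using vW by (auto simp: W_def)
    have "p (scl c v) = l (scl c u)" unfolding h(1) W_scl[OF h(2)] using h by (intro p free_space_scl r_scl)
    then show ?thesis using h p scale by simp
  qed
  ultimately obtain q where q: "\<And>u v. q (u + v) = q u + q v" "\<And>c u. q (scl c u) = c * q u" "\<And>u. u \<in> W \<Longrightarrow> q u = p u"
    using functional_extension[of W p] by metis
  show thesis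
  proof (rule that[OF q(1,2)])
    fix u :: "'p \<Rightarrow> 'm \<Rightarrow> 'k" assume u: "u \<in> free_space"
    have "D (Suc n) u + 0 \<in> W" unfolding W_def using u r_zero by blast
    then show "q (D (Suc n) u) = l u" using q(3) p[OF u r_zero] by fastforce
  next
    fix u :: "'p \<Rightarrow> 'm \<Rightarrow> 'k" assume u: "u \<in> radical_space"
    have "D (Suc n) 0 + u \<in> W" unfolding W_def using u free_space_zero by blast
    then have "q (D (Suc n) 0 + u) = l 0" using q(3) p[OF free_space_zero u] by simp
    then show "q u = 0" using lin_zero[OF lin_D] rad[OF r_zero] by simp
  qed
qed

end

section \<open>The category algebra and its degree zero part\<close>

definition amul :: "('o, 'm) category \<Rightarrow> ('m \<Rightarrow> 'k::field) \<Rightarrow> ('p \<Rightarrow> 'm \<Rightarrow> 'k) \<Rightarrow> 'p \<Rightarrow> 'm \<Rightarrow> 'k" where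
  "amul E a u = (\<lambda>i. a \<otimes>\<^bsub>category_algebra E\<^esub> u i)"

definition single :: "'m \<Rightarrow> 'm \<Rightarrow> 'k::field" where
  "single g = (\<lambda>m. if m = g then 1 else 0)"

context skeletal_free_EI_category
begin

abbreviation alg :: "('b \<Rightarrow> 'k::field) ring" where
  "alg \<equiv> category_algebra E"

lemma alg_carrier: "a \<in> carrier alg \<longleftrightarrow> (\<forall>m. m \<notin> Mor E \<longrightarrow> a m = 0)"
  and alg_zero: "\<zero>\<^bsub>alg\<^esub> = 0"
  and alg_add: "a \<oplus>\<^bsub>alg\<^esub> b = a + b"
  by (auto simp: category_algebra_def fun_eq_iff)

text \<open>The index \<open>i\<close> is arbitrary; with index type \<open>unit\<close> a single
  algebra element becomes an element of a free module, so that facts about \<open>act\<close> apply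
  to products in A.\<close>

lemma alg_mult_act: "(a \<otimes>\<^bsub>alg\<^esub> u i) m = (\<Sum>g \<in> Mor E. a g * act g u i m)"
proof -
  have "(a \<otimes>\<^bsub>alg\<^esub> u i) m = (\<Sum>(g, f) \<in> {(g, f). g \<in> Mor E \<and> f \<in> Mor E \<and> Dom E g = Cod E f \<and> g \<cdot> f = m}. a g * u i f)"
    by (simp add: category_algebra_def)
  also have "{(g, f). g \<in> Mor E \<and> f \<in> Mor E \<and> Dom E g = Cod E f \<and> g \<cdot> f = m} =
      (SIGMA g : Mor E. {f \<in> Mor E. Cod E f = Dom E g \<and> g \<cdot> f = m})" by auto
  also have "(\<Sum>(g, f) \<in> (SIGMA g : Mor E. {f \<in> Mor E. Cod E f = Dom E g \<and> g \<cdot> f = m}). a g * u i f) =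
      (\<Sum>g \<in> Mor E. \<Sum>f \<in> {f \<in> Mor E. Cod E f = Dom E g \<and> g \<cdot> f = m}. a g * u i f)"
    using finite_Mor by (intro sum.Sigma[symmetric]) auto
  finally show ?thesis by (simp add: act_def sum_distrib_left)
qed

lemma amul_apply: "amul E a u i m = (\<Sum>g \<in> Mor E. a g * act g u i m)"
  by (simp add: amul_def alg_mult_act)

lemma amul_sum: "amul E a u = (\<Sum>g \<in> Mor E. scl (a g) (act g u))"
  by (intro ext) (simp add: amul_apply sum_fun_apply scl_def)

lemma single_carrier: "g \<in> Mor E \<Longrightarrow> single g \<in> carrier alg"
  by (auto simp: alg_carrier single_def)

lemma amul_single: "g \<in> Mor E \<Longrightarrow> amul E (single g) u = act g u"
  using finite_Mor by (intro ext) (auto simp: amul_apply single_def if_distrib[of "\<lambda>x. x * _"] sum.delta cong: if_cong)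

lemma sum_act_Ident:
  assumes "\<And>i m. m \<notin> Mor E \<Longrightarrow> u i m = 0"
  shows "(\<Sum>x \<in> Obj E. act (Ident E x) u) = u"
proof (intro ext)
  fix i m
  have "(\<Sum>x \<in> Obj E. act (Ident E x) u i m) = (\<Sum>x \<in> Obj E. if x = Cod E m then u i m else 0)"
    using assms by (intro sum.cong refl) (auto simp: act_Ident)
  also have "\<dots> = u i m" using finite_Obj assms Cod_closed[of m] by (auto simp: sum.delta)
  finally show "(\<Sum>x \<in> Obj E. act (Ident E x) u) i m = u i m" by (simp add: sum_fun_apply)
qed

text \<open>The function on the left is c times the unit of A. Through it, linearity over A implies
  linearity over k.\<close>

lemma amul_scalar:
  assumes "\<And>i m. m \<notin> Mor E \<Longrightarrow> u i m = 0"
  shows "amul E (\<lambda>m. if m \<in> Ident E ` Obj E then c else 0) u = scl c u"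
proof -
  have inj: "inj_on (Ident E) (Obj E)" by (metis Dom_Id inj_onI)
  have "amul E (\<lambda>m. if m \<in> Ident E ` Obj E then c else 0) u
      = (\<Sum>g \<in> Ident E ` Obj E. scl c (act g u))"
    unfolding amul_sum using finite_Mor Id_closed
    by (intro sum.mono_neutral_cong_right) auto
  also have "\<dots> = scl c (\<Sum>x \<in> Obj E. act (Ident E x) u)"
    by (simp add: sum.reindex[OF inj] scl_sum)
  finally show ?thesis using sum_act_Ident[of u] assms by simp
qed

lemma amul_add_left: "amul E (a + b) u = amul E a u + amul E b u"
  by (intro ext) (simp add: amul_apply sum.distrib algebra_simps)

lemma amul_scale_left: "amul E (\<lambda>m. c * a m) u = scl c (amul E a u)"
  by (intro ext) (simp add: amul_apply scl_def sum_distrib_left mult.assoc)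

lemma amul_zero_left: "amul E 0 u = 0"
  by (intro ext) (simp add: amul_apply)

lemma free_space_amul: "u \<in> free_space \<Longrightarrow> amul E a u \<in> free_space"
  unfolding amul_sum by (intro free_space_sum free_space_scl free_space_act)

lemma free_space_carrier: "u \<in> free_space \<Longrightarrow> u i \<in> carrier alg"
  by (simp add: free_space_def alg_carrier)

definition alin :: "(('p \<Rightarrow> 'b \<Rightarrow> 'k::field) \<Rightarrow> 'q \<Rightarrow> 'b \<Rightarrow> 'k) \<Rightarrow> bool" where
  "alin L \<longleftrightarrow> (\<forall>u \<in> free_space. L u \<in> free_space) \<and>
     (\<forall>u \<in> free_space. \<forall>v \<in> free_space. L (u + v) = L u + L v) \<and>
     (\<forall>a \<in> carrier alg. \<forall>u \<in> free_space. L (amul E a u) = amul E a (L u))"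

lemma scalar_carrier: "(\<lambda>m. if m \<in> Ident E ` Obj E then c else 0) \<in> carrier alg"
  using Id_closed by (auto simp: alg_carrier)

lemma amul_scalar_free: "u \<in> free_space \<Longrightarrow> amul E (\<lambda>m. if m \<in> Ident E ` Obj E then c else 0) u = scl c u"
  by (rule amul_scalar) (simp add: free_space_def)

lemma alin_lin: "alin L \<Longrightarrow> lin L"
  unfolding alin_def lin_def by (metis amul_scalar_free scalar_carrier)

lemma alin_act: "alin L \<Longrightarrow> g \<in> Mor E \<Longrightarrow> u \<in> free_space \<Longrightarrow> L (act g u) = act g (L u)"
  unfolding alin_def by (metis amul_single single_carrier)

text \<open>The element of \<open>A\<^sub>0\<close> represented by \<open>a\<close>, and conversely the representative of an element
  of \<open>A\<^sub>0\<close> that is supported on the isomorphisms.\<close>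

definition iso_class :: "('b \<Rightarrow> 'k::field) \<Rightarrow> ('b \<Rightarrow> 'k) set" where
  "iso_class a = {b \<in> carrier alg. \<forall>m. iso_mor E m \<longrightarrow> b m = a m}"

definition iso_part :: "('b \<Rightarrow> 'k::field) set \<Rightarrow> 'b \<Rightarrow> 'k" where
  "iso_part X = (\<lambda>m. if iso_mor E m then (SOME b. b \<in> X) m else 0)"

lemma iso_part_class:
  assumes "a \<in> carrier alg"
  shows "iso_part (iso_class a) = (\<lambda>m. if iso_mor E m then a m else 0)"
proof -
  have "(SOME b. b \<in> iso_class a) \<in> iso_class a"
    by (rule someI[of _ a]) (use assms in \<open>simp add: iso_class_def\<close>)
  then show ?thesis by (auto simp: iso_part_def iso_class_def)
qed

lemma iso_class_cong: "(\<And>m. iso_mor E m \<Longrightarrow> a m = b m) \<Longrightarrow> iso_class a = iso_class b"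
  by (auto simp: iso_class_def)

lemma rcoset_eq_iso_class:
  assumes "a \<in> carrier alg"
  shows "non_iso_span E +>\<^bsub>regular_module alg\<^esub> a = iso_class a"
proof -
  have "b \<in> (\<Union>h \<in> non_iso_span E. {h + a})" if "b \<in> iso_class a" for b
  proof -
    have "b - a \<in> non_iso_span E" using that assms by (auto simp: non_iso_span_def iso_class_def alg_carrier)
    moreover have "b = (b - a) + a" by simp
    ultimately show ?thesis by blast
  qed
  moreover have "h + a \<in> iso_class a" if "h \<in> non_iso_span E" for h
    using that assms by (auto simp: non_iso_span_def iso_class_def alg_carrier)
  ultimately show ?thesis
    by (auto simp: a_r_coset_def' regular_module_def alg_add)
qed

section \<open>The operations of A_0 in terms of representatives\<close>

lemma A0_carrier: "carrier (degree_zero_module E :: ('b \<Rightarrow> 'k::field, _) module) = iso_class ` carrier alg"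
proof -
  have "carrier (degree_zero_module E :: ('b \<Rightarrow> 'k, _) module) = (\<Union>a \<in> carrier alg. {non_iso_span E +>\<^bsub>regular_module alg\<^esub> a})"
    by (simp add: degree_zero_module_def quotient_module_def A_RCOSETS_def') (simp add: regular_module_def)
  then show ?thesis by (auto simp: rcoset_eq_iso_class)
qed

lemma A0_zero: "\<zero>\<^bsub>degree_zero_module E\<^esub> = iso_class 0"
  by (auto simp: degree_zero_module_def quotient_module_def non_iso_span_def iso_class_def)

lemma A0_add:
  assumes "a \<in> carrier alg" "b \<in> carrier alg"
  shows "iso_class a \<oplus>\<^bsub>degree_zero_module E\<^esub> iso_class b = iso_class (a + b)"
proof -
  have "c \<in> (\<Union>h \<in> iso_class a. \<Union>k \<in> iso_class b. {h + k})" if "c \<in> iso_class (a + b)" for c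
  proof -
    have "c - b \<in> iso_class a" "b \<in> iso_class b" "c = (c - b) + b"
      using that assms by (auto simp: iso_class_def alg_carrier)
    then show ?thesis by blast
  qed
  moreover have "h + k \<in> iso_class (a + b)" if "h \<in> iso_class a" "k \<in> iso_class b" for h k
    using that by (auto simp: iso_class_def alg_carrier)
  ultimately show ?thesis
    by (auto simp: degree_zero_module_def quotient_module_def set_add_def' regular_module_def alg_add)
qed

text \<open>A composite is an isomorphism only if both factors are, so the coefficients of a product
  at isomorphisms see only such coefficients of the factors.\<close>

lemma alg_mult_iso_cong:
  assumes "\<And>m. iso_mor E m \<Longrightarrow> b m = c m" "iso_mor E m"
  shows "(a \<otimes>\<^bsub>alg\<^esub> b) m = (a \<otimes>\<^bsub>alg\<^esub> c) m"
proof -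
  have "act g (\<lambda>_::unit. b) () m = act g (\<lambda>_::unit. c) () m" if "g \<in> Mor E" for g
    unfolding act_def
  proof (intro sum.cong refl)
    fix f assume "f \<in> {f \<in> Mor E. Cod E f = Dom E g \<and> g \<cdot> f = m}"
    then have "iso_mor E f" using that assms(2) Comp_non_iso[of g f] unfolding iso_mor_iff by force
    then show "b f = c f" by (rule assms(1))
  qed
  then show ?thesis using alg_mult_act[of a "\<lambda>_::unit. b" "()" m] alg_mult_act[of a "\<lambda>_::unit. c" "()" m] by simp
qed

lemma alg_mult_closed: "b \<in> carrier alg \<Longrightarrow> a \<otimes>\<^bsub>alg\<^esub> b \<in> carrier alg"
  using free_space_carrier[OF free_space_amul[of "\<lambda>_::unit. b" a], of "()"]
  by (simp add: amul_def free_space_def alg_carrier)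

lemma A0_smult:
  assumes "a \<in> carrier alg" "b \<in> carrier alg"
  shows "a \<odot>\<^bsub>degree_zero_module E\<^esub> iso_class b = iso_class (a \<otimes>\<^bsub>alg\<^esub> b)"
proof -
  have "non_iso_span E +>\<^bsub>regular_module alg\<^esub> (a \<otimes>\<^bsub>alg\<^esub> c) = iso_class (a \<otimes>\<^bsub>alg\<^esub> b)" if "c \<in> iso_class b" for c
  proof -
    have "c \<in> carrier alg" "\<And>m. iso_mor E m \<Longrightarrow> c m = b m" using that by (auto simp: iso_class_def)
    then show ?thesis using rcoset_eq_iso_class[OF alg_mult_closed] alg_mult_iso_cong[of c b] iso_class_cong by metis
  qed
  moreover have "b \<in> iso_class b" using assms by (simp add: iso_class_def)
  ultimately show ?thesis
    by (auto simp: degree_zero_module_def quotient_module_def) (auto simp: regular_module_def)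
qed

lemma iso_part_carrier: "iso_part X \<in> carrier alg"
  by (simp add: iso_part_def alg_carrier iso_mor_iff)

lemma iso_part_non_iso: "\<not> iso_mor E m \<Longrightarrow> iso_part X m = 0"
  by (simp add: iso_part_def)

lemma iso_class_part: "X \<in> carrier (degree_zero_module E) \<Longrightarrow> iso_class (iso_part X) = X"
  unfolding A0_carrier by (auto simp: iso_part_class intro!: iso_class_cong)

lemma iso_part_zero: "iso_part \<zero>\<^bsub>degree_zero_module E\<^esub> = 0"
  unfolding A0_zero by (subst iso_part_class) (auto simp: alg_carrier)

lemma iso_part_add:
  assumes "X \<in> carrier (degree_zero_module E)" "Y \<in> carrier (degree_zero_module E)"
  shows "iso_part (X \<oplus>\<^bsub>degree_zero_module E\<^esub> Y) = iso_part X + iso_part Y"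
proof -
  have "X \<oplus>\<^bsub>degree_zero_module E\<^esub> Y = iso_class (iso_part X + iso_part Y)"
    using A0_add[OF iso_part_carrier[of X] iso_part_carrier[of Y]] assms by (simp add: iso_class_part)
  moreover have "iso_part X + iso_part Y \<in> carrier alg"
    using iso_part_carrier[of X] iso_part_carrier[of Y] by (simp add: alg_carrier)
  ultimately show ?thesis by (auto simp: iso_part_class iso_part_non_iso)
qed

lemma iso_part_smult:
  assumes "a \<in> carrier alg" "X \<in> carrier (degree_zero_module E)"
  shows "iso_part (a \<odot>\<^bsub>degree_zero_module E\<^esub> X) = (\<lambda>m. if iso_mor E m then (a \<otimes>\<^bsub>alg\<^esub> iso_part X) m else 0)"
  using A0_smult[OF assms(1) iso_part_carrier[of X]] iso_class_part[OF assms(2)]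
    iso_part_class[OF alg_mult_closed[OF iso_part_carrier[of X], of a]] by simp

lemma alg_mult_single: "g \<in> Mor E \<Longrightarrow> single g \<otimes>\<^bsub>alg\<^esub> a = act g (\<lambda>_::unit. a) ()"
  using fun_cong[OF amul_single[of g "\<lambda>_::unit. a"], of "()"] by (simp add: amul_def)

lemma iso_part_smult_single:
  assumes "g \<in> Aut E x" "X \<in> carrier (degree_zero_module E)"
  shows "iso_part (single g \<odot>\<^bsub>degree_zero_module E\<^esub> X) = single g \<otimes>\<^bsub>alg\<^esub> iso_part X"
proof -
  have g: "g \<in> Mor E" "inv_mor g \<in> Aut E x" using assms inv_mor_Aut by (auto simp: Aut_iff)
  have "act g (\<lambda>_::unit. iso_part X) () m = 0" if "\<not> iso_mor E m" for m
    using that g(2) act_Aut[OF assms(1), of "\<lambda>_::unit. iso_part X" "()" m]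
    by (auto simp: iso_part_non_iso iso_mor_iff Aut_iff Dom_Comp Cod_Comp)
  then show ?thesis using iso_part_smult[OF single_carrier[OF g(1)] assms(2)] 
    alg_mult_single[OF g(1), of "iso_part X"] by auto
qed

lemma iso_part_smult_single_non_iso:
  assumes "g \<in> Mor E" "\<not> iso_mor E g" "X \<in> carrier (degree_zero_module E)"
  shows "iso_part (single g \<odot>\<^bsub>degree_zero_module E\<^esub> X) = 0"
proof -
  have "act g (\<lambda>_::unit. iso_part X) () m = 0" if "iso_mor E m" for m
    unfolding act_def using that assms Comp_non_iso[of g] by (intro sum.neutral) (auto simp: iso_mor_iff)
  then show ?thesis using iso_part_smult[OF single_carrier[OF assms(1)] assms(3)] 
    alg_mult_single[OF assms(1), of "iso_part X"] by (auto simp: fun_eq_iff)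
qed

lemma iso_part_smult_scalar:
  assumes "X \<in> carrier (degree_zero_module E)"
  shows "iso_part ((\<lambda>m. if m \<in> Ident E ` Obj E then c else 0) \<odot>\<^bsub>degree_zero_module E\<^esub> X) = (\<lambda>m. c * iso_part X m)"
proof -
  have "amul E (\<lambda>m. if m \<in> Ident E ` Obj E then c else 0) (\<lambda>_::unit. iso_part X) = scl c (\<lambda>_::unit. iso_part X)"
    by (rule amul_scalar) (simp add: iso_part_def iso_mor_iff)
  then have "(\<lambda>m. if m \<in> Ident E ` Obj E then c else 0) \<otimes>\<^bsub>alg\<^esub> iso_part X = (\<lambda>m. c * iso_part X m)"
    by (auto simp: amul_def scl_def dest: fun_cong[where x = "()"])
  then show ?thesis using iso_part_smult[OF scalar_carrier assms] by (auto simp: iso_part_non_iso)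
qed

end

section \<open>Projective resolutions of the degree zero part\<close>

locale regular_resolution = skeletal_free_EI_category E
  for E :: "('o, 'm) category" (structure) +
  fixes P :: "('m \<Rightarrow> 'k::field, 'p, ('m \<Rightarrow> 'k) set) resolution"
  assumes resolution: "projective_resolution alg (degree_zero_module E) P"
    and regular: "x \<in> Obj E \<Longrightarrow> left_regular TYPE('k) E x \<or> right_regular TYPE('k) E x"
begin

lemma A0_module: "left_module (alg :: ('m \<Rightarrow> 'k) ring) (degree_zero_module E)"
  using resolution by (simp add: projective_resolution_def)

lemma alg_ring: "ring (alg :: ('m \<Rightarrow> 'k) ring)"
  using A0_module by (simp add: left_module_def)

lemma Term_projective: "projective_module alg (Term P n)"
  using resolution by (simp add: projective_resolution_def)

lemmas Term_module = Term_left_module[OF resolution]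
lemmas Diff_lmod_hom = Diff_hom[OF resolution]

lemma Diff_exact:
  "Diff P (Suc n) ` carrier (Term P (Suc (Suc n))) = {x \<in> carrier (Term P (Suc n)). Diff P n x = \<zero>\<^bsub>Term P n\<^esub>}"
  using resolution by (simp add: projective_resolution_def)

lemma Aug_hom: "Aug P \<in> lmod_hom alg (Term P 0) (degree_zero_module E)"
  using resolution by (simp add: projective_resolution_def)

text \<open>Index set, section and retraction are chosen as one triple, so that the three belong to
  the same splitting.\<close>

definition splitting where
  "splitting n = (SOME (I, s, r). s \<in> lmod_hom alg (Term P n) (free_module alg (I :: 'p set)) \<and>
     r \<in> lmod_hom alg (free_module alg I) (Term P n) \<and> (\<forall>x \<in> carrier (Term P n). r (s x) = x))"

definition index :: "nat \<Rightarrow> 'p set" where "index n = fst (splitting n)"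
definition sect :: "nat \<Rightarrow> 'p \<Rightarrow> 'p \<Rightarrow> 'm \<Rightarrow> 'k" where "sect n = fst (snd (splitting n))"

text \<open>The retraction is precomposed with the projection from the free module on the whole type \<open>'p\<close>, so
  that all terms of the resolution are summands of one module.\<close>

definition retr :: "nat \<Rightarrow> ('p \<Rightarrow> 'm \<Rightarrow> 'k) \<Rightarrow> 'p" where
  "retr n u = snd (snd (splitting n)) (\<lambda>i. if i \<in> index n then u i else 0)"

lemma splitting:
  "sect n \<in> lmod_hom alg (Term P n) (free_module alg (index n))"
  "snd (snd (splitting n)) \<in> lmod_hom alg (free_module alg (index n)) (Term P n)"
  "x \<in> carrier (Term P n) \<Longrightarrow> snd (snd (splitting n)) (sect n x) = x"
proof -
  obtain I s r where "s \<in> lmod_hom alg (Term P n) (free_module alg (I :: 'p set))"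
     "r \<in> lmod_hom alg (free_module alg I) (Term P n)" "\<forall>x \<in> carrier (Term P n). r (s x) = x"
    using Term_projective[of n] unfolding projective_module_def by blast
  then have "\<exists>t. case t of (I, s, r) \<Rightarrow> s \<in> lmod_hom alg (Term P n) (free_module alg (I :: 'p set)) \<and>
     r \<in> lmod_hom alg (free_module alg I) (Term P n) \<and> (\<forall>x \<in> carrier (Term P n). r (s x) = x)" by auto
  from someI_ex[OF this, folded splitting_def]
  show "sect n \<in> lmod_hom alg (Term P n) (free_module alg (index n))"
    "snd (snd (splitting n)) \<in> lmod_hom alg (free_module alg (index n)) (Term P n)"
    "x \<in> carrier (Term P n) \<Longrightarrow> snd (snd (splitting n)) (sect n x) = x"
    by (auto simp: sect_def index_def split: prod.splits)
qed

section \<open>Transport of the terms to \<open>free_space\<close>\<close>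

lemma free_module_carrier: "carrier (free_module alg I) = {u \<in> free_space. \<forall>i. i \<notin> I \<longrightarrow> u i = 0}"
  by (auto simp: free_module_def free_space_def alg_carrier alg_zero)

lemma free_module_add: "u \<oplus>\<^bsub>free_module alg I\<^esub> v = u + v"
  by (auto simp: free_module_def alg_add)

lemma free_module_smult: "a \<odot>\<^bsub>free_module alg I\<^esub> u = amul E a u"
  by (auto simp: free_module_def amul_def)

lemma sect_free_space: "x \<in> carrier (Term P n) \<Longrightarrow> sect n x \<in> free_space"
  using lmod_hom_closed[OF splitting(1)] by (auto simp: free_module_carrier)

lemma sect_add: "x \<in> carrier (Term P n) \<Longrightarrow> y \<in> carrier (Term P n) \<Longrightarrow> sect n (x \<oplus>\<^bsub>Term P n\<^esub> y) = sect n x + sect n y"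
  using lmod_hom_add[OF splitting(1)] by (auto simp: free_module_add)

lemma sect_smult: "a \<in> carrier alg \<Longrightarrow> x \<in> carrier (Term P n) \<Longrightarrow> sect n (a \<odot>\<^bsub>Term P n\<^esub> x) = amul E a (sect n x)"
  using lmod_hom_smult[OF splitting(1)] by (auto simp: free_module_smult)

lemma restrict_carrier: "u \<in> free_space \<Longrightarrow> (\<lambda>i. if i \<in> I then u i else 0) \<in> carrier (free_module alg I)"
  by (auto simp: free_module_carrier free_space_def intro: finite_subset[of _ "{i. u i \<noteq> 0}"])

lemma retr_closed: "u \<in> free_space \<Longrightarrow> retr n u \<in> carrier (Term P n)"
  unfolding retr_def by (intro lmod_hom_closed[OF splitting(2)] restrict_carrier)

lemma retr_add:
  assumes "u \<in> free_space" "v \<in> free_space"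
  shows "retr n (u + v) = retr n u \<oplus>\<^bsub>Term P n\<^esub> retr n v"
proof -
  have "(\<lambda>i. if i \<in> index n then (u + v) i else 0) =
      (\<lambda>i. if i \<in> index n then u i else 0) \<oplus>\<^bsub>free_module alg (index n)\<^esub> (\<lambda>i. if i \<in> index n then v i else 0)"
    by (auto simp: free_module_add fun_eq_iff)
  then show ?thesis unfolding retr_def
    using lmod_hom_add[OF splitting(2) restrict_carrier[OF assms(1)] restrict_carrier[OF assms(2)]] by simp
qed

lemma retr_amul:
  assumes "a \<in> carrier alg" "u \<in> free_space"
  shows "retr n (amul E a u) = a \<odot>\<^bsub>Term P n\<^esub> retr n u"
proof -
  have "a \<otimes>\<^bsub>alg\<^esub> 0 = 0"
    using alg_mult_act[of a "0 :: unit \<Rightarrow> _" "()"] by (simp add: act_zero fun_eq_iff)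
  then have "(\<lambda>i. if i \<in> index n then amul E a u i else 0) =
      a \<odot>\<^bsub>free_module alg (index n)\<^esub> (\<lambda>i. if i \<in> index n then u i else 0)"
    unfolding free_module_smult by (auto simp: amul_def)
  then show ?thesis unfolding retr_def
    using lmod_hom_smult[OF splitting(2) assms(1) restrict_carrier[OF assms(2)]] by simp
qed

lemma retr_sect:
  assumes x: "x \<in> carrier (Term P n)"
  shows "retr n (sect n x) = x"
proof -
  have "(\<lambda>i. if i \<in> index n then sect n x i else 0) = sect n x"
    using lmod_hom_closed[OF splitting(1) x] by (auto simp: free_module_carrier)
  then show ?thesis using splitting(3)[OF x] by (simp add: retr_def)
qed

lemma alin_induced:
  assumes "f \<in> lmod_hom alg (Term P m) (Term P n)"
  shows "alin (\<lambda>u. sect n (f (retr m u)))"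
  unfolding alin_def
  using lmod_homD[OF assms] sect_free_space sect_add sect_smult retr_closed retr_add retr_amul by auto

section \<open>The transported complex and its augmentation\<close>

definition ee :: "nat \<Rightarrow> ('p \<Rightarrow> 'm \<Rightarrow> 'k) \<Rightarrow> 'p \<Rightarrow> 'm \<Rightarrow> 'k" where
  "ee n u = sect n (retr n u)"

definition DD :: "nat \<Rightarrow> ('p \<Rightarrow> 'm \<Rightarrow> 'k) \<Rightarrow> 'p \<Rightarrow> 'm \<Rightarrow> 'k" where
  "DD n u = sect n (Diff P n (retr (Suc n) u))"

definition gen :: 'p where
  "gen = (SOME p. p \<in> carrier (Term P 0) \<and> Aug P p = iso_class \<one>\<^bsub>alg\<^esub>)"

text \<open>The section of the augmentation sends a class to its representative on isomorphisms
  times \<open>gen\<close>, a preimage of 1. It cannot be expected to be A-linear, as J kills A_0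
  but need not kill \<open>gen\<close>.\<close>

definition rho :: "('p \<Rightarrow> 'm \<Rightarrow> 'k) \<Rightarrow> 'p \<Rightarrow> 'm \<Rightarrow> 'k" where
  "rho u = amul E (iso_part (Aug P (retr 0 u))) (sect 0 gen)"

lemma gen: "gen \<in> carrier (Term P 0)" "Aug P gen = iso_class \<one>\<^bsub>alg\<^esub>"
proof -
  have "iso_class \<one>\<^bsub>alg\<^esub> \<in> carrier (degree_zero_module E :: ('m \<Rightarrow> 'k, _) module)"
    using ring.ring_simprules(6)[OF alg_ring] by (simp add: A0_carrier)
  also have "\<dots> = Aug P ` carrier (Term P 0)" using resolution by (simp add: projective_resolution_def)
  finally have "\<exists>p. p \<in> carrier (Term P 0) \<and> Aug P p = iso_class \<one>\<^bsub>alg\<^esub>" by auto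
  from someI_ex[OF this, folded gen_def]
  show "gen \<in> carrier (Term P 0)" "Aug P gen = iso_class \<one>\<^bsub>alg\<^esub>" by auto
qed

lemma sect_zero: "sect n \<zero>\<^bsub>Term P n\<^esub> = 0"
proof -
  interpret T: left_module alg "Term P n" by (rule Term_module)
  show ?thesis using sect_add[of "\<zero>\<^bsub>Term P n\<^esub>" n "\<zero>\<^bsub>Term P n\<^esub>"] by simp
qed

lemma retr_zero: "retr n 0 = \<zero>\<^bsub>Term P n\<^esub>"
proof -
  interpret T: left_module alg "Term P n" by (rule Term_module)
  show ?thesis using retr_sect[of "\<zero>\<^bsub>Term P n\<^esub>" n] sect_zero by simp
qed

lemma lin_rho: "lin rho"
  unfolding lin_def
proof (intro conjI ballI allI)
  fix u v :: "'p \<Rightarrow> 'm \<Rightarrow> 'k" and c assume u: "u \<in> free_space"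
  note A = lmod_hom_closed[OF Aug_hom retr_closed]
  show "rho u \<in> free_space" unfolding rho_def by (intro free_space_amul sect_free_space gen)
  show "rho (scl c u) = scl c (rho u)"
    using iso_part_smult_scalar[OF A[OF u], of c]
      lmod_hom_smult[OF Aug_hom scalar_carrier retr_closed[OF u], of c] retr_amul[OF scalar_carrier u, of 0 c]
    by (simp add: rho_def amul_scale_left amul_scalar_free[OF u, of c, symmetric] del: amul_scalar_free)
  assume v: "v \<in> free_space"
  show "rho (u + v) = rho u + rho v"
    using iso_part_add[OF A[OF u] A[OF v]] lmod_hom_add[OF Aug_hom retr_closed[OF u] retr_closed[OF v]] retr_add[OF u v]
    by (simp add: rho_def amul_add_left)
qed

lemma amul_mult:
  assumes "a \<in> carrier alg" "b \<in> carrier alg" "u \<in> free_space"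
  shows "amul E (a \<otimes>\<^bsub>alg\<^esub> b) u = amul E a (amul E b (u :: 'p \<Rightarrow> 'm \<Rightarrow> 'k))"
  unfolding amul_def
  by (rule ext) (intro monoid.m_assoc[OF ring.is_monoid[OF alg_ring]] assms free_space_carrier)

text \<open>The properties transfer because \<open>retr n\<close> undoes \<open>sect n\<close>:
  inner pairs cancel, and \<open>sect n\<close> is injective.\<close>

sublocale free_complex E ee DD rho
proof
  fix n and u :: "'p \<Rightarrow> 'm \<Rightarrow> 'k"
  note D = lmod_hom_closed[OF Diff_lmod_hom]
  have ee: "alin (ee n)" for n
    by (simp add: alin_def ee_def sect_free_space sect_add sect_smult retr_closed retr_add retr_amul)
  have DD: "alin (DD n)" for n using alin_induced[OF Diff_lmod_hom[of n]] by (simp add: DD_def[abs_def])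
  show "lin (ee n)" "lin (DD n)" using ee DD alin_lin by auto
  show "lin rho" by (rule lin_rho)
  show "x \<in> Obj E \<Longrightarrow> left_regular TYPE('k) E x \<or> right_regular TYPE('k) E x" for x by (rule regular)
  assume u: "u \<in> free_space"
  show "ee n (act g u) = act g (ee n u)" "DD n (act g u) = act g (DD n u)" if "g \<in> Mor E" for g
    using that u alin_act[OF ee] alin_act[OF DD] by auto
  have Du: "Diff P n (retr (Suc n) u) \<in> carrier (Term P n)" using D retr_closed[OF u] by blast
  show "ee n (DD n u) = DD n u" using retr_sect[OF Du] by (simp add: ee_def DD_def)
  show "DD n (DD (Suc n) u) = 0"
    using retr_sect[OF D[OF retr_closed[OF u]]] Diff_Diff[OF resolution retr_closed[OF u]] sect_zero by (simp add: DD_def)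
  show "\<exists>w \<in> free_space. ee (Suc n) u = DD (Suc n) w" if "DD n u = 0"
  proof -
    have "Diff P n (retr (Suc n) u) = \<zero>\<^bsub>Term P n\<^esub>"
      using that retr_sect[OF Du] retr_zero by (simp add: DD_def)
    then have "retr (Suc n) u \<in> Diff P (Suc n) ` carrier (Term P (Suc (Suc n)))"
      unfolding Diff_exact using retr_closed[OF u] by simp
    then obtain z where z: "z \<in> carrier (Term P (Suc (Suc n)))" "retr (Suc n) u = Diff P (Suc n) z" by blast
    then show ?thesis using sect_free_space[OF z(1)] retr_sect[OF z(1)]
      by (intro bexI[of _ "sect (Suc (Suc n)) z"]) (simp_all add: ee_def DD_def)
  qed
  show "rho (act g u) = act g (rho u)" if g: "g \<in> Aut E x" for g x
  proof -
    have gM: "g \<in> Mor E" using g by (simp add: Aut_iff)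
    note A = lmod_hom_closed[OF Aug_hom retr_closed[OF u]]
    have "Aug P (retr 0 (act g u)) = single g \<odot>\<^bsub>degree_zero_module E\<^esub> Aug P (retr 0 u)"
      using retr_amul[OF single_carrier[OF gM] u, of 0] lmod_hom_smult[OF Aug_hom single_carrier[OF gM] retr_closed[OF u]]
      by (simp add: amul_single[OF gM])
    then have "rho (act g u) = amul E (single g \<otimes>\<^bsub>alg\<^esub> iso_part (Aug P (retr 0 u))) (sect 0 gen)"
      using iso_part_smult_single[OF g A] by (simp add: rho_def)
    also have "\<dots> = act g (rho u)"
      using amul_mult[OF single_carrier[OF gM] iso_part_carrier sect_free_space[OF gen(1)]] amul_single[OF gM]
      by (simp add: rho_def)
    finally show ?thesis .
  qed
  have AD: "Diff P 0 ` carrier (Term P 1) = {x \<in> carrier (Term P 0). Aug P x = \<zero>\<^bsub>degree_zero_module E\<^esub>}"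
    using resolution by (simp add: projective_resolution_def)
  show "rho (DD 0 u) = 0"
  proof -
    have "Diff P 0 (retr 1 u) \<in> {x \<in> carrier (Term P 0). Aug P x = \<zero>\<^bsub>degree_zero_module E\<^esub>}"
      unfolding AD[symmetric] using retr_closed[OF u, of 1] by blast
    then show ?thesis using retr_sect[of "Diff P 0 (retr 1 u)" 0]
      by (simp add: rho_def DD_def iso_part_zero amul_zero_left)
  qed
  \<comment> \<open>Since \<open>gen\<close> maps to the class of 1, \<open>rho u\<close> and
    \<open>u\<close> have the same augmentation, and their difference is a boundary in
    \<open>Term P 0\<close>.\<close>
  show "\<exists>w \<in> free_space. ee 0 (u - rho u) = DD 0 w"
  proof -
    interpret A0: left_module alg "degree_zero_module E :: ('m \<Rightarrow> 'k, _) module" by (rule A0_module)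
    let ?X = "Aug P (retr 0 u)" and ?y = "retr 0 (u - rho u)"
    have X: "?X \<in> carrier (degree_zero_module E)" using lmod_hom_closed[OF Aug_hom retr_closed[OF u]] .
    have r: "rho u \<in> free_space" using lin_closed[OF lin_rho u] .
    have d: "u - rho u \<in> free_space" using free_space_diff[OF u r] .
    have y: "?y \<in> carrier (Term P 0)" using retr_closed[OF d] .
    have "retr 0 (rho u) = iso_part ?X \<odot>\<^bsub>Term P 0\<^esub> gen"
      using retr_amul[OF iso_part_carrier sect_free_space[OF gen(1)]] retr_sect[OF gen(1)] by (simp add: rho_def)
    then have "Aug P (retr 0 (rho u)) = iso_part ?X \<odot>\<^bsub>degree_zero_module E\<^esub> iso_class \<one>\<^bsub>alg\<^esub>"
      using lmod_hom_smult[OF Aug_hom iso_part_carrier gen(1)] gen(2) by simp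
    also have "\<dots> = iso_class (iso_part ?X \<otimes>\<^bsub>alg\<^esub> \<one>\<^bsub>alg\<^esub>)"
      by (rule A0_smult[OF iso_part_carrier]) (rule ring.ring_simprules(6)[OF alg_ring])
    also have "iso_part ?X \<otimes>\<^bsub>alg\<^esub> \<one>\<^bsub>alg\<^esub> = iso_part ?X"
      by (rule monoid.r_one[OF ring.is_monoid[OF alg_ring] iso_part_carrier])
    finally have "Aug P (retr 0 (rho u)) = ?X" using iso_class_part[OF X] by simp
    moreover have "retr 0 u = ?y \<oplus>\<^bsub>Term P 0\<^esub> retr 0 (rho u)"
      using retr_add[OF d r, of 0] by simp
    ultimately have "?X = Aug P ?y \<oplus>\<^bsub>degree_zero_module E\<^esub> ?X"
      using lmod_hom_add[OF Aug_hom y retr_closed[OF r]] by simp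
    then have "Aug P ?y = \<zero>\<^bsub>degree_zero_module E\<^esub>"
      using X lmod_hom_closed[OF Aug_hom y] by simp
    then obtain z where z: "z \<in> carrier (Term P 1)" "?y = Diff P 0 z" using AD y by blast
    then show ?thesis using sect_free_space[OF z(1)] retr_sect[OF z(1)]
      by (intro bexI[of _ "sect 1 z"]) (simp_all add: ee_def DD_def)
  qed
qed

text \<open>The cocycle is composed with the symmetrizing form of A_0, the resulting functional is
  lifted along the differential, and the lift \<open>q\<close> is turned back into an A-linear map
  by the formula of symmetric algebras, v maps to the sum of q(g^-1 v) g over the automorphisms
  g.\<close>

lemma cocycle_is_coboundary:
  assumes f: "f \<in> cocycles alg P (degree_zero_module E) (Suc (Suc n))"
  shows "f \<in> coboundaries alg P (degree_zero_module E) (Suc (Suc n))"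
proof -
  let ?A = "alg :: ('m \<Rightarrow> 'k) ring" and ?Az = "degree_zero_module E :: ('m \<Rightarrow> 'k, _) module"
  let ?N = "Suc (Suc n)"
  have fh: "f \<in> lmod_hom ?A (Term P ?N) ?Az" and f0: "\<And>x. x \<in> carrier (Term P (Suc ?N)) \<Longrightarrow> f (Diff P ?N x) = \<zero>\<^bsub>?Az\<^esub>"
    using f by (auto simp: cocycles_def)
  define l where "l u = (\<Sum>y \<in> Obj E. iso_part (f (retr ?N u)) (Ident E y))" for u
  note fc = lmod_hom_closed[OF fh retr_closed]
  have l_add: "l (u + v) = l u + l v" if "u \<in> free_space" "v \<in> free_space" for u v
    using that by (simp add: l_def retr_add lmod_hom_add[OF fh] retr_closed iso_part_add fc sum.distrib)
  have l_scl: "l (scl c u) = c * l u" if u: "u \<in> free_space" for c u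
  proof -
    have "f (retr ?N (scl c u)) = (\<lambda>m. if m \<in> Ident E ` Obj E then c else 0) \<odot>\<^bsub>?Az\<^esub> f (retr ?N u)"
      using retr_amul[OF scalar_carrier u, of ?N c] amul_scalar_free[OF u, of c]
        lmod_hom_smult[OF fh scalar_carrier retr_closed[OF u], of c] by simp
    then show ?thesis using iso_part_smult_scalar[OF fc[OF u], of c] by (simp add: l_def sum_distrib_left)
  qed
  have l_zero: "l 0 = 0" using l_scl[OF free_space_zero, of 0] by simp
  have l_sum: "l (\<Sum>a \<in> S. t a) = (\<Sum>a \<in> S. l (t a))" if "\<And>a. a \<in> S \<Longrightarrow> t a \<in> free_space"
    for S and t :: "'z \<Rightarrow> 'p \<Rightarrow> 'm \<Rightarrow> 'k"
    using that by (induction S rule: infinite_finite_induct)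
      (simp_all add: l_zero l_add free_space_sum del: plus_fun_apply zero_fun_apply)
  have l_act: "f (retr ?N (act g u)) = single g \<odot>\<^bsub>?Az\<^esub> f (retr ?N u)" if "g \<in> Mor E" "u \<in> free_space" for g u
    using retr_amul[OF single_carrier[OF that(1)] that(2), of ?N] amul_single[OF that(1), of u]
      lmod_hom_smult[OF fh single_carrier[OF that(1)] retr_closed[OF that(2)]] by simp
  \<comment> \<open>The basis element is \<open>m\<close> times another one, and a non-isomorphism
    acts as 0 on A_0.\<close>
  have l_delta: "l (delta i m) = 0" if m: "m \<in> Mor E" "\<not> iso_mor E m" for i m
  proof -
    have I: "Ident E (Dom E m) \<in> Mor E" "Cod E (Ident E (Dom E m)) = Dom E m"
      using m Dom_closed Id_closed Cod_Id by auto
    have "delta i m = act m (delta i (Ident E (Dom E m)) :: 'p \<Rightarrow> 'm \<Rightarrow> 'k)"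
      using I m Id_right[of m] by (simp add: act_delta[OF I(1)])
    then show ?thesis
      using l_act[OF m(1) free_space_delta[OF I(1), of i]] iso_part_smult_single_non_iso[OF m fc[OF free_space_delta[OF I(1), of i]]]
      by (simp add: l_def)
  qed
  have l_rad: "l u = 0" if "u \<in> radical_space" for u
  proof -
    have u: "u \<in> free_space" "\<And>i m. iso_mor E m \<Longrightarrow> u i m = 0" using that by (auto simp: radical_space_def)
    have "l (act (Ident E x) u) = 0" if x: "x \<in> Obj E" for x
    proof -
      have t: "scl (u i m) (delta i m) \<in> free_space" if "m \<in> Mor E" for i m
        using that by (intro free_space_scl free_space_delta)
      have tz: "l (scl (u i m) (delta i m)) = 0" if "m \<in> Mor E" for i m
        using that u(2)[of m i] l_delta[of m i] l_scl[OF free_space_delta[OF that, of i]] by (cases "iso_mor E m") (auto simp: l_zero)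
      have "l (act (Ident E x) u) = (\<Sum>i \<in> {i. u i \<noteq> 0}. l (\<Sum>m \<in> {m \<in> Mor E. Cod E m = x}. scl (u i m) (delta i m)))"
        unfolding act_Ident_wsum[OF u(1) x] wsum_def by (rule l_sum) (use t in \<open>auto intro!: free_space_sum\<close>)
      also have "\<dots> = (\<Sum>i \<in> {i. u i \<noteq> 0}. \<Sum>m \<in> {m \<in> Mor E. Cod E m = x}. l (scl (u i m) (delta i m)))"
        by (intro sum.cong refl l_sum) (use t in auto)
      also have "\<dots> = 0" using tz by (intro sum.neutral ballI) auto
      finally show ?thesis .
    qed
    moreover have "l u = (\<Sum>x \<in> Obj E. l (act (Ident E x) u))"
      using l_sum[of "Obj E" "\<lambda>x. act (Ident E x) u"] sum_act_Ident[of u] u(1) free_space_act Id_closed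
      by (auto simp: free_space_def)
    ultimately show ?thesis by simp
  qed
  have l_D: "l (DD ?N u) = 0" if u: "u \<in> free_space" for u
    using retr_sect[OF lmod_hom_closed[OF Diff_lmod_hom retr_closed[OF u]], of ?N] f0[OF retr_closed[OF u]]
    by (simp add: l_def DD_def iso_part_zero)
  have l_e: "l (ee ?N u) = l u" if u: "u \<in> free_space" for u
    using retr_sect[OF retr_closed[OF u]] by (simp add: l_def ee_def)
  obtain q where q: "\<And>u v. q (u + v) = q u + q v" "\<And>c u. q (scl c u) = c * q u"
    "\<And>u. u \<in> radical_space \<Longrightarrow> q u = 0" "\<And>u. u \<in> free_space \<Longrightarrow> q (DD (Suc n) u) = l u"
    by (rule functional_lift[OF l_add l_scl l_rad l_D l_e]) blast+
  have q_zero: "q 0 = 0" using q(2)[of 0 0] by simp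
  have q_sum: "q (\<Sum>a \<in> S. t a) = (\<Sum>a \<in> S. q (t a))" for S and t :: "'m \<Rightarrow> 'p \<Rightarrow> 'm \<Rightarrow> 'k"
    by (induction S rule: infinite_finite_induct) (simp_all add: q_zero q(1) del: plus_fun_apply zero_fun_apply)
  define c where "c v = (\<lambda>g. if iso_mor E g then q (act (inv_mor g) v) else 0)" for v
  have cA: "c v \<in> carrier ?A" for v by (auto simp: c_def alg_carrier iso_mor_iff)
  have c_add: "c (u + v) = c u + c v" for u v by (auto simp: c_def act_add q(1) fun_eq_iff)
  \<comment> \<open>Linearity over A holds only for the coefficients at isomorphisms, which suffices
    after passing to \<open>iso_class\<close>.\<close>
  have c_amul: "c (amul E a v) g = (a \<otimes>\<^bsub>?A\<^esub> c v) g" if v: "v \<in> free_space" and g: "iso_mor E g" for a v g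
  proof -
    define y where "y = Cod E g"
    have gA: "g \<in> Aut E y" using g by (simp add: Aut_iff iso_mor_iff y_def)
    have iA: "inv_mor g \<in> Aut E y" using inv_mor_Aut[OF gA] .
    have term_eq: "q (act (inv_mor g) (act m v)) = act m (\<lambda>_::unit. c v) () g" if m: "m \<in> Mor E" for m
    proof (cases "iso_mor E m \<and> Cod E m = y")
      case True
      then have mA: "m \<in> Aut E y" by (simp add: iso_mor_iff Aut_iff)
      have imA: "inv_mor m \<in> Aut E y" using inv_mor_Aut[OF mA] .
      have "inv_mor (inv_mor m \<cdot> g) = inv_mor g \<cdot> m"
      proof (rule inv_mor_unique)
        show "inv_mor m \<cdot> g \<in> Aut E y" "inv_mor g \<cdot> m \<in> Aut E y"
          using imA gA iA mA by (auto intro: Aut_Comp_closed)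
        have "(inv_mor g \<cdot> m) \<cdot> (inv_mor m \<cdot> g) = inv_mor g \<cdot> (m \<cdot> (inv_mor m \<cdot> g))"
          using imA gA iA mA by (intro Comp_assoc) (auto simp: Aut_iff Comp_closed Cod_Comp)
        also have "m \<cdot> (inv_mor m \<cdot> g) = g" using gA by (intro inv_mor_Comp_cancel(2)[OF mA]) (auto simp: Aut_iff)
        finally show "(inv_mor g \<cdot> m) \<cdot> (inv_mor m \<cdot> g) = Ident E y" using inv_mor_left[OF gA] by simp
      qed
      moreover have "iso_mor E (inv_mor m \<cdot> g)" using Aut_Comp_closed[OF imA gA] by (simp add: Aut_iff iso_mor_iff)
      moreover have "act (inv_mor g) (act m v) = act (inv_mor g \<cdot> m) v"
        using iA mA by (intro act_Comp) (auto simp: Aut_iff)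
      ultimately show ?thesis using act_Aut[OF mA, of "\<lambda>_::unit. c v" "()" g] gA by (simp add: c_def Aut_iff)
    next
      case False
      have "act m (\<lambda>_::unit. c v) () g = 0"
        unfolding act_def using False g m Comp_non_iso[of m]
        by (intro sum.neutral) (auto simp: iso_mor_iff y_def Cod_Comp)
      \<comment> \<open>Either the arrows do not compose, or \<open>m\<close> is a non-isomorphism,
        the product lies in the radical and \<open>q\<close> vanishes there.\<close>
      moreover have "q (act (inv_mor g) (act m v)) = 0"
      proof (cases "Cod E m = y")
        case True
        then have n: "\<not> iso_mor E m" using False by blast
        have "act (inv_mor g) (act m v) = act (inv_mor g \<cdot> m) v"
          using iA m True by (intro act_Comp) (auto simp: Aut_iff)
        moreover have "act (inv_mor g \<cdot> m) v \<in> radical_space"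
          using iA m n True v Comp_non_iso[of "inv_mor g" m]
          by (intro radical_space_act) (auto simp: Aut_iff Comp_closed iso_mor_iff)
        ultimately show ?thesis using q(3) by simp
      next
        case False
        then show ?thesis using act_act_zero[OF m, of "inv_mor g" v] iA q_zero by (auto simp: Aut_iff)
      qed
      ultimately show ?thesis by simp
    qed
    have "c (amul E a v) g = q (\<Sum>m \<in> Mor E. scl (a m) (act (inv_mor g) (act m v)))"
      using g by (simp add: c_def amul_sum act_sum act_scl)
    also have "\<dots> = (\<Sum>m \<in> Mor E. a m * act m (\<lambda>_::unit. c v) () g)"
      unfolding q_sum by (intro sum.cong refl) (simp add: q(2) term_eq)
    also have "\<dots> = (a \<otimes>\<^bsub>?A\<^esub> c v) g" using alg_mult_act[of a "\<lambda>_::unit. c v" "()" g] by simp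
    finally show ?thesis .
  qed
  define h where "h = (\<lambda>x \<in> carrier (Term P (Suc n)). iso_class (c (sect (Suc n) x)))"
  interpret T: left_module ?A "Term P (Suc n)" by (rule Term_module)
  have hh: "h \<in> lmod_hom ?A (Term P (Suc n)) ?Az"
  proof (rule lmod_homI)
    show "h x \<in> carrier ?Az" if "x \<in> carrier (Term P (Suc n))" for x
      using that cA by (simp add: h_def A0_carrier)
    show "h (x \<oplus>\<^bsub>Term P (Suc n)\<^esub> y) = h x \<oplus>\<^bsub>?Az\<^esub> h y"
      if "x \<in> carrier (Term P (Suc n))" "y \<in> carrier (Term P (Suc n))" for x y
      using that by (simp add: h_def A0_add[OF cA cA] sect_add c_add)
    show "h (a \<odot>\<^bsub>Term P (Suc n)\<^esub> x) = a \<odot>\<^bsub>?Az\<^esub> h x"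
      if ax: "a \<in> carrier ?A" "x \<in> carrier (Term P (Suc n))" for a x
    proof -
      have "iso_class (c (amul E a (sect (Suc n) x))) = iso_class (a \<otimes>\<^bsub>?A\<^esub> c (sect (Suc n) x))"
        by (rule iso_class_cong) (rule c_amul[OF sect_free_space[OF ax(2)]])
      then show ?thesis
        using ax A0_smult[OF ax(1) cA] by (simp add: h_def sect_smult T.smult_closed)
    qed
  qed (simp add: h_def)
  have "h (Diff P (Suc n) x) = f x" if x: "x \<in> carrier (Term P ?N)" for x
  proof -
    let ?v = "sect ?N x"
    have v: "?v \<in> free_space" using sect_free_space[OF x] .
    have Dx: "Diff P (Suc n) x \<in> carrier (Term P (Suc n))" using lmod_hom_closed[OF Diff_lmod_hom x] .
    have sD: "sect (Suc n) (Diff P (Suc n) x) = DD (Suc n) ?v" using retr_sect[OF x] by (simp add: DD_def)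
    have fx: "f x \<in> carrier ?Az" using lmod_hom_closed[OF fh x] .
    have "c (DD (Suc n) ?v) g = iso_part (f x) g" if g: "iso_mor E g" for g
    proof -
      define y where "y = Cod E g"
      have gA: "g \<in> Aut E y" using g by (simp add: Aut_iff iso_mor_iff y_def)
      have y: "y \<in> Obj E" using g Cod_closed by (simp add: y_def iso_mor_iff)
      have iA: "inv_mor g \<in> Aut E y" using inv_mor_Aut[OF gA] .
      then have iM: "inv_mor g \<in> Mor E" by (simp add: Aut_iff)
      \<comment> \<open>The form applied to g^-1 times an element of A_0 is the coefficient of that
        element at \<open>g\<close>; this is why the inverse occurs in \<open>c\<close>.\<close>
      have "c (DD (Suc n) ?v) g = q (DD (Suc n) (act (inv_mor g) ?v))"
        using g iM v D_act by (simp add: c_def)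
      also have "\<dots> = l (act (inv_mor g) ?v)" using q(4) free_space_act[OF iM v] by simp
      also have "\<dots> = (\<Sum>z \<in> Obj E. (single (inv_mor g) \<otimes>\<^bsub>?A\<^esub> iso_part (f x)) (Ident E z))"
        using l_act[OF iM v] retr_sect[OF x] iso_part_smult_single[OF iA fx] by (simp add: l_def)
      also have "\<dots> = (\<Sum>z \<in> Obj E. if z = y then iso_part (f x) g else 0)"
      proof (intro sum.cong refl)
        fix z assume z: "z \<in> Obj E"
        have "g \<cdot> Ident E y = g" using Id_right[of g] gA by (auto simp: Aut_iff)
        then show "(single (inv_mor g) \<otimes>\<^bsub>?A\<^esub> iso_part (f x)) (Ident E z) = (if z = y then iso_part (f x) g else 0)"
          using act_Aut[OF iA, of "\<lambda>_::unit. iso_part (f x)" "()" "Ident E z"] alg_mult_single[OF iM, of "iso_part (f x)"]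
            inv_mor_inv_mor[OF gA] z by (simp add: Id_closed Cod_Id)
      qed
      also have "\<dots> = iso_part (f x) g" using finite_Obj y by (simp add: sum.delta)
      finally show ?thesis .
    qed
    then have "iso_class (c (DD (Suc n) ?v)) = iso_class (iso_part (f x))" by (rule iso_class_cong)
    then show ?thesis using Dx sD iso_class_part[OF fx] by (simp add: h_def)
  qed
  then have "f = compose (carrier (Term P ?N)) h (Diff P (Suc n))"
    using lmod_hom_extensional[OF fh] by (auto simp: compose_def fun_eq_iff extensional_def)
  then show ?thesis using hh by (auto simp: coboundaries_def)
qed

end

theorem theorem1p5:
  fixes E :: "('o, 'm) category"
  assumes "finite_free_EI_category E"
    and "skeletal E"
    and "connected_category E"
    and "\<forall>x \<in> Obj E. left_regular TYPE('k::alg_closed_field) E x \<or> right_regular TYPE('k) E x"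
  shows "quasi_koszul TYPE('p) (category_algebra E :: ('m \<Rightarrow> 'k) ring) (degree_zero_module E)"
proof (rule quasi_koszul_if_higher_Ext_vanish)
  fix P :: "('m \<Rightarrow> 'k, 'p, ('m \<Rightarrow> 'k) set) resolution" and n
  assume P: "projective_resolution (category_algebra E) (degree_zero_module E) P"
  interpret finite_free_EI_category E by fact
  interpret regular_resolution E P
    using assms P by unfold_locales auto
  show "cocycles (category_algebra E) P (degree_zero_module E) (Suc (Suc n))
      \<subseteq> coboundaries (category_algebra E) P (degree_zero_module E) (Suc (Suc n))"
    using cocycle_is_coboundary by blast
qed

end
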